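(* Let $G$ be a finite group and let $$\mathcal S_2(G):=\left\{S\subseteq\operatorname{Sub}_{\mathrm{ncc}}(G)^c\ \middle|\ 2e_S\in\Omega(G)\right\}.$$ Then $$\mathcal U_{\mathrm{core}}(G)=\left\{1_{\Omega(G)}-2e_S\ \middle|\ S\in\mathcal S_2(G)\right\}.$$ Moreover, $\mathcal S_2(G)$ is an $\mathbb F_2$-vector space with symmetric difference as addition.
   Context: For a finite group $G$, $\Omega(G)$ is the Burnside ring (Grothendieck ring of finite $G$-sets), with $\mathbb Z$-basis $[G/H]$, $(H)$ running over the set $\operatorname{Sub}(G)^c$ of conjugacy classes of subgroups of $G$, and $1_{\Omega(G)}=[G/G]$. For $K\le G$, the mark $\varphi_K^G:\Omega(G)\to\mathbb Z$ is the ring homomorphism $[X]\mapsto\#X^K$. After tensoring with $\mathbb Q$, the marks give a $\mathbb Q$-algebra isomorphism $\mathbb Q\Omega(G)\cong\prod_{(H)\in\operatorname{Sub}(G)^c}\mathbb Q$; $e_H^G\in\mathbb Q\Omega(G)$ is the primitive idempotent with $\varphi_K^G(e_H^G)=1$ if $(K)=(H)$ and $0$ otherwise. For $S\subseteq\operatorname{Sub}(G)^c$, $e_S:=\sum_{(H)\in S}e_H^G$. $\Omega(G)$ is regarded as a subring of $\mathbb Q\Omega(G)$. $\operatorname{core}_G(H)=\bigcap_{g\in G}gHg^{-1}$. $\operatorname{Sub}_{\mathrm{ncc}}(G)$ is the set of subgroups $H\le G$ with $H/\operatorname{core}_G(H)$ noncyclic, and $\operatorname{Sub}_{\mathrm{ncc}}(G)^c$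 the set of their $G$-conjugacy classes. $\mathfrak n_G:\Omega(G)\to\Omega(G)$ is the additive map with $\mathfrak n_G([G/H])=[G/\operatorname{core}_G(H)]$, and $\mathcal U_{\mathrm{core}}(G):=\{u\in\Omega(G)^\times\mid\mathfrak n_G(u)=1_{\Omega(G)}\}$. *)

theory Defs
  imports
    "HOL-Algebra.Module"
    "HOL-Algebra.Group_Action"
    "HOL-Algebra.Elementary_Groups"
    "HOL-Algebra.Left_Coset"
    "HOL-Number_Theory.Residues"
begin

section \<open>Subgroups up to conjugacy\<close>

definition conj_class :: "('a, 'm) monoid_scheme \<Rightarrow> 'a set \<Rightarrow> 'a set set" where
  "conj_class G H = {g <#\<^bsub>G\<^esub> H #>\<^bsub>G\<^esub> inv\<^bsub>G\<^esub> g | g. g \<in> carrier G}"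

definition normal_core :: "('a, 'm) monoid_scheme \<Rightarrow> 'a set \<Rightarrow> 'a set" where
  "normal_core G H = (\<Inter>g\<in>carrier G. g <#\<^bsub>G\<^esub> H #>\<^bsub>G\<^esub> inv\<^bsub>G\<^esub> g)"

definition ncc_subgroups :: "('a, 'm) monoid_scheme \<Rightarrow> 'a set set" where
  "ncc_subgroups G =
     {H. subgroup H G \<and> \<not> cyclic_group ((G\<lparr>carrier := H\<rparr>) Mod (normal_core G H))}"

definition ncc_classes :: "('a, 'm) monoid_scheme \<Rightarrow> 'a set set set" where
  "ncc_classes G = conj_class G ` ncc_subgroups G"


section \<open>The semiring of isomorphism classes of finite G-sets\<close>

definition gset_iso ::
  "('a, 'm) monoid_scheme \<Rightarrow> 'x set \<Rightarrow> ('a \<Rightarrow> 'x \<Rightarrow> 'x) \<Rightarrow> 'y set \<Rightarrow> ('a \<Rightarrow> 'y \<Rightarrow> 'y) \<Rightarrow> bool" where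
  "gset_iso G E \<alpha> F \<beta> \<longleftrightarrow>
     (\<exists>f. bij_betw f E F \<and> (\<forall>g\<in>carrier G. \<forall>x\<in>E. f (\<alpha> g x) = \<beta> g (f x)))"

text \<open>
  Every finite \<open>G\<close>-set is isomorphic to one whose underlying set consists of natural numbers.
  The isomorphism class of a finite \<open>G\<close>-set, over whatever type, is therefore represented by the
  set of all isomorphic finite \<open>G\<close>-sets on sets of naturals.
\<close>

type_synonym 'a gset = "nat set \<times> ('a \<Rightarrow> nat \<Rightarrow> nat)"

definition gset_class ::
  "('a, 'm) monoid_scheme \<Rightarrow> 'x set \<Rightarrow> ('a \<Rightarrow> 'x \<Rightarrow> 'x) \<Rightarrow> 'a gset set" where
  "gset_class G E \<alpha> =
     {(F, \<beta>). finite F \<and> group_action G F \<beta> \<and> gset_iso G E \<alpha> F \<beta>}"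

text \<open>
  The actions below are restricted to their underlying sets because \<^term>\<open>group_action\<close> takes
  values in the extensional bijections.
\<close>

definition sum_action ::
  "'x set \<Rightarrow> ('a \<Rightarrow> 'x \<Rightarrow> 'x) \<Rightarrow> 'y set \<Rightarrow> ('a \<Rightarrow> 'y \<Rightarrow> 'y) \<Rightarrow> 'a \<Rightarrow> 'x + 'y \<Rightarrow> 'x + 'y" where
  "sum_action E \<alpha> F \<beta> = (\<lambda>g. \<lambda>z \<in> Sum_Type.Plus E F. map_sum (\<alpha> g) (\<beta> g) z)"

definition prod_action ::
  "'x set \<Rightarrow> ('a \<Rightarrow> 'x \<Rightarrow> 'x) \<Rightarrow> 'y set \<Rightarrow> ('a \<Rightarrow> 'y \<Rightarrow> 'y) \<Rightarrow> 'a \<Rightarrow> 'x \<times> 'y \<Rightarrow> 'x \<times> 'y" where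
  "prod_action E \<alpha> F \<beta> = (\<lambda>g. \<lambda>z \<in> E \<times> F. map_prod (\<alpha> g) (\<beta> g) z)"

definition coset_gset_class :: "('a, 'm) monoid_scheme \<Rightarrow> 'a set \<Rightarrow> 'a gset set" where
  "coset_gset_class G H =
     gset_class G (lcosets\<^bsub>G\<^esub> H) (\<lambda>g. \<lambda>C \<in> lcosets\<^bsub>G\<^esub> H. g <#\<^bsub>G\<^esub> C)"

text \<open>
  Operations on classes are written as unions over all choices of representatives; since the
  isomorphism class of the result does not depend on the choice, the union is that single class.
  The same device is used for the two further quotient constructions.
\<close>

definition gset_semiring :: "('a, 'm) monoid_scheme \<Rightarrow> 'a gset set ring" where
  "gset_semiring G =
     \<lparr>carrier = {gset_class G E \<alpha> | (E :: nat set) \<alpha>. finite E \<and> group_action G E \<alpha>},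
      monoid.mult = (\<lambda>a b. \<Union>(E, \<alpha>)\<in>a. \<Union>(F, \<beta>)\<in>b. gset_class G (E \<times> F) (prod_action E \<alpha> F \<beta>)),
      one = coset_gset_class G (carrier G),
      zero = gset_class G ({} :: nat set) (\<lambda>g. \<lambda>x \<in> {}. x),
      add = (\<lambda>a b. \<Union>(E, \<alpha>)\<in>a. \<Union>(F, \<beta>)\<in>b. gset_class G (Sum_Type.Plus E F) (sum_action E \<alpha> F \<beta>))\<rparr>"


section \<open>The Grothendieck ring of a commutative semiring\<close>

definition groth_rel :: "('s, 'm) ring_scheme \<Rightarrow> (('s \<times> 's) \<times> ('s \<times> 's)) set" where
  "groth_rel R =
     {((a, b), (c, d)). a \<in> carrier R \<and> b \<in> carrier R \<and> c \<in> carrier R \<and> d \<in> carrier R \<and>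
        (\<exists>z\<in>carrier R. a \<oplus>\<^bsub>R\<^esub> d \<oplus>\<^bsub>R\<^esub> z = c \<oplus>\<^bsub>R\<^esub> b \<oplus>\<^bsub>R\<^esub> z)}"

text \<open>The class of \<open>(a, b)\<close> stands for the formal difference \<open>a - b\<close>.\<close>

definition groth_ring :: "('s, 'm) ring_scheme \<Rightarrow> ('s \<times> 's) set ring" where
  "groth_ring R =
     \<lparr>carrier = (carrier R \<times> carrier R) // groth_rel R,
      monoid.mult = (\<lambda>P Q. \<Union>(a, b)\<in>P. \<Union>(c, d)\<in>Q.
        groth_rel R `` {(a \<otimes>\<^bsub>R\<^esub> c \<oplus>\<^bsub>R\<^esub> b \<otimes>\<^bsub>R\<^esub> d, a \<otimes>\<^bsub>R\<^esub> d \<oplus>\<^bsub>R\<^esub> b \<otimes>\<^bsub>R\<^esub> c)}),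
      one = groth_rel R `` {(\<one>\<^bsub>R\<^esub>, \<zero>\<^bsub>R\<^esub>)},
      zero = groth_rel R `` {(\<zero>\<^bsub>R\<^esub>, \<zero>\<^bsub>R\<^esub>)},
      add = (\<lambda>P Q. \<Union>(a, b)\<in>P. \<Union>(c, d)\<in>Q. groth_rel R `` {(a \<oplus>\<^bsub>R\<^esub> c, b \<oplus>\<^bsub>R\<^esub> d)})\<rparr>"


section \<open>Tensoring a commutative ring with the rationals\<close>

text \<open>
  The tensor product of \<open>\<rat>\<close> and \<open>R\<close> over \<open>\<int>\<close> is the localization of \<open>R\<close> at the nonzero
  integers; the class of \<open>(x, m)\<close> stands for the fraction \<open>x/m\<close>.
\<close>

definition rat_rel :: "('r, 'm) ring_scheme \<Rightarrow> (('r \<times> int) \<times> ('r \<times> int)) set" where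
  "rat_rel R =
     {((x, m), (y, n)). x \<in> carrier R \<and> y \<in> carrier R \<and> m \<noteq> 0 \<and> n \<noteq> 0 \<and>
        (\<exists>k::int. k \<noteq> 0 \<and> [k] \<cdot>\<^bsub>R\<^esub> ([n] \<cdot>\<^bsub>R\<^esub> x \<ominus>\<^bsub>R\<^esub> [m] \<cdot>\<^bsub>R\<^esub> y) = \<zero>\<^bsub>R\<^esub>)}"

definition rat_ring :: "('r, 'm) ring_scheme \<Rightarrow> ('r \<times> int) set ring" where
  "rat_ring R =
     \<lparr>carrier = (carrier R \<times> {m. m \<noteq> 0}) // rat_rel R,
      monoid.mult = (\<lambda>P Q. \<Union>(x, m)\<in>P. \<Union>(y, n)\<in>Q. rat_rel R `` {(x \<otimes>\<^bsub>R\<^esub> y, m * n)}),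
      one = rat_rel R `` {(\<one>\<^bsub>R\<^esub>, 1)},
      zero = rat_rel R `` {(\<zero>\<^bsub>R\<^esub>, 1)},
      add = (\<lambda>P Q. \<Union>(x, m)\<in>P. \<Union>(y, n)\<in>Q.
        rat_rel R `` {([n] \<cdot>\<^bsub>R\<^esub> x \<oplus>\<^bsub>R\<^esub> [m] \<cdot>\<^bsub>R\<^esub> y, m * n)})\<rparr>"

definition to_rat :: "('r, 'm) ring_scheme \<Rightarrow> 'r \<Rightarrow> ('r \<times> int) set" where
  "to_rat R x = rat_rel R `` {(x, 1)}"


section \<open>The Burnside ring, marks and idempotents\<close>

type_synonym 'a burnside = "('a gset set \<times> 'a gset set) set"
type_synonym 'a rat_burnside = "('a burnside \<times> int) set"

definition burnside_ring :: "('a, 'm) monoid_scheme \<Rightarrow> 'a burnside ring" where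
  "burnside_ring G = groth_ring (gset_semiring G)"

definition rat_burnside_ring :: "('a, 'm) monoid_scheme \<Rightarrow> 'a rat_burnside ring" where
  "rat_burnside_ring G = rat_ring (burnside_ring G)"

abbreviation burnside_to_rat ::
  "('a, 'm) monoid_scheme \<Rightarrow> 'a burnside \<Rightarrow> 'a rat_burnside" where
  "burnside_to_rat G \<equiv> to_rat (burnside_ring G)"

definition coset_elt :: "('a, 'm) monoid_scheme \<Rightarrow> 'a set \<Rightarrow> 'a burnside" where
  "coset_elt G H =
     groth_rel (gset_semiring G) `` {(coset_gset_class G H, \<zero>\<^bsub>gset_semiring G\<^esub>)}"

text \<open>
  The mark of \<open>K\<close> counts \<open>K\<close>-fixed points. It is defined on isomorphism classes, then on formal
  differences, then on fractions; each time it takes the same value on all representatives of a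
  class.
\<close>

definition gset_mark :: "'a set \<Rightarrow> 'a gset set \<Rightarrow> nat" where
  "gset_mark K a = the_elem ((\<lambda>(E, \<alpha>). card {x \<in> E. \<forall>k\<in>K. \<alpha> k x = x}) ` a)"

definition burnside_mark :: "'a set \<Rightarrow> 'a burnside \<Rightarrow> int" where
  "burnside_mark K P = the_elem ((\<lambda>(a, b). int (gset_mark K a) - int (gset_mark K b)) ` P)"

definition rat_burnside_mark :: "'a set \<Rightarrow> 'a rat_burnside \<Rightarrow> rat" where
  "rat_burnside_mark K q =
     the_elem ((\<lambda>(x, m). of_int (burnside_mark K x) / of_int m) ` q)"

text \<open>
  The argument \<open>C\<close> is a conjugacy class of subgroups. The element is unique because the marks are
  jointly injective, and it is the primitive idempotent belonging to \<open>C\<close> because they identify the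
  rational Burnside ring with a product of copies of \<open>\<rat>\<close> indexed by the conjugacy classes.
\<close>

definition class_idem :: "('a, 'm) monoid_scheme \<Rightarrow> 'a set set \<Rightarrow> 'a rat_burnside" where
  "class_idem G C =
     (THE x. x \<in> carrier (rat_burnside_ring G) \<and>
        (\<forall>K. subgroup K G \<longrightarrow> rat_burnside_mark K x = (if K \<in> C then 1 else 0)))"

definition set_idem :: "('a, 'm) monoid_scheme \<Rightarrow> 'a set set set \<Rightarrow> 'a rat_burnside" where
  "set_idem G S = (\<Oplus>\<^bsub>rat_burnside_ring G\<^esub> C \<in> S. class_idem G C)"


section \<open>The core map, its units, and the set of admissible families\<close>

text \<open>
  The classes of the transitive \<open>G\<close>-sets form a basis of the Burnside ring, so there is exactly one
  such map once its values outside the carrier are fixed.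
\<close>

definition core_map :: "('a, 'm) monoid_scheme \<Rightarrow> 'a burnside \<Rightarrow> 'a burnside" where
  "core_map G =
     (THE f. f \<in> extensional (carrier (burnside_ring G)) \<and>
        f \<in> hom (add_monoid (burnside_ring G)) (add_monoid (burnside_ring G)) \<and>
        (\<forall>H. subgroup H G \<longrightarrow> f (coset_elt G H) = coset_elt G (normal_core G H)))"

definition core_units :: "('a, 'm) monoid_scheme \<Rightarrow> 'a burnside set" where
  "core_units G = {u \<in> Units (burnside_ring G). core_map G u = \<one>\<^bsub>burnside_ring G\<^esub>}"

definition S2 :: "('a, 'm) monoid_scheme \<Rightarrow> 'a set set set set" where
  "S2 G = {S. S \<subseteq> ncc_classes G \<and>
     [(2::int)] \<cdot>\<^bsub>rat_burnside_ring G\<^esub> (set_idem G S)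
       \<in> burnside_to_rat G ` carrier (burnside_ring G)}"

text \<open>
  The fields \<open>mult\<close> and \<open>one\<close> come with the record type and play no role in a module. The scalars
  are \<open>0\<close> and \<open>1\<close>, so the scalar multiplication is forced.
\<close>

definition S2_space :: "('a, 'm) monoid_scheme \<Rightarrow> (int, 'a set set set) module" where
  "S2_space G =
     \<lparr>carrier = S2 G,
      monoid.mult = undefined,
      one = undefined,
      zero = {},
      add = (\<lambda>S T. sym_diff S T),
      smult = (\<lambda>c S. if c = 0 then {} else S)\<rparr>"

end

(*
  The marks identify the semiring of finite G-sets, its Grothendieck ring and the rationalization
  of the latter with rings of functions on the subgroups of G; injectivity holds because two finite
  G-sets with equal marks have isomorphic orbits of a maximal stabilizer, which can be removed. So a
  unit u has marks 1 and -1, i.e. u = 1 - 2 e_S, and what has to be shown is that the core map sends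
  u to 1 if and only if u has mark 1 at every K with K / core(K) cyclic. For a normal subgroup N,
  let D(N) be the sum of |stab x| over the points x of the virtual G-set u - 1 whose stabilizer has
  core N. The core map sends u to 1 iff all D(N) vanish, iff all sums of D(M) over the normal M
  containing N vanish. By Burnside's lemma such a sum is the sum over g in G of the marks of u - 1
  at the subgroups <N, g>. These marks are all <= 0, so the sum vanishes iff each of them does, and
  the subgroups <N, g> are exactly the K with K / core(K) cyclic.
*)

theory Submission
  imports Defs
begin

section \<open>Rings of functions\<close>

text \<open>The Burnside ring is a nested quotient whose operations are unions over representatives,
  so at the start neither the ring laws nor independence of representatives are available. Both are
  read off from marks: injectivity at each layer turns an identity into one between numbers. The
  core map is additive but not multiplicative, so it cannot be treated as a ring map between rings
  of functions. Its marks are instead weights: sums over the points of a G-set of a function of the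
  stabilizer. Ordinary marks are weights too, and linear relations between weights can be checked
  one subgroup at a time. The weight |stab x| is chosen because each of the |G : H| points of G/H
  contributes |H|, in total |G| for every H. So D(N) is |G| times the signed number of orbits of u -
  1 with core N, which is |G| times the coefficient of [G/N] in the image of u - 1 under the core
  map.\<close>

locale ring_embedding =
  fixes R (structure) and \<phi> :: "'r \<Rightarrow> 'k \<Rightarrow> 'b::comm_ring_1"
  assumes emb_inj: "\<lbrakk>x \<in> carrier R; y \<in> carrier R; \<And>k. \<phi> x k = \<phi> y k\<rbrakk> \<Longrightarrow> x = y"
    and emb_add_closed: "\<lbrakk>x \<in> carrier R; y \<in> carrier R\<rbrakk> \<Longrightarrow> x \<oplus> y \<in> carrier R"
    and emb_mult_closed: "\<lbrakk>x \<in> carrier R; y \<in> carrier R\<rbrakk> \<Longrightarrow> x \<otimes> y \<in> carrier R"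
    and emb_zero_closed: "\<zero> \<in> carrier R"
    and emb_one_closed: "\<one> \<in> carrier R"
    and emb_add: "\<lbrakk>x \<in> carrier R; y \<in> carrier R\<rbrakk> \<Longrightarrow> \<phi> (x \<oplus> y) k = \<phi> x k + \<phi> y k"
    and emb_mult: "\<lbrakk>x \<in> carrier R; y \<in> carrier R\<rbrakk> \<Longrightarrow> \<phi> (x \<otimes> y) k = \<phi> x k * \<phi> y k"
    and emb_zero: "\<phi> \<zero> k = 0"
    and emb_one: "\<phi> \<one> k = 1"
    and emb_neg: "x \<in> carrier R \<Longrightarrow> \<exists>y\<in>carrier R. \<forall>k. \<phi> y k = - \<phi> x k"
begin

text \<open>Each axiom holds for the values of \<open>\<phi>\<close> in a commutative ring and is
  pulled back by injectivity. Inverses are assumed through their values in \<open>emb_neg\<close>,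
  because \<open>\<ominus>\<close> is meaningful only once \<open>R\<close> is known to be a
  group.\<close>

lemma cring_axioms_emb: "cring R"
proof (rule cringI)
  show "abelian_group R"
  proof (rule abelian_groupI)
    fix x assume x: "x \<in> carrier R"
    then obtain y where y: "y \<in> carrier R" "\<forall>k. \<phi> y k = - \<phi> x k"
      using emb_neg by blast
    then have "y \<oplus> x = \<zero>"
      by (intro emb_inj) (simp_all add: x emb_add_closed emb_zero_closed emb_add emb_zero)
    then show "\<exists>y\<in>carrier R. y \<oplus> x = \<zero>" using y by blast
  qed (auto intro!: emb_inj simp: emb_add_closed emb_zero_closed emb_add emb_zero algebra_simps)
  show "comm_monoid R"
    by (rule comm_monoidI)
      (auto intro!: emb_inj simp: emb_mult_closed emb_one_closed emb_mult emb_one algebra_simps)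
qed (auto intro!: emb_inj
      simp: emb_add_closed emb_mult_closed emb_add emb_mult algebra_simps)

sublocale cring R
  by (rule cring_axioms_emb)

lemma emb_a_inv:
  assumes "x \<in> carrier R"
  shows "\<phi> (\<ominus> x) k = - \<phi> x k"
proof -
  have "\<phi> (\<ominus> x \<oplus> x) k = 0" using assms by (simp add: l_neg emb_zero)
  then show ?thesis using assms by (simp add: emb_add add_eq_0_iff2)
qed

lemma emb_minus:
  "\<lbrakk>x \<in> carrier R; y \<in> carrier R\<rbrakk> \<Longrightarrow> \<phi> (x \<ominus> y) k = \<phi> x k - \<phi> y k"
  by (simp add: a_minus_def emb_add emb_a_inv)

lemma emb_nat_pow:
  assumes "x \<in> carrier R"
  shows "\<phi> ([(n::nat)] \<cdot> x) k = of_nat n * \<phi> x k"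
  by (induction n) (simp_all add: assms emb_zero emb_add algebra_simps)

lemma emb_int_pow:
  assumes "x \<in> carrier R"
  shows "\<phi> ([(n::int)] \<cdot> x) k = of_int n * \<phi> x k"
proof (cases "0 \<le> n")
  case True
  then have "[n] \<cdot> x = [nat n] \<cdot> x"
    by (metis add_pow_int_ge)
  then show ?thesis using True by (simp add: assms emb_nat_pow)
next
  case False
  then have "[n] \<cdot> x = \<ominus> ([nat (- n)] \<cdot> x)"
    by (simp add: add_pow_int_lt)
  then show ?thesis using False by (simp add: assms emb_nat_pow emb_a_inv)
qed

lemma int_pow_closed: "x \<in> carrier R \<Longrightarrow> [(n::int)] \<cdot> x \<in> carrier R"
  using add.int_pow_closed by blast

lemma emb_finsum:
  assumes "finite A" and "\<And>a. a \<in> A \<Longrightarrow> f a \<in> carrier R"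
  shows "\<phi> (\<Oplus>a\<in>A. f a) k = (\<Sum>a\<in>A. \<phi> (f a) k)"
  using assms
proof (induction A)
  case (insert a A)
  then have "(\<Oplus>b\<in>insert a A. f b) = f a \<oplus> (\<Oplus>b\<in>A. f b)"
    by (intro finsum_insert) auto
  moreover have "(\<Oplus>b\<in>A. f b) \<in> carrier R"
    using insert by (intro finsum_closed) auto
  ultimately show ?case using insert by (simp add: emb_add)
qed (simp add: emb_zero)

end

locale semiring_embedding =
  fixes S (structure) and \<mu> :: "'s \<Rightarrow> 'k \<Rightarrow> nat"
  assumes semi_inj: "\<lbrakk>x \<in> carrier S; y \<in> carrier S; \<And>k. \<mu> x k = \<mu> y k\<rbrakk> \<Longrightarrow> x = y"
    and semi_add_closed [simp]: "\<lbrakk>x \<in> carrier S; y \<in> carrier S\<rbrakk> \<Longrightarrow> x \<oplus> y \<in> carrier S"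
    and semi_mult_closed [simp]: "\<lbrakk>x \<in> carrier S; y \<in> carrier S\<rbrakk> \<Longrightarrow> x \<otimes> y \<in> carrier S"
    and semi_zero_closed [simp]: "\<zero> \<in> carrier S"
    and semi_one_closed [simp]: "\<one> \<in> carrier S"
    and semi_add: "\<lbrakk>x \<in> carrier S; y \<in> carrier S\<rbrakk> \<Longrightarrow> \<mu> (x \<oplus> y) k = \<mu> x k + \<mu> y k"
    and semi_mult: "\<lbrakk>x \<in> carrier S; y \<in> carrier S\<rbrakk> \<Longrightarrow> \<mu> (x \<otimes> y) k = \<mu> x k * \<mu> y k"
    and semi_zero: "\<mu> \<zero> k = 0"
    and semi_one: "\<mu> \<one> k = 1"


section \<open>The Grothendieck ring\<close>

definition groth_diff :: "('s, 'm) ring_scheme \<Rightarrow> 's \<Rightarrow> 's \<Rightarrow> ('s \<times> 's) set" where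
  "groth_diff S a b = groth_rel S `` {(a, b)}"

definition groth_ext :: "('s \<Rightarrow> 'b::ab_group_add) \<Rightarrow> ('s \<times> 's) set \<Rightarrow> 'b" where
  "groth_ext h P = the_elem ((\<lambda>(a, b). h a - h b) ` P)"

lemma the_elem_image_const:
  assumes "x \<in> A" and "\<And>y. y \<in> A \<Longrightarrow> f y = c"
  shows "the_elem (f ` A) = c"
proof -
  have "f ` A = {c}" using assms by auto
  then show ?thesis by simp
qed

text \<open>Evaluates the quotient operations: once all representatives give the same class, the
  union is that class. A member of \<open>P\<close> is required because an empty union would be
  empty.\<close>

lemma UN_case_prod_const:
  assumes "(a, b) \<in> P" and "\<And>x y. (x, y) \<in> P \<Longrightarrow> f x y = c"
  shows "(\<Union>(x, y)\<in>P. f x y) = c"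
  using assms by fastforce

context semiring_embedding
begin

text \<open>Natural numbers cancel, so the auxiliary summand \<open>z\<close> of
  \<open>groth_rel\<close> drops out of the values; conversely \<open>\<zero>\<close> can serve as
  \<open>z\<close>, by injectivity of \<open>\<mu>\<close>.\<close>

lemma groth_rel_iff:
  "((a, b), (c, d)) \<in> groth_rel S \<longleftrightarrow>
     a \<in> carrier S \<and> b \<in> carrier S \<and> c \<in> carrier S \<and> d \<in> carrier S \<and>
     (\<forall>k. \<mu> a k + \<mu> d k = \<mu> c k + \<mu> b k)" (is "?L \<longleftrightarrow> ?R")
proof
  assume ?L
  then obtain z where mem: "a \<in> carrier S" "b \<in> carrier S" "c \<in> carrier S" "d \<in> carrier S"
    and z: "z \<in> carrier S" and eq: "a \<oplus> d \<oplus> z = c \<oplus> b \<oplus> z"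
    by (auto simp: groth_rel_def)
  have "\<mu> (a \<oplus> d \<oplus> z) k = \<mu> (c \<oplus> b \<oplus> z) k" for k by (simp only: eq)
  then show ?R using mem z by (simp add: semi_add)
next
  assume r: ?R
  then have "a \<oplus> d \<oplus> \<zero> = c \<oplus> b \<oplus> \<zero>"
    by (intro semi_inj) (auto simp: semi_add)
  then show ?L using r unfolding groth_rel_def by auto
qed

lemma equiv_groth_rel: "equiv (carrier S \<times> carrier S) (groth_rel S)"
proof (rule equivI)
  show "groth_rel S \<subseteq> (carrier S \<times> carrier S) \<times> (carrier S \<times> carrier S)"
    by (auto simp: groth_rel_def)
  show "refl_on (carrier S \<times> carrier S) (groth_rel S)"
    by (auto simp: refl_on_def groth_rel_iff)
  show "sym (groth_rel S)"
    by (auto simp: sym_def groth_rel_iff)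
  show "trans (groth_rel S)"
  proof (rule transI, clarify)
    fix a b c d e f
    assume *: "((a, b), (c, d)) \<in> groth_rel S" "((c, d), (e, f)) \<in> groth_rel S"
    then have "\<mu> a k + \<mu> d k = \<mu> c k + \<mu> b k" "\<mu> c k + \<mu> f k = \<mu> e k + \<mu> d k" for k
      by (auto simp: groth_rel_iff)
    then have "\<mu> a k + \<mu> f k = \<mu> e k + \<mu> b k" for k
      by (smt (verit) add.assoc add.commute add_left_cancel)
    then show "((a, b), (e, f)) \<in> groth_rel S"
      using * by (auto simp: groth_rel_iff)
  qed
qed

lemma groth_diff_mem_iff:
  "(c, d) \<in> groth_diff S a b \<longleftrightarrow> ((a, b), (c, d)) \<in> groth_rel S"
  by (simp add: groth_diff_def)

lemma groth_diff_self: "\<lbrakk>a \<in> carrier S; b \<in> carrier S\<rbrakk> \<Longrightarrow> (a, b) \<in> groth_diff S a b"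
  by (simp add: groth_diff_mem_iff groth_rel_iff)

lemma groth_diff_eqI:
  "\<lbrakk>a \<in> carrier S; b \<in> carrier S; c \<in> carrier S; d \<in> carrier S;
    \<And>k. \<mu> a k + \<mu> d k = \<mu> c k + \<mu> b k\<rbrakk> \<Longrightarrow> groth_diff S a b = groth_diff S c d"
  unfolding groth_diff_def
  by (rule equiv_class_eq[OF equiv_groth_rel]) (simp add: groth_rel_iff)

lemma groth_diff_mem: "\<lbrakk>a \<in> carrier S; b \<in> carrier S\<rbrakk> \<Longrightarrow> groth_diff S a b \<in> carrier (groth_ring S)"
  by (simp add: groth_diff_def groth_ring_def quotientI)

lemma groth_cases:
  assumes "P \<in> carrier (groth_ring S)"
  obtains a b where "a \<in> carrier S" "b \<in> carrier S" "P = groth_diff S a b"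
  using assms by (auto simp: groth_diff_def groth_ring_def elim!: quotientE)

text \<open>Additivity of \<open>h\<close> alone makes the value independent of the representative,
  since \<open>z\<close> cancels in the target group. The extension therefore serves marks as well
  as rational weights.\<close>

lemma groth_ext_diff:
  assumes h: "\<And>x y. \<lbrakk>x \<in> carrier S; y \<in> carrier S\<rbrakk> \<Longrightarrow> h (x \<oplus> y) = h x + h y"
    and "a \<in> carrier S" "b \<in> carrier S"
  shows "groth_ext h (groth_diff S a b) = h a - h b"
  unfolding groth_ext_def
proof (rule the_elem_image_const)
  show "(a, b) \<in> groth_diff S a b" using assms by (simp add: groth_diff_self)
next
  fix p assume p: "p \<in> groth_diff S a b"
  obtain c d where cd: "p = (c, d)" by (cases p)
  from p obtain z where mem: "c \<in> carrier S" "d \<in> carrier S"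
    and z: "z \<in> carrier S" and eq: "a \<oplus> d \<oplus> z = c \<oplus> b \<oplus> z"
    unfolding cd groth_diff_mem_iff by (auto simp: groth_rel_def)
  have "h (a \<oplus> d \<oplus> z) = h (c \<oplus> b \<oplus> z)" by (simp only: eq)
  then have "h a + h d = h c + h b" using assms mem z by (simp add: h)
  then show "(case p of (a, b) \<Rightarrow> h a - h b) = h a - h b"
    unfolding cd by (simp add: algebra_simps)
qed

lemma groth_add_diff:
  assumes "a \<in> carrier S" "b \<in> carrier S" "c \<in> carrier S" "d \<in> carrier S"
  shows "groth_diff S a b \<oplus>\<^bsub>groth_ring S\<^esub> groth_diff S c d = groth_diff S (a \<oplus> c) (b \<oplus> d)"
proof -
  have "groth_diff S (a' \<oplus> c') (b' \<oplus> d') = groth_diff S (a \<oplus> c) (b \<oplus> d)"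
    if "(a', b') \<in> groth_diff S a b" "(c', d') \<in> groth_diff S c d" for a' b' c' d'
  proof -
    have mem: "a' \<in> carrier S" "b' \<in> carrier S" "c' \<in> carrier S" "d' \<in> carrier S"
      and e: "\<mu> a k + \<mu> b' k = \<mu> a' k + \<mu> b k" "\<mu> c k + \<mu> d' k = \<mu> c' k + \<mu> d k" for k
      using that by (auto simp: groth_diff_mem_iff groth_rel_iff)
    have "\<mu> (a' \<oplus> c') k + \<mu> (b \<oplus> d) k = \<mu> (a \<oplus> c) k + \<mu> (b' \<oplus> d') k" for k
      using e[of k] assms mem by (simp add: semi_add)
    then show ?thesis using assms mem by (intro groth_diff_eqI) auto
  qed
  then show ?thesis
    unfolding groth_ring_def ring_record_simps groth_diff_def[symmetric]
    by (intro UN_case_prod_const[OF groth_diff_self[OF assms(1,2)]]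
        UN_case_prod_const[OF groth_diff_self[OF assms(3,4)]])
qed

lemma groth_mult_diff:
  assumes "a \<in> carrier S" "b \<in> carrier S" "c \<in> carrier S" "d \<in> carrier S"
  shows "groth_diff S a b \<otimes>\<^bsub>groth_ring S\<^esub> groth_diff S c d =
    groth_diff S (a \<otimes> c \<oplus> b \<otimes> d) (a \<otimes> d \<oplus> b \<otimes> c)"
proof -
  have "groth_diff S (a' \<otimes> c' \<oplus> b' \<otimes> d') (a' \<otimes> d' \<oplus> b' \<otimes> c') =
      groth_diff S (a \<otimes> c \<oplus> b \<otimes> d) (a \<otimes> d \<oplus> b \<otimes> c)"
    if *: "(a', b') \<in> groth_diff S a b" "(c', d') \<in> groth_diff S c d" for a' b' c' d'
  proof -
    have mem: "a' \<in> carrier S" "b' \<in> carrier S" "c' \<in> carrier S" "d' \<in> carrier S"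
      and e: "\<mu> a k + \<mu> b' k = \<mu> a' k + \<mu> b k" "\<mu> c k + \<mu> d' k = \<mu> c' k + \<mu> d k" for k
      using * by (auto simp: groth_diff_mem_iff groth_rel_iff)
    show ?thesis
    proof (rule groth_diff_eqI)
      fix k
      \<comment> \<open>In \<open>int\<close> the two relations become equalities of differences,
        which can simply be multiplied.\<close>
      have e1: "int (\<mu> a k) - int (\<mu> b k) = int (\<mu> a' k) - int (\<mu> b' k)"
        using e(1)[of k] by linarith
      have e2: "int (\<mu> c k) - int (\<mu> d k) = int (\<mu> c' k) - int (\<mu> d' k)"
        using e(2)[of k] by linarith
      have "(int (\<mu> a k) - int (\<mu> b k)) * (int (\<mu> c k) - int (\<mu> d k)) =
            (int (\<mu> a' k) - int (\<mu> b' k)) * (int (\<mu> c' k) - int (\<mu> d' k))"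
        by (simp only: e1 e2)
      then have "int (\<mu> (a' \<otimes> c' \<oplus> b' \<otimes> d') k + \<mu> (a \<otimes> d \<oplus> b \<otimes> c) k) =
        int (\<mu> (a \<otimes> c \<oplus> b \<otimes> d) k + \<mu> (a' \<otimes> d' \<oplus> b' \<otimes> c') k)"
        using assms mem by (simp add: semi_add semi_mult algebra_simps)
      then show "\<mu> (a' \<otimes> c' \<oplus> b' \<otimes> d') k + \<mu> (a \<otimes> d \<oplus> b \<otimes> c) k =
        \<mu> (a \<otimes> c \<oplus> b \<otimes> d) k + \<mu> (a' \<otimes> d' \<oplus> b' \<otimes> c') k"
        using of_nat_eq_iff by blast
    qed (use assms mem in auto)
  qed
  then show ?thesis
    unfolding groth_ring_def monoid.simps groth_diff_def[symmetric]
    by (intro UN_case_prod_const[OF groth_diff_self[OF assms(1,2)]]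
        UN_case_prod_const[OF groth_diff_self[OF assms(3,4)]])
qed

lemma groth_one: "\<one>\<^bsub>groth_ring S\<^esub> = groth_diff S \<one> \<zero>"
  by (simp add: groth_ring_def groth_diff_def)

lemma groth_zero: "\<zero>\<^bsub>groth_ring S\<^esub> = groth_diff S \<zero> \<zero>"
  by (simp add: groth_ring_def groth_diff_def)

lemma groth_ext_add:
  assumes h: "\<And>x y. \<lbrakk>x \<in> carrier S; y \<in> carrier S\<rbrakk> \<Longrightarrow> h (x \<oplus> y) = h x + h y"
    and "P \<in> carrier (groth_ring S)" "Q \<in> carrier (groth_ring S)"
  shows "groth_ext h (P \<oplus>\<^bsub>groth_ring S\<^esub> Q) = groth_ext h P + groth_ext h Q"
proof -
  obtain a b c d where "a \<in> carrier S" "b \<in> carrier S" "c \<in> carrier S" "d \<in> carrier S"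
    "P = groth_diff S a b" "Q = groth_diff S c d"
    using assms(2,3) by (metis groth_cases)
  then show ?thesis by (simp add: groth_add_diff groth_ext_diff[OF h] h)
qed

lemma groth_mark_diff:
  "\<lbrakk>a \<in> carrier S; b \<in> carrier S\<rbrakk> \<Longrightarrow>
    groth_ext (\<lambda>a. int (\<mu> a k)) (groth_diff S a b) = int (\<mu> a k) - int (\<mu> b k)"
  by (rule groth_ext_diff) (simp_all add: semi_add)

lemma ring_embedding_groth:
  "ring_embedding (groth_ring S) (\<lambda>P k. groth_ext (\<lambda>a. int (\<mu> a k)) P)"
    (is "ring_embedding ?R ?\<psi>")
proof -
  have inj: "P = Q"
    if PQ: "P \<in> carrier ?R" "Q \<in> carrier ?R" and eq: "\<And>k. ?\<psi> P k = ?\<psi> Q k" for P Q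
  proof -
    obtain a b c d
      where m: "a \<in> carrier S" "b \<in> carrier S" "c \<in> carrier S" "d \<in> carrier S"
        and PQ: "P = groth_diff S a b" "Q = groth_diff S c d"
      using PQ by (metis groth_cases)
    have "\<mu> a k + \<mu> d k = \<mu> c k + \<mu> b k" for k
      using eq[of k] m unfolding PQ by (simp add: groth_mark_diff)
    then show "P = Q" unfolding PQ using m by (intro groth_diff_eqI)
  qed
  have neg: "\<exists>Q\<in>carrier ?R. \<forall>k. ?\<psi> Q k = - ?\<psi> P k" if "P \<in> carrier ?R" for P
  proof -
    obtain a b where m: "a \<in> carrier S" "b \<in> carrier S" and P: "P = groth_diff S a b"
      using \<open>P \<in> carrier ?R\<close> by (metis groth_cases)
    then show ?thesis
      by (intro bexI[of _ "groth_diff S b a"]) (auto simp: groth_mark_diff groth_diff_mem)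
  qed
  have ops: "P \<oplus>\<^bsub>?R\<^esub> Q \<in> carrier ?R \<and> P \<otimes>\<^bsub>?R\<^esub> Q \<in> carrier ?R \<and>
      (\<forall>k. ?\<psi> (P \<oplus>\<^bsub>?R\<^esub> Q) k = ?\<psi> P k + ?\<psi> Q k \<and> ?\<psi> (P \<otimes>\<^bsub>?R\<^esub> Q) k = ?\<psi> P k * ?\<psi> Q k)"
    if PQ: "P \<in> carrier ?R" "Q \<in> carrier ?R" for P Q
  proof -
    obtain a b c d
      where m: "a \<in> carrier S" "b \<in> carrier S" "c \<in> carrier S" "d \<in> carrier S"
        and PQ: "P = groth_diff S a b" "Q = groth_diff S c d"
      using PQ by (metis groth_cases)
    then show ?thesis
      by (simp add: groth_add_diff groth_mult_diff groth_diff_mem groth_mark_diff semi_add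
          semi_mult algebra_simps)
  qed
  show ?thesis
    by (rule ring_embedding.intro)
      (use inj neg ops in \<open>auto simp: groth_one groth_zero groth_diff_mem groth_mark_diff
        semi_one semi_zero\<close>)
qed

end


section \<open>Tensoring with the rationals\<close>

definition rat_frac :: "('r, 'm) ring_scheme \<Rightarrow> 'r \<Rightarrow> int \<Rightarrow> ('r \<times> int) set" where
  "rat_frac R x m = rat_rel R `` {(x, m)}"

locale int_ring_embedding = ring_embedding R \<phi>
  for R (structure) and \<phi> :: "'r \<Rightarrow> 'k \<Rightarrow> int"
begin

text \<open>Integers have no torsion, so the nonzero factor in \<open>rat_rel\<close> cancels and
  cross multiplication of values remains. Conversely the factor 1 suffices, by injectivity of
  \<open>\<phi>\<close>.\<close>

lemma rat_rel_iff:
  "((x, m), (y, n)) \<in> rat_rel R \<longleftrightarrow>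
     x \<in> carrier R \<and> y \<in> carrier R \<and> m \<noteq> 0 \<and> n \<noteq> 0 \<and> (\<forall>k. n * \<phi> x k = m * \<phi> y k)"
    (is "?L \<longleftrightarrow> ?R")
proof
  assume ?L
  then obtain k0 :: int where mem: "x \<in> carrier R" "y \<in> carrier R" "m \<noteq> 0" "n \<noteq> 0"
    and k0: "k0 \<noteq> 0" and eq: "[k0] \<cdot> ([n] \<cdot> x \<ominus> [m] \<cdot> y) = \<zero>"
    by (auto simp: rat_rel_def)
  have "\<phi> ([k0] \<cdot> ([n] \<cdot> x \<ominus> [m] \<cdot> y)) k = 0" for k by (simp only: eq emb_zero)
  then show ?R using mem k0 by (simp add: emb_int_pow emb_minus int_pow_closed)
next
  assume r: ?R
  then have "[(1::int)] \<cdot> ([n] \<cdot> x \<ominus> [m] \<cdot> y) = \<zero>"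
    by (intro emb_inj) (auto simp: emb_int_pow emb_minus int_pow_closed emb_zero)
  then show ?L using r unfolding rat_rel_def by (auto intro!: exI[of _ "1::int"])
qed

lemma equiv_rat_rel: "equiv (carrier R \<times> {m. m \<noteq> 0}) (rat_rel R)"
proof (rule equivI)
  show "rat_rel R \<subseteq> (carrier R \<times> {m. m \<noteq> 0}) \<times> (carrier R \<times> {m. m \<noteq> 0})"
    by (auto simp: rat_rel_def)
  show "refl_on (carrier R \<times> {m. m \<noteq> 0}) (rat_rel R)"
    by (auto simp: refl_on_def rat_rel_iff)
  show "sym (rat_rel R)"
    by (auto simp: sym_def rat_rel_iff)
  show "trans (rat_rel R)"
  proof (rule transI, clarify)
    fix x y z and l m n :: int
    assume *: "((x, l), (y, m)) \<in> rat_rel R" "((y, m), (z, n)) \<in> rat_rel R"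
    then have "m * \<phi> x k = l * \<phi> y k" "n * \<phi> y k = m * \<phi> z k" "m \<noteq> 0" for k
      by (auto simp: rat_rel_iff)
    then have "m * (n * \<phi> x k) = m * (l * \<phi> z k)" for k
      by (metis mult.left_commute)
    then have "n * \<phi> x k = l * \<phi> z k" for k
      using \<open>m \<noteq> 0\<close> by simp
    then show "((x, l), (z, n)) \<in> rat_rel R"
      using * by (auto simp: rat_rel_iff)
  qed
qed

lemma rat_frac_mem_iff: "(y, n) \<in> rat_frac R x m \<longleftrightarrow> ((x, m), (y, n)) \<in> rat_rel R"
  by (simp add: rat_frac_def)

lemma rat_frac_self: "\<lbrakk>x \<in> carrier R; m \<noteq> 0\<rbrakk> \<Longrightarrow> (x, m) \<in> rat_frac R x m"
  by (simp add: rat_frac_mem_iff rat_rel_iff)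

lemma rat_frac_eqI:
  "\<lbrakk>x \<in> carrier R; y \<in> carrier R; m \<noteq> 0; n \<noteq> 0; \<And>k. n * \<phi> x k = m * \<phi> y k\<rbrakk>
    \<Longrightarrow> rat_frac R x m = rat_frac R y n"
  unfolding rat_frac_def
  by (rule equiv_class_eq[OF equiv_rat_rel]) (simp add: rat_rel_iff)

lemma rat_frac_mem: "\<lbrakk>x \<in> carrier R; m \<noteq> 0\<rbrakk> \<Longrightarrow> rat_frac R x m \<in> carrier (rat_ring R)"
  by (auto simp: rat_frac_def rat_ring_def intro!: quotientI)

lemma rat_cases:
  assumes "q \<in> carrier (rat_ring R)"
  obtains x m where "x \<in> carrier R" "m \<noteq> 0" "q = rat_frac R x m"
  using assms by (auto simp: rat_frac_def rat_ring_def elim!: quotientE)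

definition rat_emb :: "('r \<times> int) set \<Rightarrow> 'k \<Rightarrow> rat" where
  "rat_emb q k = the_elem ((\<lambda>(x, m). of_int (\<phi> x k) / of_int m) ` q)"

lemma rat_emb_frac:
  assumes "x \<in> carrier R" "m \<noteq> 0"
  shows "rat_emb (rat_frac R x m) k = of_int (\<phi> x k) / of_int m"
  unfolding rat_emb_def
proof (rule the_elem_image_const)
  show "(x, m) \<in> rat_frac R x m" using assms by (simp add: rat_frac_self)
next
  fix p assume p: "p \<in> rat_frac R x m"
  obtain y n where yn: "p = (y, n)" by (cases p)
  have "n \<noteq> 0" "n * \<phi> x k = m * \<phi> y k"
    using p by (auto simp: yn rat_frac_mem_iff rat_rel_iff)
  then have "of_int n * of_int (\<phi> x k) = (of_int m * of_int (\<phi> y k) :: rat)"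
    by (metis of_int_mult)
  then show "(case p of (x, m) \<Rightarrow> of_int (\<phi> x k) / of_int m) = (of_int (\<phi> x k) / of_int m :: rat)"
    using assms \<open>n \<noteq> 0\<close> by (simp add: yn field_simps)
qed

lemma rat_add_frac:
  assumes "x \<in> carrier R" "m \<noteq> 0" "y \<in> carrier R" "n \<noteq> 0"
  shows "rat_frac R x m \<oplus>\<^bsub>rat_ring R\<^esub> rat_frac R y n =
    rat_frac R ([n] \<cdot> x \<oplus> [m] \<cdot> y) (m * n)"
proof -
  have "rat_frac R ([n'] \<cdot> x' \<oplus> [m'] \<cdot> y') (m' * n') = rat_frac R ([n] \<cdot> x \<oplus> [m] \<cdot> y) (m * n)"
    if *: "(x', m') \<in> rat_frac R x m" "(y', n') \<in> rat_frac R y n" for x' m' y' n'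
  proof (rule rat_frac_eqI)
    fix k
    have e: "m' * \<phi> x k = m * \<phi> x' k" "n' * \<phi> y k = n * \<phi> y' k"
      and mem: "x' \<in> carrier R" "y' \<in> carrier R"
      using * by (auto simp: rat_frac_mem_iff rat_rel_iff)
    have "m * n * (n' * \<phi> x' k + m' * \<phi> y' k) = n * n' * (m * \<phi> x' k) + m * m' * (n * \<phi> y' k)"
      by (simp add: algebra_simps)
    also have "\<dots> = m' * n' * (n * \<phi> x k + m * \<phi> y k)"
      unfolding e[symmetric] by (simp add: algebra_simps)
    finally show "m * n * \<phi> ([n'] \<cdot> x' \<oplus> [m'] \<cdot> y') k = m' * n' * \<phi> ([n] \<cdot> x \<oplus> [m] \<cdot> y) k"
      using assms mem by (simp add: emb_add emb_int_pow int_pow_closed)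
  qed (use * assms in \<open>auto simp: rat_frac_mem_iff rat_rel_iff int_pow_closed\<close>)
  then show ?thesis
    unfolding rat_ring_def ring_record_simps rat_frac_def[symmetric]
    by (intro UN_case_prod_const[OF rat_frac_self[OF assms(1,2)]]
        UN_case_prod_const[OF rat_frac_self[OF assms(3,4)]])
qed

lemma rat_mult_frac:
  assumes "x \<in> carrier R" "m \<noteq> 0" "y \<in> carrier R" "n \<noteq> 0"
  shows "rat_frac R x m \<otimes>\<^bsub>rat_ring R\<^esub> rat_frac R y n = rat_frac R (x \<otimes> y) (m * n)"
proof -
  have "rat_frac R (x' \<otimes> y') (m' * n') = rat_frac R (x \<otimes> y) (m * n)"
    if *: "(x', m') \<in> rat_frac R x m" "(y', n') \<in> rat_frac R y n" for x' m' y' n'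
  proof (rule rat_frac_eqI)
    fix k
    have e: "m' * \<phi> x k = m * \<phi> x' k" "n' * \<phi> y k = n * \<phi> y' k"
      and mem: "x' \<in> carrier R" "y' \<in> carrier R"
      using * by (auto simp: rat_frac_mem_iff rat_rel_iff)
    have "m * n * (\<phi> x' k * \<phi> y' k) = (m * \<phi> x' k) * (n * \<phi> y' k)"
      by (simp add: algebra_simps)
    also have "\<dots> = m' * n' * (\<phi> x k * \<phi> y k)"
      unfolding e[symmetric] by (simp add: algebra_simps)
    finally show "m * n * \<phi> (x' \<otimes> y') k = m' * n' * \<phi> (x \<otimes> y) k"
      using assms mem by (simp add: emb_mult)
  qed (use * assms in \<open>auto simp: rat_frac_mem_iff rat_rel_iff\<close>)
  then show ?thesis
    unfolding rat_ring_def monoid.simps rat_frac_def[symmetric]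
    by (intro UN_case_prod_const[OF rat_frac_self[OF assms(1,2)]]
        UN_case_prod_const[OF rat_frac_self[OF assms(3,4)]])
qed

lemma rat_one: "\<one>\<^bsub>rat_ring R\<^esub> = rat_frac R \<one> 1"
  by (simp add: rat_ring_def rat_frac_def)

lemma rat_zero: "\<zero>\<^bsub>rat_ring R\<^esub> = rat_frac R \<zero> 1"
  by (simp add: rat_ring_def rat_frac_def)

lemma ring_embedding_rat: "ring_embedding (rat_ring R) rat_emb"
proof -
  have inj: "p = q"
    if pq: "p \<in> carrier (rat_ring R)" "q \<in> carrier (rat_ring R)"
      and eq: "\<And>k. rat_emb p k = rat_emb q k" for p q
  proof -
    obtain x m y n
      where m: "x \<in> carrier R" "m \<noteq> 0" "y \<in> carrier R" "n \<noteq> 0"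
        and pq: "p = rat_frac R x m" "q = rat_frac R y n"
      using pq by (metis rat_cases)
    have "n * \<phi> x k = m * \<phi> y k" for k
    proof -
      have "of_int n * of_int (\<phi> x k) = (of_int m * of_int (\<phi> y k) :: rat)"
        using eq[of k] m unfolding pq by (simp add: rat_emb_frac field_simps)
      then show ?thesis by (metis of_int_eq_iff of_int_mult)
    qed
    then show "p = q" unfolding pq using m by (intro rat_frac_eqI)
  qed
  have neg: "\<exists>q\<in>carrier (rat_ring R). \<forall>k. rat_emb q k = - rat_emb p k"
    if "p \<in> carrier (rat_ring R)" for p
  proof -
    obtain x m where m: "x \<in> carrier R" "m \<noteq> 0" and p: "p = rat_frac R x m"
      using \<open>p \<in> carrier (rat_ring R)\<close> by (metis rat_cases)
    then show ?thesis
      by (intro bexI[of _ "rat_frac R (\<ominus> x) m"]) (auto simp: rat_emb_frac emb_a_inv rat_frac_mem)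
  qed
  have ops: "p \<oplus>\<^bsub>rat_ring R\<^esub> q \<in> carrier (rat_ring R) \<and> p \<otimes>\<^bsub>rat_ring R\<^esub> q \<in> carrier (rat_ring R) \<and>
      (\<forall>k. rat_emb (p \<oplus>\<^bsub>rat_ring R\<^esub> q) k = rat_emb p k + rat_emb q k \<and>
        rat_emb (p \<otimes>\<^bsub>rat_ring R\<^esub> q) k = rat_emb p k * rat_emb q k)"
    if pq: "p \<in> carrier (rat_ring R)" "q \<in> carrier (rat_ring R)" for p q
  proof -
    obtain x m y n
      where m: "x \<in> carrier R" "m \<noteq> 0" "y \<in> carrier R" "n \<noteq> 0"
        and pq: "p = rat_frac R x m" "q = rat_frac R y n"
      using pq by (metis rat_cases)
    then show ?thesis
      by (simp add: rat_add_frac rat_mult_frac rat_frac_mem rat_emb_frac emb_add emb_mult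
          emb_int_pow int_pow_closed field_simps)
  qed
  show ?thesis
    by (rule ring_embedding.intro)
      (use inj neg ops in \<open>auto simp: rat_one rat_zero rat_frac_mem rat_emb_frac
        emb_one emb_zero\<close>)
qed

lemma to_rat_mem: "x \<in> carrier R \<Longrightarrow> to_rat R x \<in> carrier (rat_ring R)"
  using rat_frac_mem[of x 1] by (simp add: to_rat_def rat_frac_def)

end


section \<open>Finite sets with a group action\<close>

text \<open>Unlike \<open>group_action\<close>, this does not ask for extensionality outside
  \<open>E\<close>. The same \<open>\<alpha>\<close> then acts on every stable subset, such as an
  orbit or its complement.\<close>

definition acts :: "('a, 'm) monoid_scheme \<Rightarrow> 'x set \<Rightarrow> ('a \<Rightarrow> 'x \<Rightarrow> 'x) \<Rightarrow> bool" where
  "acts G E \<alpha> \<longleftrightarrow>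
     (\<forall>g\<in>carrier G. \<forall>x\<in>E. \<alpha> g x \<in> E) \<and> (\<forall>x\<in>E. \<alpha> \<one>\<^bsub>G\<^esub> x = x) \<and>
     (\<forall>g\<in>carrier G. \<forall>h\<in>carrier G. \<forall>x\<in>E. \<alpha> (g \<otimes>\<^bsub>G\<^esub> h) x = \<alpha> g (\<alpha> h x))"

lemma actsD:
  assumes "acts G E \<alpha>"
  shows "\<lbrakk>g \<in> carrier G; x \<in> E\<rbrakk> \<Longrightarrow> \<alpha> g x \<in> E"
    and "x \<in> E \<Longrightarrow> \<alpha> \<one>\<^bsub>G\<^esub> x = x"
    and "\<lbrakk>g \<in> carrier G; h \<in> carrier G; x \<in> E\<rbrakk> \<Longrightarrow> \<alpha> (g \<otimes>\<^bsub>G\<^esub> h) x = \<alpha> g (\<alpha> h x)"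
  using assms by (auto simp: acts_def)

lemma actsI:
  assumes "\<And>g x. \<lbrakk>g \<in> carrier G; x \<in> E\<rbrakk> \<Longrightarrow> \<alpha> g x \<in> E"
    and "\<And>x. x \<in> E \<Longrightarrow> \<alpha> \<one>\<^bsub>G\<^esub> x = x"
    and "\<And>g h x. \<lbrakk>g \<in> carrier G; h \<in> carrier G; x \<in> E\<rbrakk> \<Longrightarrow> \<alpha> (g \<otimes>\<^bsub>G\<^esub> h) x = \<alpha> g (\<alpha> h x)"
  shows "acts G E \<alpha>"
  using assms unfolding acts_def by simp

lemma acts_if_group_action:
  assumes "group_action G E \<alpha>"
  shows "acts G E \<alpha>"
proof -
  interpret group_action G E \<alpha> by (rule assms)
  show ?thesis
    unfolding acts_def using element_image composition_rule id_eq_one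
    by (metis restrict_apply')
qed

lemma gset_iso_refl: "gset_iso G E \<alpha> E \<alpha>"
  unfolding gset_iso_def by (rule exI[of _ id]) auto

lemma gset_iso_trans:
  assumes "gset_iso G E \<alpha> F \<beta>" "gset_iso G F \<beta> X \<gamma>"
  shows "gset_iso G E \<alpha> X \<gamma>"
proof -
  obtain f where f: "bij_betw f E F" "\<forall>g\<in>carrier G. \<forall>x\<in>E. f (\<alpha> g x) = \<beta> g (f x)"
    using assms(1) by (auto simp: gset_iso_def)
  obtain h where h: "bij_betw h F X" "\<forall>g\<in>carrier G. \<forall>x\<in>F. h (\<beta> g x) = \<gamma> g (h x)"
    using assms(2) by (auto simp: gset_iso_def)
  show ?thesis
    unfolding gset_iso_def using f h bij_betw_trans[OF f(1) h(1)] bij_betw_apply[OF f(1)]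
    by (intro exI[of _ "h \<circ> f"]) simp
qed

text \<open>\<open>gset_iso\<close> does not demand that its arguments are actions. Equivariance of
  the inverse needs translates of points of \<open>E\<close> to remain in \<open>E\<close>, where
  the inverse of \<open>f\<close> undoes \<open>f\<close>.\<close>

lemma gset_iso_sym:
  assumes "acts G E \<alpha>" and "gset_iso G E \<alpha> F \<beta>"
  shows "gset_iso G F \<beta> E \<alpha>"
proof -
  obtain f where f: "bij_betw f E F" "\<forall>g\<in>carrier G. \<forall>x\<in>E. f (\<alpha> g x) = \<beta> g (f x)"
    using assms(2) by (auto simp: gset_iso_def)
  have "inv_into E f (\<beta> g y) = \<alpha> g (inv_into E f y)" if "g \<in> carrier G" "y \<in> F" for g y
  proof -
    have x: "inv_into E f y \<in> E" "f (inv_into E f y) = y"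
      using f(1) that by (auto simp: bij_betw_def inv_into_into f_inv_into_f)
    then have "f (\<alpha> g (inv_into E f y)) = \<beta> g y" using f(2) that by auto
    moreover have "\<alpha> g (inv_into E f y) \<in> E" using actsD(1)[OF assms(1)] that x by simp
    ultimately show ?thesis
      using f(1) by (metis bij_betw_inv_into_left)
  qed
  then show ?thesis
    unfolding gset_iso_def using bij_betw_inv_into[OF f(1)] by blast
qed

lemma acts_iso:
  assumes "acts G E \<alpha>" "monoid G" and "gset_iso G E \<alpha> F \<beta>"
  shows "acts G F \<beta>"
proof -
  interpret monoid G by fact
  obtain f where f: "bij_betw f E F" and eq: "\<And>g x. \<lbrakk>g \<in> carrier G; x \<in> E\<rbrakk> \<Longrightarrow> \<beta> g (f x) = f (\<alpha> g x)"
    using assms(3) by (auto simp: gset_iso_def)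
  have F: "F = f ` E" using f by (simp add: bij_betw_def)
  note act = actsD[OF assms(1)]
  show ?thesis unfolding F by (rule actsI; erule imageE) (simp_all add: eq act)
qed

lemma gset_iso_Plus:
  assumes "acts G E \<alpha>" "acts G F \<beta>"
    and "gset_iso G E \<alpha> E' \<alpha>'" "gset_iso G F \<beta> F' \<beta>'"
  shows "gset_iso G (Sum_Type.Plus E F) (sum_action E \<alpha> F \<beta>)
    (Sum_Type.Plus E' F') (sum_action E' \<alpha>' F' \<beta>')"
proof -
  obtain f where f: "bij_betw f E E'" "\<forall>g\<in>carrier G. \<forall>x\<in>E. f (\<alpha> g x) = \<alpha>' g (f x)"
    using assms(3) by (auto simp: gset_iso_def)
  obtain h where h: "bij_betw h F F'" "\<forall>g\<in>carrier G. \<forall>x\<in>F. h (\<beta> g x) = \<beta>' g (h x)"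
    using assms(4) by (auto simp: gset_iso_def)
  have "inj_on (map_sum f h) (Sum_Type.Plus E F)"
    by (auto intro!: inj_onI dest: inj_onD[OF bij_betw_imp_inj_on[OF f(1)]]
        inj_onD[OF bij_betw_imp_inj_on[OF h(1)]])
  moreover have "map_sum f h ` (Sum_Type.Plus E F) = Sum_Type.Plus (f ` E) (h ` F)"
    by (simp add: Plus_def image_Un image_image)
  ultimately have "bij_betw (map_sum f h) (Sum_Type.Plus E F) (Sum_Type.Plus E' F')"
    using f(1) h(1) by (simp add: bij_betw_def)
  moreover have "map_sum f h (sum_action E \<alpha> F \<beta> g z) = sum_action E' \<alpha>' F' \<beta>' g (map_sum f h z)"
    if "g \<in> carrier G" "z \<in> Sum_Type.Plus E F" for g z
  proof (cases z)
    case (Inl x)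
    then have "x \<in> E" using that by auto
    then show ?thesis using Inl that(1) f(2) bij_betw_apply[OF f(1)] by (auto simp: sum_action_def)
  next
    case (Inr y)
    then have "y \<in> F" using that by auto
    then show ?thesis using Inr that(1) h(2) bij_betw_apply[OF h(1)] by (auto simp: sum_action_def)
  qed
  ultimately show ?thesis unfolding gset_iso_def by blast
qed

lemma gset_iso_Times:
  assumes "acts G E \<alpha>" "acts G F \<beta>"
    and "gset_iso G E \<alpha> E' \<alpha>'" "gset_iso G F \<beta> F' \<beta>'"
  shows "gset_iso G (E \<times> F) (prod_action E \<alpha> F \<beta>) (E' \<times> F') (prod_action E' \<alpha>' F' \<beta>')"
proof -
  obtain f where f: "bij_betw f E E'" "\<forall>g\<in>carrier G. \<forall>x\<in>E. f (\<alpha> g x) = \<alpha>' g (f x)"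
    using assms(3) by (auto simp: gset_iso_def)
  obtain h where h: "bij_betw h F F'" "\<forall>g\<in>carrier G. \<forall>x\<in>F. h (\<beta> g x) = \<beta>' g (h x)"
    using assms(4) by (auto simp: gset_iso_def)
  have "bij_betw (map_prod f h) (E \<times> F) (E' \<times> F')"
    using f(1) h(1) by (rule bij_betw_map_prod)
  moreover have "map_prod f h (prod_action E \<alpha> F \<beta> g z) = prod_action E' \<alpha>' F' \<beta>' g (map_prod f h z)"
    if "g \<in> carrier G" "z \<in> E \<times> F" for g z
    using that f(2) h(2) bij_betw_apply[OF f(1)] bij_betw_apply[OF h(1)]
    by (cases z) (simp add: prod_action_def)
  ultimately show ?thesis unfolding gset_iso_def by blast
qed

lemma acts_Plus:
  assumes "monoid G" "acts G E \<alpha>" "acts G F \<beta>"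
  shows "acts G (Sum_Type.Plus E F) (sum_action E \<alpha> F \<beta>)"
proof -
  interpret monoid G by fact
  note E = actsD[OF assms(2)] and F = actsD[OF assms(3)]
  show ?thesis
    by (rule actsI; erule PlusE) (auto simp: sum_action_def E F)
qed

lemma acts_Times:
  assumes "monoid G" "acts G E \<alpha>" "acts G F \<beta>"
  shows "acts G (E \<times> F) (prod_action E \<alpha> F \<beta>)"
proof -
  interpret monoid G by fact
  note E = actsD[OF assms(2)] and F = actsD[OF assms(3)]
  show ?thesis
    by (rule actsI; erule SigmaE) (simp_all add: prod_action_def E F)
qed

lemma gset_class_eqI:
  assumes "acts G E \<alpha>" and "gset_iso G E \<alpha> F \<beta>"
  shows "gset_class G E \<alpha> = gset_class G F \<beta>"
  using gset_iso_trans[OF assms(2)] gset_iso_trans[OF gset_iso_sym[OF assms]]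
  by (auto simp: gset_class_def)

section \<open>Isomorphism classes of finite \<open>G\<close>-sets and their operations\<close>

context group
begin

lemma group_action_if_acts:
  assumes "acts G E \<alpha>" and "\<And>g. g \<in> carrier G \<Longrightarrow> \<alpha> g \<in> extensional E"
  shows "group_action G E \<alpha>"
proof -
  have inv: "\<alpha> (inv g) (\<alpha> g x) = x" "\<alpha> g (\<alpha> (inv g) x) = x" if "g \<in> carrier G" "x \<in> E" for g x
    using actsD[OF assms(1)] that by (metis inv_closed l_inv r_inv)+
  have bij: "\<alpha> g \<in> Bij E" if "g \<in> carrier G" for g
    unfolding Bij_def using that assms actsD(1)[OF assms(1)]
    by (auto intro!: bij_betw_byWitness[where f' = "\<alpha> (inv g)"] simp: inv)
  have "\<alpha> \<in> hom G (BijGroup E)"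
  proof (rule homI)
    fix g h assume gh: "g \<in> carrier G" "h \<in> carrier G"
    have "\<alpha> (g \<otimes> h) = compose E (\<alpha> g) (\<alpha> h)"
      by (rule extensionalityI[of _ E])
        (use gh assms(2) actsD(3)[OF assms(1)] in \<open>simp_all add: compose_def\<close>)
    then show "\<alpha> (g \<otimes> h) = \<alpha> g \<otimes>\<^bsub>BijGroup E\<^esub> \<alpha> h"
      using gh bij by (simp add: BijGroup_def)
  qed (simp add: BijGroup_def bij)
  then show ?thesis
    unfolding group_action_def group_hom_def group_hom_axioms_def
    using group_BijGroup by (simp add: is_group)
qed

lemma acts_inv:
  "\<lbrakk>acts G E \<alpha>; g \<in> carrier G; x \<in> E\<rbrakk> \<Longrightarrow> \<alpha> (inv g) (\<alpha> g x) = x"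
  using actsD(2)[of G E \<alpha> x] actsD(3)[of G E \<alpha> "inv g" g x] by simp

lemma acts_subset:
  "\<lbrakk>acts G E \<alpha>; A \<subseteq> E; \<And>g x. \<lbrakk>g \<in> carrier G; x \<in> A\<rbrakk> \<Longrightarrow> \<alpha> g x \<in> A\<rbrakk> \<Longrightarrow> acts G A \<alpha>"
  by (rule actsI) (auto simp: subset_iff actsD(2)[of G E] actsD(3)[of G E])

text \<open>The action is transported along a numbering of \<open>E\<close>. As classes contain only
  actions on sets of naturals, this is what makes the class of a finite \<open>G\<close>-set over
  any type nonempty. \<open>\<beta>\<close> is restricted so that it is extensional.\<close>

lemma gset_transfer:
  assumes "finite E" "acts G E \<alpha>"
  obtains N :: "nat set" and \<beta> where "finite N" "group_action G N \<beta>" "gset_iso G E \<alpha> N \<beta>"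
proof -
  obtain f where f: "bij_betw f E {0..<card E}"
    using ex_bij_betw_finite_nat[OF assms(1)] by blast
  define \<beta> where "\<beta> = (\<lambda>g. \<lambda>n\<in>{0..<card E}. f (\<alpha> g (inv_into E f n)))"
  have iso: "gset_iso G E \<alpha> {0..<card E} \<beta>"
    unfolding gset_iso_def \<beta>_def using f bij_betw_apply[OF f] bij_betw_inv_into_left[OF f]
    by (intro exI[of _ f]) auto
  then have "acts G {0..<card E} \<beta>"
    using acts_iso assms(2) is_monoid by blast
  then have "group_action G {0..<card E} \<beta>"
    by (rule group_action_if_acts) (simp add: \<beta>_def)
  then show ?thesis using iso that by blast
qed

lemma gset_class_closed:
  assumes "finite E" "acts G E \<alpha>"
  shows "gset_class G E \<alpha> \<in> carrier (gset_semiring G)"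
proof -
  obtain N :: "nat set" and \<beta> where "finite N" "group_action G N \<beta>" "gset_iso G E \<alpha> N \<beta>"
    using gset_transfer[OF assms] .
  then show ?thesis
    using gset_class_eqI[OF assms(2)] by (fastforce simp: gset_semiring_def)
qed

lemma gset_cases:
  assumes "a \<in> carrier (gset_semiring G)"
  obtains E :: "nat set" and \<alpha> where "finite E" "acts G E \<alpha>" "a = gset_class G E \<alpha>"
  using assms acts_if_group_action by (fastforce simp: gset_semiring_def)

lemma gset_class_memD:
  assumes "(F, \<beta>) \<in> gset_class G E \<alpha>"
  shows "finite F" "acts G F \<beta>" "gset_iso G E \<alpha> F \<beta>"
  using assms acts_if_group_action by (auto simp: gset_class_def)

lemma gset_class_nonempty:
  assumes "finite E" "acts G E \<alpha>"
  obtains F \<beta> where "(F, \<beta>) \<in> gset_class G E \<alpha>"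
proof -
  obtain N :: "nat set" and \<beta> where "finite N" "group_action G N \<beta>" "gset_iso G E \<alpha> N \<beta>"
    using gset_transfer[OF assms] .
  then show ?thesis by (intro that[of N \<beta>]) (simp add: gset_class_def)
qed

text \<open>All representatives give isomorphic disjoint unions, and both classes are inhabited, so
  the union over representatives collapses to one class.\<close>

lemma gset_add:
  assumes "finite E" "acts G E \<alpha>" "finite F" "acts G F \<beta>"
  shows "gset_class G E \<alpha> \<oplus>\<^bsub>gset_semiring G\<^esub> gset_class G F \<beta> =
    gset_class G (Sum_Type.Plus E F) (sum_action E \<alpha> F \<beta>)"
proof -
  obtain X \<gamma> Y \<delta> where X: "(X, \<gamma>) \<in> gset_class G E \<alpha>" and Y: "(Y, \<delta>) \<in> gset_class G F \<beta>"
    using gset_class_nonempty[OF assms(1,2)] gset_class_nonempty[OF assms(3,4)] by metis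
  have "gset_class G (Sum_Type.Plus E' F') (sum_action E' \<alpha>' F' \<beta>') = gset_class G (Sum_Type.Plus E F) (sum_action E \<alpha> F \<beta>)"
    if "(E', \<alpha>') \<in> gset_class G E \<alpha>" "(F', \<beta>') \<in> gset_class G F \<beta>" for E' \<alpha>' F' \<beta>'
    using gset_class_eqI[OF acts_Plus[OF is_monoid assms(2,4)] gset_iso_Plus[OF assms(2,4)
          gset_class_memD(3)[OF that(1)] gset_class_memD(3)[OF that(2)]]] by simp
  then show ?thesis
    unfolding gset_semiring_def ring_record_simps
    by (intro UN_case_prod_const[OF X] UN_case_prod_const[OF Y])
qed

lemma gset_mult:
  assumes "finite E" "acts G E \<alpha>" "finite F" "acts G F \<beta>"
  shows "gset_class G E \<alpha> \<otimes>\<^bsub>gset_semiring G\<^esub> gset_class G F \<beta> =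
    gset_class G (E \<times> F) (prod_action E \<alpha> F \<beta>)"
proof -
  obtain X \<gamma> Y \<delta> where X: "(X, \<gamma>) \<in> gset_class G E \<alpha>" and Y: "(Y, \<delta>) \<in> gset_class G F \<beta>"
    using gset_class_nonempty[OF assms(1,2)] gset_class_nonempty[OF assms(3,4)] by metis
  have "gset_class G (E' \<times> F') (prod_action E' \<alpha>' F' \<beta>') = gset_class G (E \<times> F) (prod_action E \<alpha> F \<beta>)"
    if "(E', \<alpha>') \<in> gset_class G E \<alpha>" "(F', \<beta>') \<in> gset_class G F \<beta>" for E' \<alpha>' F' \<beta>'
    using gset_class_eqI[OF acts_Times[OF is_monoid assms(2,4)] gset_iso_Times[OF assms(2,4)
          gset_class_memD(3)[OF that(1)] gset_class_memD(3)[OF that(2)]]] by simp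
  then show ?thesis
    unfolding gset_semiring_def monoid.simps
    by (intro UN_case_prod_const[OF X] UN_case_prod_const[OF Y])
qed

section \<open>Point stabilizers, weights and marks\<close>

lemma subgroup_stabilizer:
  assumes "acts G E \<alpha>" "x \<in> E"
  shows "subgroup (stabilizer G \<alpha> x) G"
proof (rule subgroupI)
  show "stabilizer G \<alpha> x \<noteq> {}"
    using actsD(2)[OF assms] by (auto simp: stabilizer_def)
next
  fix g assume g: "g \<in> stabilizer G \<alpha> x"
  then have "\<alpha> (inv g) x = x"
    using acts_inv[OF assms(1) _ assms(2), of g] by (simp add: stabilizer_def)
  then show "inv g \<in> stabilizer G \<alpha> x" using g by (simp add: stabilizer_def)
next
  fix g h assume "g \<in> stabilizer G \<alpha> x" "h \<in> stabilizer G \<alpha> x"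
  then show "g \<otimes> h \<in> stabilizer G \<alpha> x"
    using actsD(3)[OF assms(1), of g h x] assms(2) by (simp add: stabilizer_def)
qed (simp add: stabilizer_def subset_iff)

lemma stabilizer_subset: "stabilizer G \<alpha> x \<subseteq> carrier G"
  by (auto simp: stabilizer_def)

text \<open>The common form of all invariants used: the indicator of \<open>K \<subseteq> H\<close>
  gives the mark of \<open>K\<close>, other choices of \<open>w\<close> give orbit counts and the
  marks of the core map. Each choice is invariant under isomorphism and additive on disjoint
  unions.\<close>

definition gset_weight :: "('a set \<Rightarrow> 'w::comm_monoid_add) \<Rightarrow> 'a gset set \<Rightarrow> 'w" where
  "gset_weight w a = the_elem ((\<lambda>(E, \<alpha>). \<Sum>x\<in>E. w (stabilizer G \<alpha> x)) ` a)"

lemma gset_weight_iso: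
  assumes "acts G E \<alpha>" "gset_iso G E \<alpha> F \<beta>"
  shows "(\<Sum>y\<in>F. w (stabilizer G \<beta> y)) = (\<Sum>x\<in>E. w (stabilizer G \<alpha> x))"
proof -
  obtain f where f: "bij_betw f E F" "\<forall>g\<in>carrier G. \<forall>x\<in>E. f (\<alpha> g x) = \<beta> g (f x)"
    using assms(2) by (auto simp: gset_iso_def)
  have "stabilizer G \<beta> (f x) = stabilizer G \<alpha> x" if "x \<in> E" for x
  proof -
    have "\<beta> g (f x) = f x \<longleftrightarrow> \<alpha> g x = x" if "g \<in> carrier G" for g
      using f that \<open>x \<in> E\<close> actsD(1)[OF assms(1) that \<open>x \<in> E\<close>]
      by (metis bij_betw_inv_into_left)
    then show ?thesis by (auto simp: stabilizer_def)
  qed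
  then show ?thesis
    using sum.reindex_bij_betw[OF f(1), of "\<lambda>y. w (stabilizer G \<beta> y)"] by simp
qed

lemma gset_weight_class:
  assumes "finite E" "acts G E \<alpha>"
  shows "gset_weight w (gset_class G E \<alpha>) = (\<Sum>x\<in>E. w (stabilizer G \<alpha> x))"
proof -
  obtain F \<beta> where F: "(F, \<beta>) \<in> gset_class G E \<alpha>"
    using gset_class_nonempty[OF assms] .
  show ?thesis unfolding gset_weight_def
    by (rule the_elem_image_const[OF F])
      (auto dest!: gset_class_memD(3) simp: gset_weight_iso[OF assms(2)])
qed

lemma gset_mark_class:
  assumes "finite E" "acts G E \<alpha>" "K \<subseteq> carrier G"
  shows "gset_mark K (gset_class G E \<alpha>) = card {x \<in> E. K \<subseteq> stabilizer G \<alpha> x}"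
proof -
  obtain F \<beta> where F: "(F, \<beta>) \<in> gset_class G E \<alpha>"
    using gset_class_nonempty[OF assms(1,2)] .
  have *: "card {x \<in> X. \<forall>k\<in>K. \<gamma> k x = x} = (\<Sum>x\<in>X. if K \<subseteq> stabilizer G \<gamma> x then 1 else 0)"
    if "finite X" for X and \<gamma> :: "'a \<Rightarrow> 'x \<Rightarrow> 'x"
  proof -
    have "{x \<in> X. \<forall>k\<in>K. \<gamma> k x = x} = {x \<in> X. K \<subseteq> stabilizer G \<gamma> x}"
      using assms(3) by (auto simp: stabilizer_def)
    moreover have "card {x \<in> X. K \<subseteq> stabilizer G \<gamma> x} = (\<Sum>x\<in>X. if K \<subseteq> stabilizer G \<gamma> x then 1 else 0)"
      using that by (simp add: sum.If_cases Int_def)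
    ultimately show ?thesis by simp
  qed
  have **: "card {x \<in> E. K \<subseteq> stabilizer G \<alpha> x} = (\<Sum>x\<in>E. if K \<subseteq> stabilizer G \<alpha> x then 1 else 0)"
    using assms(1) by (simp add: sum.If_cases Int_def)
  have "card {x \<in> X. \<forall>k\<in>K. \<gamma> k x = x} = card {x \<in> E. K \<subseteq> stabilizer G \<alpha> x}"
    if "(X, \<gamma>) \<in> gset_class G E \<alpha>" for X \<gamma>
    using gset_class_memD[OF that] unfolding **
    by (subst *) (simp_all add: gset_weight_iso[OF assms(2), where w = "\<lambda>H. if K \<subseteq> H then 1 else 0"])
  then show ?thesis
    unfolding gset_mark_def by (intro the_elem_image_const[OF F]) auto
qed

lemma stabilizer_Inl:
  "\<lbrakk>x \<in> E\<rbrakk> \<Longrightarrow> stabilizer G (sum_action E \<alpha> F \<beta>) (Inl x) = stabilizer G \<alpha> x"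
  by (auto simp: stabilizer_def sum_action_def)

lemma stabilizer_Inr:
  "\<lbrakk>y \<in> F\<rbrakk> \<Longrightarrow> stabilizer G (sum_action E \<alpha> F \<beta>) (Inr y) = stabilizer G \<beta> y"
  by (auto simp: stabilizer_def sum_action_def)

lemma gset_weight_add:
  assumes "a \<in> carrier (gset_semiring G)" "b \<in> carrier (gset_semiring G)"
  shows "gset_weight w (a \<oplus>\<^bsub>gset_semiring G\<^esub> b) = gset_weight w a + gset_weight w b"
proof -
  obtain E :: "nat set" and \<alpha> where E: "finite E" "acts G E \<alpha>" "a = gset_class G E \<alpha>"
    using gset_cases[OF assms(1)] .
  obtain F :: "nat set" and \<beta> where F: "finite F" "acts G F \<beta>" "b = gset_class G F \<beta>"
    using gset_cases[OF assms(2)] .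
  have "gset_weight w (a \<oplus>\<^bsub>gset_semiring G\<^esub> b) =
      (\<Sum>z\<in>E <+> F. w (stabilizer G (sum_action E \<alpha> F \<beta>) z))"
    using E F by (simp add: gset_add gset_weight_class acts_Plus is_monoid)
  also have "\<dots> = (\<Sum>x\<in>E. w (stabilizer G \<alpha> x)) + (\<Sum>y\<in>F. w (stabilizer G \<beta> y))"
    using E F by (simp add: sum.Plus stabilizer_Inl stabilizer_Inr)
  finally show ?thesis using E F by (simp add: gset_weight_class)
qed

lemma gset_mark_weight:
  assumes "a \<in> carrier (gset_semiring G)" "K \<subseteq> carrier G"
  shows "gset_mark K a = gset_weight (\<lambda>H. if K \<subseteq> H then 1 else 0) a"
proof -
  obtain E :: "nat set" and \<alpha> where E: "finite E" "acts G E \<alpha>" "a = gset_class G E \<alpha>"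
    using gset_cases[OF assms(1)] .
  then show ?thesis
    using assms(2) by (simp add: gset_mark_class gset_weight_class sum.If_cases Int_def)
qed

text \<open>A pair is fixed exactly when both components are, so fixed points of a product form a
  product. General weights are not multiplicative, hence the argument on fixed points.\<close>

lemma gset_mark_mult:
  assumes "a \<in> carrier (gset_semiring G)" "b \<in> carrier (gset_semiring G)" "K \<subseteq> carrier G"
  shows "gset_mark K (a \<otimes>\<^bsub>gset_semiring G\<^esub> b) = gset_mark K a * gset_mark K b"
proof -
  obtain E :: "nat set" and \<alpha> where E: "finite E" "acts G E \<alpha>" "a = gset_class G E \<alpha>"
    using gset_cases[OF assms(1)] .
  obtain F :: "nat set" and \<beta> where F: "finite F" "acts G F \<beta>" "b = gset_class G F \<beta>"
    using gset_cases[OF assms(2)] .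
  have "{z \<in> E \<times> F. K \<subseteq> stabilizer G (prod_action E \<alpha> F \<beta>) z} =
      {x \<in> E. K \<subseteq> stabilizer G \<alpha> x} \<times> {y \<in> F. K \<subseteq> stabilizer G \<beta> y}"
    by (auto simp: stabilizer_def prod_action_def)
  then show ?thesis
    using E F assms(3) by (simp add: gset_mult gset_mark_class acts_Times is_monoid card_cartesian_product)
qed

lemma acts_empty: "acts G {} \<alpha>"
  by (simp add: acts_def)

lemma gset_zero_closed: "\<zero>\<^bsub>gset_semiring G\<^esub> \<in> carrier (gset_semiring G)"
  using gset_class_closed[OF _ acts_empty] by (simp add: gset_semiring_def)

lemma gset_weight_zero: "gset_weight w \<zero>\<^bsub>gset_semiring G\<^esub> = 0"
  using gset_weight_class[OF _ acts_empty] by (simp add: gset_semiring_def)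

lemma gset_add_closed:
  assumes "a \<in> carrier (gset_semiring G)" "b \<in> carrier (gset_semiring G)"
  shows "a \<oplus>\<^bsub>gset_semiring G\<^esub> b \<in> carrier (gset_semiring G)"
proof -
  obtain E :: "nat set" and \<alpha> where E: "finite E" "acts G E \<alpha>" "a = gset_class G E \<alpha>"
    using gset_cases[OF assms(1)] .
  obtain F :: "nat set" and \<beta> where F: "finite F" "acts G F \<beta>" "b = gset_class G F \<beta>"
    using gset_cases[OF assms(2)] .
  show ?thesis
    using E F by (simp add: gset_add gset_class_closed acts_Plus is_monoid)
qed

lemma gset_mult_closed:
  assumes "a \<in> carrier (gset_semiring G)" "b \<in> carrier (gset_semiring G)"
  shows "a \<otimes>\<^bsub>gset_semiring G\<^esub> b \<in> carrier (gset_semiring G)"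
proof -
  obtain E :: "nat set" and \<alpha> where E: "finite E" "acts G E \<alpha>" "a = gset_class G E \<alpha>"
    using gset_cases[OF assms(1)] .
  obtain F :: "nat set" and \<beta> where F: "finite F" "acts G F \<beta>" "b = gset_class G F \<beta>"
    using gset_cases[OF assms(2)] .
  show ?thesis
    using E F by (simp add: gset_mult gset_class_closed acts_Times is_monoid)
qed

subsection \<open>Orbits and transitive actions\<close>

lemma orbit_image: "orbit G \<gamma> z = (\<lambda>g. \<gamma> g z) ` carrier G"
  by (auto simp: orbit_def)

lemma orbit_closed:
  assumes "acts G E \<alpha>" "x \<in> E"
  shows "orbit G \<alpha> x \<subseteq> E" "x \<in> orbit G \<alpha> x"
    and "\<lbrakk>g \<in> carrier G; z \<in> orbit G \<alpha> x\<rbrakk> \<Longrightarrow> \<alpha> g z \<in> orbit G \<alpha> x"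
    and "\<lbrakk>g \<in> carrier G; z \<in> E - orbit G \<alpha> x\<rbrakk> \<Longrightarrow> \<alpha> g z \<in> E - orbit G \<alpha> x"
proof -
  show "orbit G \<alpha> x \<subseteq> E" using actsD(1)[OF assms(1)] assms(2) by (auto simp: orbit_def)
  show "x \<in> orbit G \<alpha> x"
    using actsD(2)[OF assms] unfolding orbit_def by (metis (mono_tags, lifting) mem_Collect_eq one_closed)
  show inv: "\<alpha> g z \<in> orbit G \<alpha> x" if g: "g \<in> carrier G" and z: "z \<in> orbit G \<alpha> x" for g z
  proof -
    obtain h where h: "h \<in> carrier G" "z = \<alpha> h x" using z by (auto simp: orbit_def)
    then have "\<alpha> g z = \<alpha> (g \<otimes> h) x" using actsD(3)[OF assms(1) g h(1) assms(2)] by simp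
    then show ?thesis using h g by (auto simp: orbit_def)
  qed
  show "\<alpha> g z \<in> E - orbit G \<alpha> x" if "g \<in> carrier G" "z \<in> E - orbit G \<alpha> x"
  proof -
    have "z \<in> orbit G \<alpha> x" if "\<alpha> g z \<in> orbit G \<alpha> x"
      using inv[of "inv g" "\<alpha> g z"] that acts_inv[OF assms(1), of g z] \<open>g \<in> carrier G\<close>
        \<open>z \<in> E - orbit G \<alpha> x\<close> by simp
    then show ?thesis using that actsD(1)[OF assms(1), of g z] by blast
  qed
qed

lemma acts_orbit: "\<lbrakk>acts G E \<alpha>; x \<in> E\<rbrakk> \<Longrightarrow> acts G (orbit G \<alpha> x) \<alpha>"
  by (rule acts_subset[of E]) (simp_all add: orbit_closed)

lemma acts_Diff_orbit: "\<lbrakk>acts G E \<alpha>; x \<in> E\<rbrakk> \<Longrightarrow> acts G (E - orbit G \<alpha> x) \<alpha>"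
  by (rule acts_subset[of E]) (assumption, blast, rule orbit_closed(4))

text \<open>Whether \<open>\<alpha> g x\<close> and \<open>\<alpha> h x\<close> coincide depends
  only on whether \<open>inv h \<otimes> g\<close> lies in the stabilizer. Equal stabilizers make
  the assignment of \<open>\<beta> g y\<close> to \<open>\<alpha> g x\<close> well defined and
  injective.\<close>

lemma orbit_iso:
  assumes "acts G E \<alpha>" "x \<in> E" "acts G F \<beta>" "y \<in> F" and stab: "stabilizer G \<alpha> x = stabilizer G \<beta> y"
  shows "gset_iso G (orbit G \<alpha> x) \<alpha> (orbit G \<beta> y) \<beta>"
proof -
  have eq_iff: "\<gamma> g z = \<gamma> h z \<longleftrightarrow> inv h \<otimes> g \<in> stabilizer G \<gamma> z"
    if "acts G X \<gamma>" "z \<in> X" "g \<in> carrier G" "h \<in> carrier G" for X \<gamma> g h and z :: 'z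
  proof -
    note act = actsD[OF that(1)]
    have "\<gamma> (inv h \<otimes> g) z = \<gamma> (inv h) (\<gamma> g z)"
      using act(3)[of "inv h" g z] that by simp
    moreover have "\<gamma> (inv h) (\<gamma> h z) = z" "\<gamma> h (\<gamma> (inv h) (\<gamma> g z)) = \<gamma> g z"
      using acts_inv[OF that(1), of h z] acts_inv[OF that(1), of "inv h" "\<gamma> g z"] act(1) that by auto
    ultimately have "\<gamma> (inv h \<otimes> g) z = z \<longleftrightarrow> \<gamma> g z = \<gamma> h z" by metis
    then show ?thesis using that by (simp add: stabilizer_def)
  qed
  have eq: "\<alpha> g x = \<alpha> h x \<longleftrightarrow> \<beta> g y = \<beta> h y" if "g \<in> carrier G" "h \<in> carrier G" for g h
    using eq_iff[OF assms(1,2) that] eq_iff[OF assms(3,4) that] stab by simp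
  define f where "f z = \<beta> (SOME g. g \<in> carrier G \<and> \<alpha> g x = z) y" for z
  have f: "f (\<alpha> g x) = \<beta> g y" if "g \<in> carrier G" for g
  proof -
    have "\<exists>h. h \<in> carrier G \<and> \<alpha> h x = \<alpha> g x" using that by blast
    from someI_ex[OF this] show ?thesis unfolding f_def using eq that by metis
  qed
  have "bij_betw f (orbit G \<alpha> x) (orbit G \<beta> y)"
  proof (rule bij_betw_imageI)
    show "inj_on f (orbit G \<alpha> x)"
      using f eq by (auto simp: inj_on_def orbit_def)
    show "f ` orbit G \<alpha> x = orbit G \<beta> y"
      unfolding orbit_image image_image by (rule image_cong) (simp_all add: f)
  qed
  moreover have "f (\<alpha> g z) = \<beta> g (f z)" if "g \<in> carrier G" "z \<in> orbit G \<alpha> x" for g z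
  proof -
    obtain h where "h \<in> carrier G" "z = \<alpha> h x" using \<open>z \<in> orbit G \<alpha> x\<close> by (auto simp: orbit_def)
    then show ?thesis
      using that f actsD(3)[OF assms(1) _ _ assms(2), symmetric] actsD(3)[OF assms(3) _ _ assms(4), symmetric]
      by simp
  qed
  ultimately show ?thesis unfolding gset_iso_def by blast
qed

lemma gset_iso_Un:
  assumes "acts G A \<alpha>" "acts G B \<alpha>" "A \<inter> B = {}" "C \<inter> D = {}"
    and "gset_iso G A \<alpha> C \<beta>" "gset_iso G B \<alpha> D \<beta>"
  shows "gset_iso G (A \<union> B) \<alpha> (C \<union> D) \<beta>"
proof -
  obtain f where f: "bij_betw f A C" "\<forall>g\<in>carrier G. \<forall>x\<in>A. f (\<alpha> g x) = \<beta> g (f x)"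
    using assms(5) by (auto simp: gset_iso_def)
  obtain h where h: "bij_betw h B D" "\<forall>g\<in>carrier G. \<forall>x\<in>B. h (\<alpha> g x) = \<beta> g (h x)"
    using assms(6) by (auto simp: gset_iso_def)
  have "bij_betw (\<lambda>x. if x \<in> A then f x else h x) (A \<union> B) (C \<union> D)"
    by (rule bij_betw_disjoint_Un[OF f(1) h(1) assms(3,4)])
  moreover have "(if \<alpha> g x \<in> A then f (\<alpha> g x) else h (\<alpha> g x)) = \<beta> g (if x \<in> A then f x else h x)"
    if "g \<in> carrier G" "x \<in> A \<union> B" for g x
    using that f h actsD(1)[OF assms(1), of g x] actsD(1)[OF assms(2), of g x] assms(3) by auto
  ultimately show ?thesis unfolding gset_iso_def by blast
qed

lemma gset_iso_if_marks_eq: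
  fixes E :: "'x set" and F :: "'y set"
  assumes "finite (carrier G)"
  assumes "finite E" "acts G E \<alpha>" "finite F" "acts G F \<beta>"
    and "\<And>K. subgroup K G \<Longrightarrow>
      card {x \<in> E. K \<subseteq> stabilizer G \<alpha> x} = card {y \<in> F. K \<subseteq> stabilizer G \<beta> y}"
  shows "gset_iso G E \<alpha> F \<beta>"
  using assms(2-)
proof (induction "card E" arbitrary: E F rule: less_induct)
  case less
  have fin_stab: "finite (stabilizer G \<gamma> z)" for \<gamma> and z :: 'z
    using assms(1) stabilizer_subset by (rule rev_finite_subset)
  show ?case
  proof (cases "E = {}")
    case True
    \<comment> \<open>The mark at the trivial subgroup counts all points, so \<open>F\<close> is
      empty too.\<close>
    have "{y \<in> F. {\<one>} \<subseteq> stabilizer G \<beta> y} = F"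
      using actsD(2)[OF less.prems(4)] by (auto simp: stabilizer_def)
    then have "card F = 0" using less.prems(5)[OF triv_subgroup] True by simp
    then show ?thesis using True less.prems(3) by (simp add: gset_iso_refl gset_iso_def bij_betw_def)
  next
    case False
    let ?c = "\<lambda>z. card (stabilizer G \<alpha> z)"
    have "Max (?c ` E) \<in> ?c ` E" using False less.prems(1) by (intro Max_in) auto
    then obtain x where x: "x \<in> E" and "?c x = Max (?c ` E)" by auto
    then have max: "?c z \<le> ?c x" if "z \<in> E" for z
      using less.prems(1) that by simp
    let ?K = "stabilizer G \<alpha> x"
    \<comment> \<open>The point \<open>x\<close> is counted by the mark at \<open>?K\<close>, so
      \<open>F\<close> has a point \<open>y\<close> fixed by \<open>?K\<close>. The mark at its
      stabilizer \<open>?L\<close> then yields a point of \<open>E\<close> fixed by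
      \<open>?L\<close>. Since \<open>?K\<close> has maximal order among stabilizers in
      \<open>E\<close>, this squeezes \<open>?L\<close> down to \<open>?K\<close>.\<close>
    have "x \<in> {z \<in> E. ?K \<subseteq> stabilizer G \<alpha> z}" using x by simp
    then have "card {z \<in> E. ?K \<subseteq> stabilizer G \<alpha> z} > 0"
      using less.prems(1) by (auto simp: card_gt_0_iff)
    then have "card {y \<in> F. ?K \<subseteq> stabilizer G \<beta> y} > 0"
      using less.prems(5)[OF subgroup_stabilizer[OF less.prems(2) x]] by simp
    then obtain y where y: "y \<in> F" "?K \<subseteq> stabilizer G \<beta> y"
      by (auto simp: card_gt_0_iff)
    let ?L = "stabilizer G \<beta> y"
    have "card {z \<in> F. ?L \<subseteq> stabilizer G \<beta> z} > 0"
      using y less.prems(3) by (auto simp: card_gt_0_iff)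
    then have "card {z \<in> E. ?L \<subseteq> stabilizer G \<alpha> z} > 0"
      using less.prems(5)[OF subgroup_stabilizer[OF less.prems(4) y(1)]] by simp
    then obtain z where z: "z \<in> E" "?L \<subseteq> stabilizer G \<alpha> z"
      by (auto simp: card_gt_0_iff)
    have "card ?L \<le> card ?K"
      using max[OF z(1)] card_mono[OF fin_stab z(2)] by simp
    then have stab: "?K = ?L"
      using y(2) fin_stab by (metis card_seteq)
    let ?A = "orbit G \<alpha> x" and ?C = "orbit G \<beta> y"
    have iso: "gset_iso G ?A \<alpha> ?C \<beta>"
      by (rule orbit_iso[OF less.prems(2) x less.prems(4) y(1) stab])
    have AC: "?A \<subseteq> E" "x \<in> ?A" "?C \<subseteq> F"
      using orbit_closed(1,2)[OF less.prems(2) x] orbit_closed(1)[OF less.prems(4) y(1)] by auto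
    have "gset_iso G (E - ?A) \<alpha> (F - ?C) \<beta>"
    proof (rule less.hyps)
      show "card (E - ?A) < card E"
        using AC x less.prems(1) by (intro psubset_card_mono) auto
      show "acts G (E - ?A) \<alpha>" "acts G (F - ?C) \<beta>"
        by (rule acts_Diff_orbit[OF less.prems(2) x], rule acts_Diff_orbit[OF less.prems(4) y(1)])
      fix K assume K: "subgroup K G"
      let ?w = "\<lambda>H. if K \<subseteq> H then 1 else (0::nat)"
      have fin: "finite ?A" "finite ?C" using AC less.prems finite_subset by blast+
      \<comment> \<open>Isomorphic orbits contribute equally to each mark, so the complements again
        have equal marks. Subtraction in \<open>nat\<close> is exact because the orbits are
        subsets.\<close>
      have "(\<Sum>z\<in>?C. ?w (stabilizer G \<beta> z)) = (\<Sum>z\<in>?A. ?w (stabilizer G \<alpha> z))"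
        by (rule gset_weight_iso[OF acts_orbit[OF less.prems(2) x] iso])
      moreover have "(\<Sum>z\<in>E. ?w (stabilizer G \<alpha> z)) = (\<Sum>z\<in>F. ?w (stabilizer G \<beta> z))"
        using less.prems(5)[OF K] less.prems(1,3) by (simp add: sum.If_cases Int_def)
      ultimately have "(\<Sum>z\<in>E-?A. ?w (stabilizer G \<alpha> z)) = (\<Sum>z\<in>F-?C. ?w (stabilizer G \<beta> z))"
        using AC less.prems(1,3) by (simp only: sum_diff_nat fin)
      then show "card {z \<in> E-?A. K \<subseteq> stabilizer G \<alpha> z} = card {z \<in> F-?C. K \<subseteq> stabilizer G \<beta> z}"
        using less.prems(1,3) by (simp add: sum.If_cases Int_def)
    qed (use less.prems in auto)
    then have "gset_iso G (?A \<union> (E - ?A)) \<alpha> (?C \<union> (F - ?C)) \<beta>"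
      by (intro gset_iso_Un[OF acts_orbit[OF less.prems(2) x] acts_Diff_orbit[OF less.prems(2) x] _ _ iso])
        auto
    then show ?thesis using AC by (simp add: Un_absorb1)
  qed
qed

end


section \<open>Conjugation and coset actions\<close>

context group
begin

abbreviation conjg :: "'a \<Rightarrow> 'a set \<Rightarrow> 'a set" where
  "conjg g H \<equiv> g <# H #> inv g"

lemma conjg_image: "conjg g H = (\<lambda>x. g \<otimes> x \<otimes> inv g) ` H"
  by (auto simp: l_coset_def r_coset_def)

lemma conjg_mem_iff:
  assumes "g \<in> carrier G" "H \<subseteq> carrier G"
  shows "x \<in> conjg g H \<longleftrightarrow> x \<in> carrier G \<and> inv g \<otimes> x \<otimes> g \<in> H" (is "?L \<longleftrightarrow> ?R")
proof
  assume ?L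
  then obtain h where h: "h \<in> H" "x = g \<otimes> h \<otimes> inv g" by (auto simp: conjg_image)
  then have "h \<in> carrier G" using assms by blast
  then have "inv g \<otimes> x \<otimes> g = h"
    using h(2) assms(1) by (simp add: m_assoc inv_solve_left')
  then show ?R using h assms(1) \<open>h \<in> carrier G\<close> by simp
next
  assume r: ?R
  then have "g \<otimes> (inv g \<otimes> x \<otimes> g) \<otimes> inv g = g \<otimes> (inv g \<otimes> x)"
    using assms(1) by (simp add: m_assoc)
  also have "\<dots> = x" using r assms(1) by (simp flip: m_assoc)
  finally show ?L using r unfolding conjg_image by (metis imageI)
qed

lemma conjg_conjg:
  assumes "g \<in> carrier G" "h \<in> carrier G" "H \<subseteq> carrier G"
  shows "conjg g (conjg h H) = conjg (g \<otimes> h) H"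
  unfolding conjg_image image_image
  by (rule image_cong) (use assms in \<open>auto simp: m_assoc inv_mult_group subset_iff\<close>)

lemma conjg_one:
  assumes "H \<subseteq> carrier G"
  shows "conjg \<one> H = H"
proof -
  have "(\<lambda>x. \<one> \<otimes> x \<otimes> inv \<one>) ` H = (\<lambda>x. x) ` H"
    by (rule image_cong) (use assms in \<open>auto simp: subset_iff\<close>)
  then show ?thesis unfolding conjg_image by (simp only: image_ident)
qed

lemma conjg_subset: "\<lbrakk>g \<in> carrier G; H \<subseteq> carrier G\<rbrakk> \<Longrightarrow> conjg g H \<subseteq> carrier G"
  by (auto simp: conjg_mem_iff)

lemma conjg_inv:
  "\<lbrakk>g \<in> carrier G; H \<subseteq> carrier G\<rbrakk> \<Longrightarrow> conjg (inv g) (conjg g H) = H"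
  using conjg_conjg[of "inv g" g H] conjg_one[of H] by simp

lemma conjg_inv':
  "\<lbrakk>g \<in> carrier G; H \<subseteq> carrier G\<rbrakk> \<Longrightarrow> conjg g (conjg (inv g) H) = H"
  using conjg_conjg[of g "inv g" H] conjg_one[of H] by simp

lemma conjg_mono: "H \<subseteq> K \<Longrightarrow> conjg g H \<subseteq> conjg g K"
  unfolding conjg_image by (rule image_mono)

lemma conjg_subset_iff:
  assumes "g \<in> carrier G" "H \<subseteq> carrier G" "K \<subseteq> carrier G"
  shows "conjg g H \<subseteq> K \<longleftrightarrow> H \<subseteq> conjg (inv g) K"
  using conjg_mono[of "conjg g H" K "inv g"] conjg_mono[of H "conjg (inv g) K" g]
    conjg_inv[OF assms(1,2)] conjg_inv'[OF assms(1,3)] by metis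

lemma subgroup_conjg:
  assumes "g \<in> carrier G" "subgroup H G"
  shows "subgroup (conjg g H) G"
proof -
  interpret H: subgroup H G by fact
  note sub = H.subset
  show ?thesis
  proof (rule subgroupI)
    show "conjg g H \<subseteq> carrier G" using assms sub by (simp add: conjg_subset)
    show "conjg g H \<noteq> {}" unfolding conjg_image using H.one_closed by blast
  next
    fix x assume "x \<in> conjg g H"
    then obtain h where h: "h \<in> H" "x = g \<otimes> h \<otimes> inv g" by (auto simp: conjg_image)
    then have "inv x = g \<otimes> inv h \<otimes> inv g"
      using assms(1) by (simp add: inv_mult_group m_assoc)
    then show "inv x \<in> conjg g H" using h by (auto simp: conjg_image)
  next
    fix x y assume "x \<in> conjg g H" "y \<in> conjg g H"
    then obtain h k where h: "h \<in> H" "x = g \<otimes> h \<otimes> inv g" and k: "k \<in> H" "y = g \<otimes> k \<otimes> inv g"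
      by (auto simp: conjg_image)
    have "inv g \<otimes> (g \<otimes> (k \<otimes> inv g)) = k \<otimes> inv g"
      using assms(1) k(1) by (simp flip: m_assoc)
    then have "x \<otimes> y = g \<otimes> (h \<otimes> k) \<otimes> inv g"
      using assms(1) h k by (simp add: m_assoc)
    then show "x \<otimes> y \<in> conjg g H" using h k by (auto simp: conjg_image)
  qed
qed

lemma card_conjg:
  assumes "g \<in> carrier G" "H \<subseteq> carrier G"
  shows "card (conjg g H) = card H"
  unfolding conjg_image
  by (rule card_image, rule inj_onI) (use assms in \<open>auto simp: subset_iff\<close>)

lemma conj_class_mem_iff: "K \<in> conj_class G H \<longleftrightarrow> (\<exists>g\<in>carrier G. K = conjg g H)"
  by (auto simp: conj_class_def)

lemma conj_class_self: "H \<subseteq> carrier G \<Longrightarrow> H \<in> conj_class G H"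
  unfolding conj_class_mem_iff using conjg_one[of H] by (intro bexI[of _ \<one>]) auto

lemma conj_class_conjg:
  assumes "g \<in> carrier G" "H \<subseteq> carrier G"
  shows "conj_class G (conjg g H) = conj_class G H"
proof (intro equalityI subsetI)
  fix K assume "K \<in> conj_class G (conjg g H)"
  then obtain h where "h \<in> carrier G" "K = conjg h (conjg g H)" by (auto simp: conj_class_mem_iff)
  then show "K \<in> conj_class G H"
    using assms unfolding conj_class_mem_iff by (intro bexI[of _ "h \<otimes> g"]) (simp_all add: conjg_conjg)
next
  fix K assume "K \<in> conj_class G H"
  then obtain h where "h \<in> carrier G" "K = conjg h H" by (auto simp: conj_class_mem_iff)
  then show "K \<in> conj_class G (conjg g H)"
    using assms unfolding conj_class_mem_iff
    by (intro bexI[of _ "h \<otimes> inv g"]) (simp_all add: conjg_conjg m_assoc)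
qed

lemma conj_class_eq_iff:
  assumes "H \<subseteq> carrier G" "K \<subseteq> carrier G"
  shows "conj_class G K = conj_class G H \<longleftrightarrow> K \<in> conj_class G H"
  using conj_class_self[OF assms(2)] conj_class_conjg[OF _ assms(1)]
  by (auto simp: conj_class_mem_iff)

lemma normal_core_mem_iff: "x \<in> normal_core G H \<longleftrightarrow> (\<forall>g\<in>carrier G. x \<in> conjg g H)"
  by (simp add: normal_core_def)

lemma normal_core_subset: "H \<subseteq> carrier G \<Longrightarrow> normal_core G H \<subseteq> H"
  using conjg_one[of H] unfolding normal_core_def by blast

text \<open>Both cores are the intersection of one and the same conjugacy class.\<close>

lemma normal_core_conjg:
  assumes "g \<in> carrier G" "H \<subseteq> carrier G"
  shows "normal_core G (conjg g H) = normal_core G H"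
proof -
  have "(\<lambda>h. conjg h (conjg g H)) ` carrier G = conj_class G (conjg g H)"
    and "(\<lambda>h. conjg h H) ` carrier G = conj_class G H"
    by (auto simp: conj_class_def)
  then show ?thesis using conj_class_conjg[OF assms] by (simp add: normal_core_def)
qed

lemma normal_conjg:
  assumes "N \<lhd> G" "g \<in> carrier G"
  shows "conjg g N = N"
proof -
  interpret N: normal N G by fact
  have le: "conjg h N \<subseteq> N" if "h \<in> carrier G" for h
    using that N.inv_op_closed2 by (auto simp: conjg_image)
  have "N \<subseteq> conjg g N"
    using le[of "inv g"] conjg_subset_iff[of "inv g" N N] assms(2) N.subset by simp
  then show ?thesis using le[OF assms(2)] by blast
qed

text \<open>Conjugation fixes \<open>N\<close>, so \<open>N \<subseteq> H\<close> places
  \<open>N\<close> inside every conjugate of \<open>H\<close>. Containment of a normal subgroup in a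
  stabilizer thereby becomes a condition on the core of the stabilizer.\<close>

lemma normal_subset_core_iff:
  assumes "N \<lhd> G" "H \<subseteq> carrier G"
  shows "N \<subseteq> normal_core G H \<longleftrightarrow> N \<subseteq> H"
proof
  assume "N \<subseteq> H"
  have "N \<subseteq> conjg g H" if "g \<in> carrier G" for g
    using conjg_mono[OF \<open>N \<subseteq> H\<close>, of g] normal_conjg[OF assms(1) that] by simp
  then show "N \<subseteq> normal_core G H" unfolding normal_core_def by blast
qed (use normal_core_subset[OF assms(2)] in blast)

lemma normal_normal_core:
  assumes "subgroup H G"
  shows "normal_core G H \<lhd> G"
proof -
  have sub: "H \<subseteq> carrier G" using assms by (rule subgroup.subset)
  have "subgroup (\<Inter> ((\<lambda>g. conjg g H) ` carrier G)) G"
    by (rule subgroups_Inter) (use subgroup_conjg assms in auto)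
  then have S: "subgroup (normal_core G H) G" by (simp add: normal_core_def)
  show ?thesis
  proof (rule normal_invI[OF S])
    fix x h assume x: "x \<in> carrier G" and h: "h \<in> normal_core G H"
    show "x \<otimes> h \<otimes> inv x \<in> normal_core G H"
      unfolding normal_core_mem_iff
    proof
      fix g assume g: "g \<in> carrier G"
      \<comment> \<open>Conjugation by \<open>x\<close> permutes the conjugates of \<open>H\<close>;
        the one indexed by \<open>inv x \<otimes> g\<close> is the one it moves to index
        \<open>g\<close>.\<close>
      then have "h \<in> conjg (inv x \<otimes> g) H" using h x by (simp add: normal_core_mem_iff)
      then have "x \<otimes> h \<otimes> inv x \<in> conjg x (conjg (inv x \<otimes> g) H)"
        unfolding conjg_image[of x] by blast
      moreover have "x \<otimes> (inv x \<otimes> g) = g" using x g by (simp flip: m_assoc)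
      ultimately show "x \<otimes> h \<otimes> inv x \<in> conjg g H"
        using x g sub by (simp add: conjg_conjg)
    qed
  qed
qed

section \<open>Stabilizers of translates, coset actions and the splitting off of an orbit\<close>

lemma stabilizer_conj:
  assumes "acts G E \<alpha>" "x \<in> E" "g \<in> carrier G"
  shows "stabilizer G \<alpha> (\<alpha> g x) = conjg g (stabilizer G \<alpha> x)"
proof (rule Set.set_eqI)
  fix k
  note act = actsD[OF assms(1)]
  show "k \<in> stabilizer G \<alpha> (\<alpha> g x) \<longleftrightarrow> k \<in> conjg g (stabilizer G \<alpha> x)"
  proof (cases "k \<in> carrier G")
    case True
    have "\<alpha> (inv g \<otimes> k \<otimes> g) x = \<alpha> (inv g) (\<alpha> k (\<alpha> g x))"
      using act(3)[of "inv g \<otimes> k" g x] act(3)[of "inv g" k "\<alpha> g x"] act(1) True assms by simp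
    moreover have "\<alpha> g (\<alpha> (inv g) (\<alpha> k (\<alpha> g x))) = \<alpha> k (\<alpha> g x)"
      using acts_inv[OF assms(1), of "inv g" "\<alpha> k (\<alpha> g x)"] act(1) True assms by simp
    moreover have "\<alpha> (inv g) (\<alpha> g x) = x" by (rule acts_inv[OF assms(1,3,2)])
    ultimately have "\<alpha> (inv g \<otimes> k \<otimes> g) x = x \<longleftrightarrow> \<alpha> k (\<alpha> g x) = \<alpha> g x" by metis
    then show ?thesis
      unfolding conjg_mem_iff[OF assms(3) stabilizer_subset] using True assms(3)
      by (simp add: stabilizer_def)
  next
    case False
    then show ?thesis
      unfolding conjg_mem_iff[OF assms(3) stabilizer_subset] by (simp add: stabilizer_def)
  qed
qed

abbreviation lcoset_action :: "'a set \<Rightarrow> 'a \<Rightarrow> 'a set \<Rightarrow> 'a set" where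
  "lcoset_action H \<equiv> (\<lambda>g. \<lambda>C \<in> lcosets H. g <# C)"

lemma lcosets_mem_iff: "C \<in> lcosets H \<longleftrightarrow> (\<exists>a\<in>carrier G. C = a <# H)"
  by (auto simp: LCOSETS_def)

lemma l_coset_mem_lcosets:
  assumes "H \<subseteq> carrier G" "g \<in> carrier G" "C \<in> lcosets H"
  shows "g <# C \<in> lcosets H"
proof -
  obtain a where a: "a \<in> carrier G" "C = a <# H" using assms(3) by (auto simp: lcosets_mem_iff)
  then have "g <# C = (g \<otimes> a) <# H" using assms by (simp add: lcos_m_assoc)
  then show ?thesis using a assms(2) by (auto simp: lcosets_mem_iff)
qed

lemma acts_lcosets:
  assumes "H \<subseteq> carrier G"
  shows "acts G (lcosets H) (lcoset_action H)"
proof (rule actsI)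
  fix C assume C: "C \<in> lcosets H"
  then have sub: "C \<subseteq> carrier G"
    using assms l_coset_subset_G by (auto simp: lcosets_mem_iff)
  then show "lcoset_action H \<one> C = C" using C by (simp add: lcos_mult_one)
  fix g h assume gh: "g \<in> carrier G" "h \<in> carrier G"
  then show "lcoset_action H (g \<otimes> h) C = lcoset_action H g (lcoset_action H h C)"
    using C sub l_coset_mem_lcosets[OF assms] by (simp add: lcos_m_assoc)
qed (simp add: l_coset_mem_lcosets[OF assms])

lemma self_mem_lcosets: "H \<subseteq> carrier G \<Longrightarrow> H \<in> lcosets H"
  unfolding lcosets_mem_iff by (rule bexI[of _ \<one>]) (simp_all add: lcos_mult_one)

lemma orbit_lcosets:
  assumes "H \<subseteq> carrier G"
  shows "orbit G (lcoset_action H) H = lcosets H"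
  using self_mem_lcosets[OF assms] by (auto simp: orbit_def lcosets_mem_iff)

lemma stabilizer_lcosets_self:
  assumes "subgroup H G"
  shows "stabilizer G (lcoset_action H) H = H"
proof -
  interpret H: subgroup H G by fact
  have "g <# H = H \<longleftrightarrow> g \<in> H" if "g \<in> carrier G" for g
    using coset_join3[OF that assms] lcos_self[OF that assms] by blast
  then show ?thesis
    using self_mem_lcosets[OF H.subset] H.subset by (auto simp: stabilizer_def)
qed

lemma stabilizer_lcosets:
  assumes "subgroup H G" "g \<in> carrier G"
  shows "stabilizer G (lcoset_action H) (g <# H) = conjg g H"
proof -
  have sub: "H \<subseteq> carrier G" using assms(1) by (rule subgroup.subset)
  show ?thesis
    using stabilizer_conj[OF acts_lcosets[OF sub] self_mem_lcosets[OF sub] assms(2)]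
      stabilizer_lcosets_self[OF assms(1)] self_mem_lcosets[OF sub] by simp
qed

text \<open>Orbit-stabilizer as an isomorphism: \<open>x\<close> and the trivial coset are base
  points of transitive \<open>G\<close>-sets with the same stabilizer.\<close>

lemma gset_class_orbit:
  assumes "acts G E \<alpha>" "x \<in> E"
  shows "gset_class G (orbit G \<alpha> x) \<alpha> = coset_gset_class G (stabilizer G \<alpha> x)"
proof -
  let ?H = "stabilizer G \<alpha> x"
  have H: "subgroup ?H G" by (rule subgroup_stabilizer[OF assms])
  then have sub: "?H \<subseteq> carrier G" by (rule subgroup.subset)
  show ?thesis
    unfolding coset_gset_class_def
    using gset_class_eqI[OF acts_orbit[OF assms]
        orbit_iso[OF assms acts_lcosets[OF sub] self_mem_lcosets[OF sub]
          stabilizer_lcosets_self[OF H, symmetric]]] orbit_lcosets[OF sub] by simp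
qed

lemma gset_class_split:
  assumes "finite E" "acts G E \<alpha>" "x \<in> E"
  shows "gset_class G E \<alpha> =
    coset_gset_class G (stabilizer G \<alpha> x) \<oplus>\<^bsub>gset_semiring G\<^esub> gset_class G (E - orbit G \<alpha> x) \<alpha>"
proof -
  let ?A = "orbit G \<alpha> x"
  have A: "?A \<subseteq> E" using orbit_closed(1)[OF assms(2,3)] .
  have fin: "finite ?A" using A assms(1) finite_subset by blast
  let ?f = "\<lambda>z. if z \<in> ?A then Inl z else Inr z"
  have "bij_betw ?f E (?A <+> (E - ?A))"
    by (rule bij_betwI[where g = "case_sum id id"]) (use A in \<open>auto split: if_splits\<close>)
  moreover have "?f (\<alpha> g z) = sum_action ?A \<alpha> (E - ?A) \<alpha> g (?f z)" if "g \<in> carrier G" "z \<in> E" for g z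
    using that orbit_closed(3)[OF assms(2,3) that(1), of z] orbit_closed(4)[OF assms(2,3) that(1), of z]
    by (auto simp: sum_action_def)
  ultimately have iso: "gset_iso G E \<alpha> (?A <+> (E - ?A)) (sum_action ?A \<alpha> (E - ?A) \<alpha>)"
    unfolding gset_iso_def by blast
  show ?thesis
    using gset_class_eqI[OF assms(2) iso] assms(1)
      gset_add[OF fin acts_orbit[OF assms(2,3)] _ acts_Diff_orbit[OF assms(2,3)]]
    by (simp add: gset_class_orbit[OF assms(2,3)])
qed

end


section \<open>The Burnside ring as a ring of functions\<close>

locale finite_group = group +
  assumes finite_carrier: "finite (carrier G)"
begin

lemma finite_lcosets: "finite (lcosets H)"
  using finite_carrier by (simp add: LCOSETS_def)

lemma coset_gset_class_closed:
  "subgroup H G \<Longrightarrow> coset_gset_class G H \<in> carrier (gset_semiring G)"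
  unfolding coset_gset_class_def
  by (rule gset_class_closed[OF finite_lcosets acts_lcosets[OF subgroup.subset]])

text \<open>The transitive \<open>G\<close>-sets generate the semiring additively: orbits are
  removed one at a time until nothing is left.\<close>

lemma gset_induct [consumes 1, case_names zero add]:
  assumes "a \<in> carrier (gset_semiring G)"
    and "P \<zero>\<^bsub>gset_semiring G\<^esub>"
    and "\<And>H a. \<lbrakk>subgroup H G; a \<in> carrier (gset_semiring G); P a\<rbrakk>
      \<Longrightarrow> P (coset_gset_class G H \<oplus>\<^bsub>gset_semiring G\<^esub> a)"
  shows "P a"
proof -
  have "P (gset_class G E \<alpha>)" if "finite E" "acts G E \<alpha>" for E :: "nat set" and \<alpha>
    using that
  proof (induction "card E" arbitrary: E rule: less_induct)
    case less
    show ?case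
    proof (cases "E = {}")
      case True
      have "gset_class G ({} :: nat set) \<alpha> = gset_class G ({} :: nat set) (\<lambda>g. \<lambda>x\<in>{}. x)"
        by (rule gset_class_eqI[OF acts_empty]) (simp add: gset_iso_def bij_betw_def)
      then show ?thesis using True assms(2) by (simp add: gset_semiring_def)
    next
      case False
      then obtain x where x: "x \<in> E" by blast
      have "P (gset_class G (E - orbit G \<alpha> x) \<alpha>)"
      proof (rule less.hyps)
        show "card (E - orbit G \<alpha> x) < card E"
          using orbit_closed(2)[OF less.prems(2) x] x less.prems(1) by (intro psubset_card_mono) auto
      qed (use less.prems(1) acts_Diff_orbit[OF less.prems(2) x] in simp_all)
      moreover have "gset_class G (E - orbit G \<alpha> x) \<alpha> \<in> carrier (gset_semiring G)"
        using less.prems(1) by (intro gset_class_closed acts_Diff_orbit[OF less.prems(2) x]) simp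
      ultimately show ?thesis
        unfolding gset_class_split[OF less.prems x]
        by (intro assms(3) subgroup_stabilizer[OF less.prems(2) x])
    qed
  qed
  then show ?thesis using gset_cases[OF assms(1)] by metis
qed

text \<open>The stabilizers of the points of \<open>G/H\<close> are the conjugates of
  \<open>H\<close>, so a weight invariant under conjugation is constant on these points.\<close>

lemma gset_weight_coset:
  fixes w :: "'a set \<Rightarrow> 'w::comm_semiring_1"
  assumes "subgroup H G" and "\<And>g. g \<in> carrier G \<Longrightarrow> w (conjg g H) = w H"
  shows "gset_weight w (coset_gset_class G H) = of_nat (card (lcosets H)) * w H"
proof -
  have "gset_weight w (coset_gset_class G H) = (\<Sum>C\<in>lcosets H. w (stabilizer G (lcoset_action H) C))"
    unfolding coset_gset_class_def
    by (rule gset_weight_class[OF finite_lcosets acts_lcosets[OF subgroup.subset[OF assms(1)]]])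
  also have "\<dots> = (\<Sum>C\<in>lcosets H. w H)"
  proof (rule sum.cong)
    fix C assume "C \<in> lcosets H"
    then obtain g where "g \<in> carrier G" "C = g <# H" by (auto simp: lcosets_mem_iff)
    then show "w (stabilizer G (lcoset_action H) C) = w H"
      by (simp only: stabilizer_lcosets[OF assms(1)] assms(2))
  qed simp
  finally show ?thesis by simp
qed

lemma lcosets_carrier_self: "lcosets (carrier G) = {carrier G}"
proof -
  have "a <# carrier G = carrier G" if "a \<in> carrier G" for a
    using that by (simp add: coset_join3 subgroup_self)
  then show ?thesis by (auto simp: LCOSETS_def)
qed

lemma conjg_carrier: "g \<in> carrier G \<Longrightarrow> conjg g (carrier G) = carrier G"
  by (rule normal_conjg) (rule normal_self)

lemma gset_one: "\<one>\<^bsub>gset_semiring G\<^esub> = coset_gset_class G (carrier G)"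
  by (simp add: gset_semiring_def)

lemma gset_weight_one:
  fixes w :: "'a set \<Rightarrow> 'w::comm_semiring_1"
  shows "gset_weight w \<one>\<^bsub>gset_semiring G\<^esub> = w (carrier G)"
  using gset_weight_coset[OF subgroup_self, of w] by (simp add: gset_one conjg_carrier lcosets_carrier_self)

text \<open>The coset \<open>g <# H\<close> is fixed by \<open>K\<close> iff \<open>K\<close> lies
  in its stabilizer \<open>conjg g H\<close>. This is the triangular shape of the table of marks
  with respect to subconjugacy.\<close>

lemma gset_mark_coset_pos_iff:
  assumes "subgroup H G" "K \<subseteq> carrier G"
  shows "gset_mark K (coset_gset_class G H) > 0 \<longleftrightarrow> (\<exists>g\<in>carrier G. K \<subseteq> conjg g H)"
proof -
  have "gset_mark K (coset_gset_class G H) =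
      card {C \<in> lcosets H. K \<subseteq> stabilizer G (lcoset_action H) C}"
    unfolding coset_gset_class_def
    by (rule gset_mark_class[OF finite_lcosets acts_lcosets[OF subgroup.subset[OF assms(1)]] assms(2)])
  also have "\<dots> > 0 \<longleftrightarrow> (\<exists>C\<in>lcosets H. K \<subseteq> stabilizer G (lcoset_action H) C)"
    using finite_lcosets by (auto simp: card_gt_0_iff)
  also have "\<dots> \<longleftrightarrow> (\<exists>g\<in>carrier G. K \<subseteq> stabilizer G (lcoset_action H) (g <# H))"
    unfolding Bex_def lcosets_mem_iff by blast
  also have "\<dots> \<longleftrightarrow> (\<exists>g\<in>carrier G. K \<subseteq> conjg g H)"
    by (simp only: stabilizer_lcosets[OF assms(1)] cong: bex_cong)
  finally show ?thesis .
qed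

text \<open>Translation by \<open>g\<close> carries the points fixed by \<open>K\<close> to those
  fixed by its conjugate, since stabilizers are conjugated along with their points.\<close>

lemma gset_mark_conjg:
  assumes "a \<in> carrier (gset_semiring G)" "K \<subseteq> carrier G" "g \<in> carrier G"
  shows "gset_mark (conjg g K) a = gset_mark K a"
proof -
  obtain E :: "nat set" and \<alpha> where E: "finite E" "acts G E \<alpha>" "a = gset_class G E \<alpha>"
    using gset_cases[OF assms(1)] .
  note act = actsD[OF E(2)]
  have "bij_betw (\<alpha> g) {x \<in> E. K \<subseteq> stabilizer G \<alpha> x} {x \<in> E. conjg g K \<subseteq> stabilizer G \<alpha> x}"
  proof (rule bij_betw_byWitness[where f' = "\<alpha> (inv g)"])
    show "\<forall>x\<in>{x \<in> E. K \<subseteq> stabilizer G \<alpha> x}. \<alpha> (inv g) (\<alpha> g x) = x"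
      using acts_inv[OF E(2) assms(3)] by blast
    show "\<forall>x\<in>{x \<in> E. conjg g K \<subseteq> stabilizer G \<alpha> x}. \<alpha> g (\<alpha> (inv g) x) = x"
      using acts_inv[OF E(2), of "inv g"] assms(3) by simp
    show "\<alpha> g ` {x \<in> E. K \<subseteq> stabilizer G \<alpha> x} \<subseteq> {x \<in> E. conjg g K \<subseteq> stabilizer G \<alpha> x}"
    proof (rule image_subsetI, clarify, intro conjI)
      fix x assume x: "x \<in> E" "K \<subseteq> stabilizer G \<alpha> x"
      show "\<alpha> g x \<in> E" using act(1)[OF assms(3) x(1)] .
      show "conjg g K \<subseteq> stabilizer G \<alpha> (\<alpha> g x)"
        unfolding stabilizer_conj[OF E(2) x(1) assms(3)] by (rule conjg_mono[OF x(2)])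
    qed
    show "\<alpha> (inv g) ` {x \<in> E. conjg g K \<subseteq> stabilizer G \<alpha> x} \<subseteq> {x \<in> E. K \<subseteq> stabilizer G \<alpha> x}"
    proof (rule image_subsetI, clarify, intro conjI)
      fix x assume x: "x \<in> E" "conjg g K \<subseteq> stabilizer G \<alpha> x"
      show "\<alpha> (inv g) x \<in> E" using act(1)[OF _ x(1)] assms(3) by simp
      show "K \<subseteq> stabilizer G \<alpha> (\<alpha> (inv g) x)"
        unfolding stabilizer_conj[OF E(2) x(1) inv_closed[OF assms(3)]]
        by (rule iffD1[OF conjg_subset_iff[OF assms(3,2) stabilizer_subset] x(2)])
    qed
  qed
  then have "card {x \<in> E. K \<subseteq> stabilizer G \<alpha> x} = card {x \<in> E. conjg g K \<subseteq> stabilizer G \<alpha> x}"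
    by (rule bij_betw_same_card)
  then show ?thesis
    unfolding E(3) gset_mark_class[OF E(1,2) assms(2)]
      gset_mark_class[OF E(1,2) conjg_subset[OF assms(3,2)]] by simp
qed

text \<open>Marks are indexed by all sets, non-subgroups being replaced by \<open>G\<close>, so that the ring
  embeddings take values in functions on a type.\<close>

definition sub_index :: "'a set \<Rightarrow> 'a set" where
  "sub_index K = (if subgroup K G then K else carrier G)"

lemma subgroup_sub_index: "subgroup (sub_index K) G"
  by (simp add: sub_index_def subgroup_self)

lemma sub_index_subset: "sub_index K \<subseteq> carrier G"
  by (rule subgroup.subset[OF subgroup_sub_index])

lemma sub_index_eq: "subgroup K G \<Longrightarrow> sub_index K = K"
  by (simp add: sub_index_def)

text \<open>Injectivity is \<open>gset_iso_if_marks_eq\<close>, and additivity holds because marks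
  are weights. The two interpretations that follow pass ring structure and separation by marks on to
  the Burnside ring and to its rational version.\<close>

sublocale gs: semiring_embedding "gset_semiring G" "\<lambda>a K. gset_mark (sub_index K) a"
proof (rule semiring_embedding.intro)
  fix a b assume ab: "a \<in> carrier (gset_semiring G)" "b \<in> carrier (gset_semiring G)"
    and eq: "\<And>k. gset_mark (sub_index k) a = gset_mark (sub_index k) b"
  obtain E :: "nat set" and \<alpha> where E: "finite E" "acts G E \<alpha>" "a = gset_class G E \<alpha>"
    using gset_cases[OF ab(1)] .
  obtain F :: "nat set" and \<beta> where F: "finite F" "acts G F \<beta>" "b = gset_class G F \<beta>"
    using gset_cases[OF ab(2)] .
  have "gset_iso G E \<alpha> F \<beta>"
  proof (rule gset_iso_if_marks_eq[OF finite_carrier E(1,2) F(1,2)])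
    fix K assume K: "subgroup K G"
    then show "card {x \<in> E. K \<subseteq> stabilizer G \<alpha> x} = card {y \<in> F. K \<subseteq> stabilizer G \<beta> y}"
      using eq[of K] gset_mark_class[OF E(1,2) subgroup.subset[OF K]]
        gset_mark_class[OF F(1,2) subgroup.subset[OF K]] E(3) F(3) by (simp add: sub_index_eq)
  qed
  then show "a = b" using gset_class_eqI[OF E(2)] E F by simp
next
  show one: "\<one>\<^bsub>gset_semiring G\<^esub> \<in> carrier (gset_semiring G)"
    unfolding gset_one by (rule coset_gset_class_closed[OF subgroup_self])
  show "gset_mark (sub_index k) \<one>\<^bsub>gset_semiring G\<^esub> = 1" for k
    unfolding gset_mark_weight[OF one sub_index_subset] gset_weight_one
    by (simp add: sub_index_subset)
  show "gset_mark (sub_index k) \<zero>\<^bsub>gset_semiring G\<^esub> = 0" for k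
    using gset_mark_weight[OF gset_zero_closed sub_index_subset] by (simp add: gset_weight_zero)
  show "gset_mark (sub_index k) (a \<oplus>\<^bsub>gset_semiring G\<^esub> b) =
      gset_mark (sub_index k) a + gset_mark (sub_index k) b"
    if "a \<in> carrier (gset_semiring G)" "b \<in> carrier (gset_semiring G)" for a b k
    unfolding gset_mark_weight[OF that(1) sub_index_subset] gset_mark_weight[OF that(2) sub_index_subset]
      gset_mark_weight[OF gset_add_closed[OF that] sub_index_subset] gset_weight_add[OF that] ..
qed (simp_all add: gset_add_closed gset_mult_closed gset_zero_closed
    gset_mark_mult[OF _ _ sub_index_subset])


sublocale br: int_ring_embedding "burnside_ring G" "\<lambda>P K. burnside_mark (sub_index K) P"
proof -
  have eq: "groth_ext (\<lambda>a. int (gset_mark K a)) = burnside_mark K" for K :: "'a set"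
    by (simp add: fun_eq_iff groth_ext_def burnside_mark_def)
  show "int_ring_embedding (burnside_ring G) (\<lambda>P K. burnside_mark (sub_index K) P)"
    using gs.ring_embedding_groth unfolding eq
    by (simp add: int_ring_embedding_def burnside_ring_def)
qed

sublocale qb: ring_embedding "rat_burnside_ring G" "\<lambda>q K. rat_burnside_mark (sub_index K) q"
proof -
  have eq: "br.rat_emb q K = rat_burnside_mark (sub_index K) q" for q K
    by (simp add: br.rat_emb_def rat_burnside_mark_def)
  show "ring_embedding (rat_burnside_ring G) (\<lambda>q K. rat_burnside_mark (sub_index K) q)"
    using br.ring_embedding_rat unfolding eq by (simp add: rat_burnside_ring_def)
qed

lemma rat_mark_frac:
  assumes "x \<in> carrier (burnside_ring G)" "m \<noteq> 0" "subgroup K G"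
  shows "rat_burnside_mark K (rat_frac (burnside_ring G) x m) = of_int (burnside_mark K x) / of_int m"
  using br.rat_emb_frac[OF assms(1,2), of K]
  by (simp add: br.rat_emb_def rat_burnside_mark_def sub_index_eq[OF assms(3)])

lemma rat_frac_closed:
  "\<lbrakk>x \<in> carrier (burnside_ring G); m \<noteq> 0\<rbrakk> \<Longrightarrow>
    rat_frac (burnside_ring G) x m \<in> carrier (rat_burnside_ring G)"
  by (simp add: rat_burnside_ring_def br.rat_frac_mem)

lemma to_rat_closed:
  "x \<in> carrier (burnside_ring G) \<Longrightarrow> burnside_to_rat G x \<in> carrier (rat_burnside_ring G)"
  by (simp add: rat_burnside_ring_def br.to_rat_mem)

lemma rat_mark_to_rat:
  assumes "x \<in> carrier (burnside_ring G)" "subgroup K G"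
  shows "rat_burnside_mark K (burnside_to_rat G x) = of_int (burnside_mark K x)"
  using rat_mark_frac[OF assms(1) _ assms(2), of 1] by (simp add: rat_frac_def to_rat_def)

lemma burnside_eqI:
  assumes "x \<in> carrier (burnside_ring G)" "y \<in> carrier (burnside_ring G)"
    and "\<And>K. subgroup K G \<Longrightarrow> burnside_mark K x = burnside_mark K y"
  shows "x = y"
  by (rule br.emb_inj[OF assms(1,2)]) (rule assms(3)[OF subgroup_sub_index])

lemma rat_burnside_eqI:
  assumes "x \<in> carrier (rat_burnside_ring G)" "y \<in> carrier (rat_burnside_ring G)"
    and "\<And>K. subgroup K G \<Longrightarrow> rat_burnside_mark K x = rat_burnside_mark K y"
  shows "x = y"
  by (rule qb.emb_inj[OF assms(1,2)]) (rule assms(3)[OF subgroup_sub_index])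

lemma burnside_cases:
  assumes "P \<in> carrier (burnside_ring G)"
  obtains a b where "a \<in> carrier (gset_semiring G)" "b \<in> carrier (gset_semiring G)"
    "P = groth_diff (gset_semiring G) a b"
  using gs.groth_cases assms unfolding burnside_ring_def by metis

lemma groth_diff_closed:
  "\<lbrakk>a \<in> carrier (gset_semiring G); b \<in> carrier (gset_semiring G)\<rbrakk> \<Longrightarrow>
    groth_diff (gset_semiring G) a b \<in> carrier (burnside_ring G)"
  by (simp add: burnside_ring_def gs.groth_diff_mem)

lemma burnside_mark_diff:
  assumes "a \<in> carrier (gset_semiring G)" "b \<in> carrier (gset_semiring G)" "subgroup K G"
  shows "burnside_mark K (groth_diff (gset_semiring G) a b) = int (gset_mark K a) - int (gset_mark K b)"
  using gs.groth_mark_diff[OF assms(1,2), of K]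
  by (simp add: groth_ext_def burnside_mark_def sub_index_eq[OF assms(3)])

lemma coset_elt_diff:
  "coset_elt G H = groth_diff (gset_semiring G) (coset_gset_class G H) \<zero>\<^bsub>gset_semiring G\<^esub>"
  by (simp add: coset_elt_def groth_diff_def)

lemma coset_elt_closed: "subgroup H G \<Longrightarrow> coset_elt G H \<in> carrier (burnside_ring G)"
  by (simp add: coset_elt_diff groth_diff_closed coset_gset_class_closed gset_zero_closed)

lemma burnside_mark_coset:
  assumes "subgroup H G" "subgroup K G"
  shows "burnside_mark K (coset_elt G H) = int (gset_mark K (coset_gset_class G H))"
proof -
  have "gset_mark K \<zero>\<^bsub>gset_semiring G\<^esub> = 0"
    using gset_mark_weight[OF gset_zero_closed subgroup.subset[OF assms(2)]]
    by (simp add: gset_weight_zero)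
  then show ?thesis
    using assms by (simp add: coset_elt_diff burnside_mark_diff coset_gset_class_closed gset_zero_closed)
qed

lemma burnside_mark_conjg:
  assumes "P \<in> carrier (burnside_ring G)" "subgroup K G" "g \<in> carrier G"
  shows "burnside_mark (conjg g K) P = burnside_mark K P"
  using burnside_cases[OF assms(1)]
  by (metis assms(2,3) burnside_mark_diff gset_mark_conjg subgroup.subset subgroup_conjg)

lemma burnside_mark_conj_class:
  assumes "P \<in> carrier (burnside_ring G)" "subgroup K G" "L \<in> conj_class G K"
  shows "burnside_mark L P = burnside_mark K P"
  using assms(3) burnside_mark_conjg[OF assms(1,2)] by (auto simp: conj_class_mem_iff)

lemma burnside_mark_ops:
  assumes "subgroup K G" "x \<in> carrier (burnside_ring G)" "y \<in> carrier (burnside_ring G)"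
  shows "burnside_mark K (x \<oplus>\<^bsub>burnside_ring G\<^esub> y) = burnside_mark K x + burnside_mark K y"
    and "burnside_mark K (x \<ominus>\<^bsub>burnside_ring G\<^esub> y) = burnside_mark K x - burnside_mark K y"
    and "burnside_mark K (x \<otimes>\<^bsub>burnside_ring G\<^esub> y) = burnside_mark K x * burnside_mark K y"
    and "burnside_mark K ([(n::int)] \<cdot>\<^bsub>burnside_ring G\<^esub> x) = n * burnside_mark K x"
    and "burnside_mark K \<one>\<^bsub>burnside_ring G\<^esub> = 1"
    and "burnside_mark K \<zero>\<^bsub>burnside_ring G\<^esub> = 0"
  using br.emb_add[OF assms(2,3), of K] br.emb_minus[OF assms(2,3), of K]
    br.emb_mult[OF assms(2,3), of K] br.emb_int_pow[OF assms(2), where n = n and k = K]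
    br.emb_one[of K] br.emb_zero[of K]
  by (simp_all add: sub_index_eq[OF assms(1)])

lemma rat_mark_ops:
  assumes "subgroup K G" "x \<in> carrier (rat_burnside_ring G)" "y \<in> carrier (rat_burnside_ring G)"
  shows "rat_burnside_mark K (x \<oplus>\<^bsub>rat_burnside_ring G\<^esub> y) = rat_burnside_mark K x + rat_burnside_mark K y"
    and "rat_burnside_mark K (x \<ominus>\<^bsub>rat_burnside_ring G\<^esub> y) = rat_burnside_mark K x - rat_burnside_mark K y"
    and "rat_burnside_mark K ([(n::int)] \<cdot>\<^bsub>rat_burnside_ring G\<^esub> x) = of_int n * rat_burnside_mark K x"
    and "rat_burnside_mark K \<one>\<^bsub>rat_burnside_ring G\<^esub> = 1"
  using qb.emb_add[OF assms(2,3), of K] qb.emb_minus[OF assms(2,3), of K]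
    qb.emb_int_pow[OF assms(2), where n = n and k = K] qb.emb_one[of K]
  by (simp_all add: sub_index_eq[OF assms(1)])


section \<open>Idempotents\<close>

text \<open>If all elements had equal marks at \<open>H\<close> and \<open>L\<close>, testing on
  \<open>G/H\<close> and \<open>G/L\<close> would make each subgroup subconjugate to the other, and
  comparison of orders would make them conjugate.\<close>

lemma marks_separate:
  assumes H: "subgroup H G" and L: "subgroup L G" and "L \<notin> conj_class G H"
  shows "\<exists>v\<in>carrier (burnside_ring G). burnside_mark L v \<noteq> burnside_mark H v"
proof (rule ccontr)
  note subs = subgroup.subset[OF H] subgroup.subset[OF L]
  assume "\<not> ?thesis"
  then have eq: "burnside_mark L (coset_elt G M) = burnside_mark H (coset_elt G M)"
    if "subgroup M G" for M
    using coset_elt_closed[OF that] by blast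
  have pos: "0 < gset_mark M (coset_gset_class G M)" if "subgroup M G" for M
    unfolding gset_mark_coset_pos_iff[OF that subgroup.subset[OF that]]
    using conjg_one[OF subgroup.subset[OF that]] by (intro bexI[of _ \<one>]) auto
  have "0 < gset_mark L (coset_gset_class G H)"
    using eq[OF H] pos[OF H] burnside_mark_coset H L by simp
  then obtain g where g: "g \<in> carrier G" "L \<subseteq> conjg g H"
    using gset_mark_coset_pos_iff H subs(2) by blast
  have "0 < gset_mark H (coset_gset_class G L)"
    using eq[OF L] pos[OF L] burnside_mark_coset H L by simp
  then obtain h where h: "h \<in> carrier G" "H \<subseteq> conjg h L"
    using gset_mark_coset_pos_iff L subs(1) by blast
  have fin: "finite (conjg g H)" "finite (conjg h L)"
    using finite_subset[OF conjg_subset finite_carrier] g h subs by blast+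
  have "card (conjg g H) \<le> card L"
    using card_mono[OF fin(2) h(2)] card_conjg g(1) h(1) subs by simp
  then have "L = conjg g H" using g(2) fin(1) by (simp add: card_seteq)
  then show False using assms(3) g(1) by (auto simp: conj_class_mem_iff)
qed

text \<open>Interpolation: for each \<open>L\<close> in \<open>A\<close> a factor
  \<open>v - c\<close> is multiplied in, where \<open>c\<close> is the constant equal to the mark of
  \<open>v\<close> at \<open>L\<close>. It vanishes at \<open>L\<close> but not at \<open>H\<close>.
  The resulting mark at \<open>H\<close> is nonzero but need not be 1, so normalization is left to
  the rational ring.\<close>

lemma mark_supported_on_class:
  assumes H: "subgroup H G" and "finite A"
    and "\<And>L. L \<in> A \<Longrightarrow> subgroup L G \<and> L \<notin> conj_class G H"
  shows "\<exists>y\<in>carrier (burnside_ring G). burnside_mark H y \<noteq> 0 \<and> (\<forall>L\<in>A. burnside_mark L y = 0)"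
  using assms(2,3)
proof (induction A)
  case empty
  show ?case
    using burnside_mark_ops(5)[OF H br.zero_closed br.zero_closed] by (intro bexI[of _ "\<one>\<^bsub>burnside_ring G\<^esub>"]) auto
next
  case (insert L A)
  then obtain y where y: "y \<in> carrier (burnside_ring G)" "burnside_mark H y \<noteq> 0"
    "\<forall>L\<in>A. burnside_mark L y = 0" by blast
  have L: "subgroup L G" "L \<notin> conj_class G H" using insert.prems by auto
  obtain v where v: "v \<in> carrier (burnside_ring G)" "burnside_mark L v \<noteq> burnside_mark H v"
    using marks_separate[OF H L] by blast
  define c where "c = [burnside_mark L v] \<cdot>\<^bsub>burnside_ring G\<^esub> \<one>\<^bsub>burnside_ring G\<^esub>"
  have c: "c \<in> carrier (burnside_ring G)"
    unfolding c_def by (rule br.int_pow_closed) simp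
  have mark: "burnside_mark M (y \<otimes>\<^bsub>burnside_ring G\<^esub> (v \<ominus>\<^bsub>burnside_ring G\<^esub> c)) =
      burnside_mark M y * (burnside_mark M v - burnside_mark L v)" if M: "subgroup M G" for M
  proof -
    have "burnside_mark M c = burnside_mark L v"
      unfolding c_def using burnside_mark_ops(4,5)[OF M br.one_closed br.one_closed] by simp
    then show ?thesis
      using burnside_mark_ops(3)[OF M y(1) br.minus_closed[OF v(1) c]] burnside_mark_ops(2)[OF M v(1) c]
      by simp
  qed
  show ?case
  proof (intro bexI conjI ballI)
    show "y \<otimes>\<^bsub>burnside_ring G\<^esub> (v \<ominus>\<^bsub>burnside_ring G\<^esub> c) \<in> carrier (burnside_ring G)"
      using y(1) v(1) c by simp
    show "burnside_mark H (y \<otimes>\<^bsub>burnside_ring G\<^esub> (v \<ominus>\<^bsub>burnside_ring G\<^esub> c)) \<noteq> 0"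
      using mark[OF H] y(2) v(2) by simp
    fix M assume "M \<in> insert L A"
    then show "burnside_mark M (y \<otimes>\<^bsub>burnside_ring G\<^esub> (v \<ominus>\<^bsub>burnside_ring G\<^esub> c)) = 0"
      using mark[of M] y(3) insert.prems[of M] by auto
  qed
qed

lemma finite_subgroups: "finite {H. subgroup H G}"
  by (rule finite_subset[of _ "Pow (carrier G)"]) (auto dest: subgroup.subset simp: finite_carrier)

text \<open>An integral element supported on the class of \<open>H\<close>, divided by its mark at
  \<open>H\<close>, has the required marks, because marks are constant on conjugacy classes.
  Uniqueness, which gives \<open>THE\<close> its meaning, is separation by rational marks.\<close>

lemma class_idem_spec:
  assumes H: "subgroup H G"
  shows "class_idem G (conj_class G H) \<in> carrier (rat_burnside_ring G)"
    and "subgroup K G \<Longrightarrow>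
      rat_burnside_mark K (class_idem G (conj_class G H)) = (if K \<in> conj_class G H then 1 else 0)"
proof -
  let ?C = "conj_class G H"
  let ?P = "\<lambda>x. x \<in> carrier (rat_burnside_ring G) \<and>
    (\<forall>K. subgroup K G \<longrightarrow> rat_burnside_mark K x = (if K \<in> ?C then 1 else 0))"
  have fin: "finite {L. subgroup L G \<and> L \<notin> ?C}"
    by (rule finite_subset[OF _ finite_subgroups]) blast
  obtain y where y: "y \<in> carrier (burnside_ring G)" "burnside_mark H y \<noteq> 0"
    "\<And>L. \<lbrakk>subgroup L G; L \<notin> ?C\<rbrakk> \<Longrightarrow> burnside_mark L y = 0"
    using mark_supported_on_class[OF H fin] by auto
  let ?x = "rat_frac (burnside_ring G) y (burnside_mark H y)"
  have x: "?P ?x"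
    using y by (auto simp: rat_frac_closed rat_mark_frac burnside_mark_conj_class[OF y(1) H])
  have "z = ?x" if "?P z" for z
    by (rule rat_burnside_eqI) (use x that in auto)
  then have "?P (THE x. ?P x)" by (rule theI[of ?P, OF x])
  then have *: "?P (class_idem G ?C)" unfolding class_idem_def .
  show "class_idem G ?C \<in> carrier (rat_burnside_ring G)" using * by blast
  show "subgroup K G \<Longrightarrow> rat_burnside_mark K (class_idem G ?C) = (if K \<in> ?C then 1 else 0)"
    using * by blast
qed

text \<open>A subgroup \<open>K\<close> belongs to exactly one class, so at most one summand has a
  nonzero mark at \<open>K\<close>.\<close>

lemma set_idem_spec:
  assumes S: "S \<subseteq> conj_class G ` {H. subgroup H G}"
  shows "set_idem G S \<in> carrier (rat_burnside_ring G)"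
    and "subgroup K G \<Longrightarrow> rat_burnside_mark K (set_idem G S) = (if conj_class G K \<in> S then 1 else 0)"
proof -
  have fin: "finite S" using finite_subset[OF S] finite_subgroups by simp
  have mem: "class_idem G C \<in> carrier (rat_burnside_ring G)" if "C \<in> S" for C
    using that S class_idem_spec(1) by blast
  show "set_idem G S \<in> carrier (rat_burnside_ring G)"
    unfolding set_idem_def using mem by (intro qb.finsum_closed) auto
  assume K: "subgroup K G"
  have mark: "rat_burnside_mark K (class_idem G C) = (if C = conj_class G K then 1 else 0)" if C: "C \<in> S" for C
  proof -
    obtain H where H: "subgroup H G" "C = conj_class G H" using C S by blast
    then show ?thesis
      using class_idem_spec(2)[OF H(1) K]
        conj_class_eq_iff[OF subgroup.subset[OF H(1)] subgroup.subset[OF K]] by auto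
  qed
  have "rat_burnside_mark K (set_idem G S) = (\<Sum>C\<in>S. rat_burnside_mark K (class_idem G C))"
    using qb.emb_finsum[OF fin mem, where k = K] by (simp add: set_idem_def sub_index_eq[OF K])
  also have "\<dots> = (\<Sum>C\<in>S. if C = conj_class G K then 1 else 0)"
    using mark by (intro sum.cong) auto
  also have "\<dots> = (if conj_class G K \<in> S then 1 else 0)" using fin by simp
  finally show "rat_burnside_mark K (set_idem G S) = (if conj_class G K \<in> S then 1 else 0)" .
qed

end


section \<open>Subgroups that are cyclic modulo their core\<close>

context group
begin

lemma generate_insert_normal:
  assumes "N \<lhd> G" "g \<in> carrier G"
  shows "subgroup (generate G (insert g N)) G" "insert g N \<subseteq> generate G (insert g N)"
    and "subgroup H G \<Longrightarrow> generate G (insert g N) \<subseteq> H \<longleftrightarrow> N \<subseteq> H \<and> g \<in> H"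
proof -
  have sub: "insert g N \<subseteq> carrier G"
    using assms by (auto simp: normal_def dest: subgroup.subset)
  then show "subgroup (generate G (insert g N)) G" by (rule generate_is_subgroup)
  show incl: "insert g N \<subseteq> generate G (insert g N)" by (auto intro: generate.incl)
  show "generate G (insert g N) \<subseteq> H \<longleftrightarrow> N \<subseteq> H \<and> g \<in> H" if "subgroup H G"
    using incl generate_subgroup_incl[OF _ that, of "insert g N"] by blast
qed

text \<open>From left to right, \<open>N\<close> is the core and \<open>g\<close> a lift of a
  generator of the quotient. From right to left, the normal subgroup \<open>N\<close> of
  \<open>G\<close> inside \<open>K\<close> lies in the core and dies in the quotient, which is then
  generated by the image of \<open>g\<close>.\<close>

lemma cyclic_mod_core_iff:
  assumes K: "subgroup K G"
  shows "cyclic_group ((G\<lparr>carrier := K\<rparr>) Mod (normal_core G K)) \<longleftrightarrow>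
    (\<exists>N g. N \<lhd> G \<and> g \<in> carrier G \<and> K = generate G (insert g N))"
proof -
  let ?C = "normal_core G K" and ?K = "G\<lparr>carrier := K\<rparr>"
  let ?Q = "?K Mod ?C" and ?h = "\<lambda>k. ?C #> k"
  have sub: "K \<subseteq> carrier G" using K by (rule subgroup.subset)
  have C: "?C \<lhd> G" "?C \<subseteq> K" using normal_normal_core[OF K] normal_core_subset[OF sub] .
  have CK: "?C \<lhd> ?K" by (rule normal_restrict_supergroup[OF K C])
  interpret CK: normal ?C ?K by (rule CK)
  interpret Q: group ?Q by (rule CK.factorgroup_is_group)
  have rc: "?C #>\<^bsub>?K\<^esub> k = ?h k" for k by (simp add: r_coset_def)
  interpret h: group_hom ?K ?Q ?h
    using CK.r_coset_hom_Mod unfolding rc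
    by (simp add: group_hom_def group_hom_axioms_def CK.is_group Q.is_group)
  have img: "carrier ?Q = ?h ` K"
    by (auto simp: FactGroup_def RCOSETS_def rc)
  show ?thesis
  proof
    assume "cyclic_group ?Q"
    then obtain x where x: "x \<in> carrier ?Q" "carrier ?Q = range (\<lambda>n::int. x [^]\<^bsub>?Q\<^esub> n)"
      using Q.cyclic_group by blast
    then obtain g where g: "g \<in> K" "x = ?h g" using img by blast
    let ?L = "generate G (insert g ?C)"
    have gG: "g \<in> carrier G" using g(1) sub by blast
    note L = generate_insert_normal[OF C(1) gG]
    have "k \<in> ?L" if k: "k \<in> K" for k
    proof -
      have "?h k \<in> range (\<lambda>n::int. x [^]\<^bsub>?Q\<^esub> n)" using k img x(2) by blast
      then obtain n :: int where "?h k = x [^]\<^bsub>?Q\<^esub> n" by blast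
      also have "\<dots> = ?h (g [^]\<^bsub>?K\<^esub> n)" using h.hom_int_pow[of g n] g by simp
      also have "g [^]\<^bsub>?K\<^esub> n = g [^] n" using int_pow_consistent[OF K g(1)] by simp
      finally have "?h k = ?h (g [^] n)" .
      moreover have "k \<in> ?h k"
        using rcos_self[of k ?C] k sub C(1) by (auto simp: normal_def)
      ultimately obtain c where "c \<in> ?C" "k = c \<otimes> g [^] n" by (auto simp: r_coset_def)
      then show ?thesis
        using L(2) subgroup_int_pow_closed[OF L(1), of g n] subgroup.m_closed[OF L(1)] by auto
    qed
    moreover have "?L \<subseteq> K" using L(3)[OF K] C(2) g(1) by blast
    ultimately have "K = ?L" by blast
    then show "\<exists>N g. N \<lhd> G \<and> g \<in> carrier G \<and> K = generate G (insert g N)"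
      using C(1) gG by blast
  next
    assume "\<exists>N g. N \<lhd> G \<and> g \<in> carrier G \<and> K = generate G (insert g N)"
    then obtain N g where N: "N \<lhd> G" "g \<in> carrier G" and Kgen: "K = generate G (insert g N)" by blast
    note L = generate_insert_normal[OF N, folded Kgen]
    have NC: "N \<subseteq> ?C" using normal_subset_core_iff[OF N(1) sub] L(2) by blast
    have g: "g \<in> K" using L(2) by blast
    have Q1: "\<one>\<^bsub>?Q\<^esub> = ?C" by (simp add: FactGroup_def)
    have "?h ` insert g N \<subseteq> {?h g, \<one>\<^bsub>?Q\<^esub>}"
      using NC CK.rcos_const[unfolded rc] by (auto simp: Q1)
    moreover have "{?h g, \<one>\<^bsub>?Q\<^esub>} \<subseteq> generate ?Q {?h g}"
      using generate.one[of ?Q "{?h g}"] generate.incl[of "?h g" "{?h g}" ?Q] by simp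
    ultimately have hsub: "?h ` insert g N \<subseteq> generate ?Q {?h g}" by blast
    have hg: "?h g \<in> carrier ?Q" using g img by blast
    have "?h ` K = ?h ` generate ?K (insert g N)"
      using generate_consistent[OF L(2) K] Kgen by simp
    also have "\<dots> = generate ?Q (?h ` insert g N)"
      using h.generate_img[of "insert g N"] L(2) by simp
    also have "\<dots> \<subseteq> generate ?Q {?h g}"
      using Q.generate_subgroup_incl[OF hsub Q.generate_is_subgroup] hg by blast
    also have "\<dots> = range (\<lambda>n::int. ?h g [^]\<^bsub>?Q\<^esub> n)"
      unfolding Q.generate_pow[OF hg] by auto
    finally have "carrier ?Q \<subseteq> range (\<lambda>n::int. ?h g [^]\<^bsub>?Q\<^esub> n)" using img by simp
    moreover have "range (\<lambda>n::int. ?h g [^]\<^bsub>?Q\<^esub> n) \<subseteq> carrier ?Q" using hg by auto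
    ultimately show "cyclic_group ?Q" using Q.cyclic_group hg by blast
  qed
qed

text \<open>Conjugation by \<open>x\<close> fixes \<open>N\<close> and carries the subgroup
  generated by \<open>N\<close> and \<open>g\<close> to the one generated by \<open>N\<close> and
  the conjugate of \<open>g\<close>. Cyclicity modulo the core is thus a property of the conjugacy
  class.\<close>

lemma cyclic_mod_core_conjg:
  assumes K: "subgroup K G" and x: "x \<in> carrier G"
    and "cyclic_group ((G\<lparr>carrier := K\<rparr>) Mod (normal_core G K))"
  shows "cyclic_group ((G\<lparr>carrier := conjg x K\<rparr>) Mod (normal_core G (conjg x K)))"
proof -
  obtain N g where N: "N \<lhd> G" "g \<in> carrier G" and Kgen: "K = generate G (insert g N)"
    using assms cyclic_mod_core_iff[OF K] by blast
  let ?c = "\<lambda>y. x \<otimes> y \<otimes> inv x"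
  interpret c: group_hom G G ?c
  proof (unfold_locales, rule homI)
    fix y z assume yz: "y \<in> carrier G" "z \<in> carrier G"
    have "inv x \<otimes> (x \<otimes> (z \<otimes> inv x)) = z \<otimes> inv x" using x yz by (simp flip: m_assoc)
    then show "?c (y \<otimes> z) = ?c y \<otimes> ?c z" using x yz by (simp add: m_assoc)
  qed (use x in simp)
  have NG: "insert g N \<subseteq> carrier G" using N by (auto simp: normal_def dest: subgroup.subset)
  have "conjg x K = generate G (?c ` insert g N)"
    unfolding conjg_image Kgen using c.generate_img[OF NG] by simp
  also have "?c ` insert g N = insert (?c g) N"
    using normal_conjg[OF N(1) x] by (simp add: conjg_image)
  finally show ?thesis
    using cyclic_mod_core_iff[OF subgroup_conjg[OF x K]] N x by (metis inv_closed m_closed)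
qed

end


section \<open>The core map\<close>

text \<open>A triangular system: at a maximal \<open>N\<close> with \<open>D N \<noteq> 0\<close>
  only the diagonal term \<open>c N * D N\<close> survives. The coefficients are kept general
  because both \<open>1 / card M\<close>, from the core map, and 1, from Burnside's lemma,
  occur.\<close>

lemma upper_sums_zero_imp_zero:
  fixes c D :: "'p::order \<Rightarrow> 'c::linordered_idom"
  assumes "finite F" and c: "\<And>M. M \<in> F \<Longrightarrow> c M \<noteq> 0"
    and sums: "\<And>N. N \<in> F \<Longrightarrow> (\<Sum>M\<in>F. (if N \<le> M then c M else 0) * D M) = 0"
    and "M \<in> F"
  shows "D M = 0"
proof (rule ccontr)
  assume "D M \<noteq> 0"
  then have "{M \<in> F. D M \<noteq> 0} \<noteq> {}" using assms(4) by blast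
  moreover have "finite {M \<in> F. D M \<noteq> 0}" using assms(1) by simp
  ultimately obtain N where N: "N \<in> {M \<in> F. D M \<noteq> 0}"
    and max: "\<And>L. \<lbrakk>L \<in> {M \<in> F. D M \<noteq> 0}; N \<le> L\<rbrakk> \<Longrightarrow> L = N"
    using finite_has_maximal by (metis (no_types, lifting))
  have "(\<Sum>M\<in>F. (if N \<le> M then c M else 0) * D M) = (\<Sum>M\<in>F. if M = N then c N * D N else 0)"
    using max by (intro sum.cong) auto
  then show False using sums[of N] N c assms(1) by simp
qed

context finite_group
begin

text \<open>Rational values allow quotients of group orders to be written as fractions.\<close>

definition burnside_weight :: "('a set \<Rightarrow> rat) \<Rightarrow> 'a burnside \<Rightarrow> rat" where
  "burnside_weight w = groth_ext (gset_weight w)"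

lemma burnside_weight_diff:
  "\<lbrakk>a \<in> carrier (gset_semiring G); b \<in> carrier (gset_semiring G)\<rbrakk> \<Longrightarrow>
    burnside_weight w (groth_diff (gset_semiring G) a b) = gset_weight w a - gset_weight w b"
  unfolding burnside_weight_def by (rule gs.groth_ext_diff) (simp_all add: gset_weight_add)

lemma burnside_weight_add:
  "\<lbrakk>P \<in> carrier (burnside_ring G); Q \<in> carrier (burnside_ring G)\<rbrakk> \<Longrightarrow>
    burnside_weight w (P \<oplus>\<^bsub>burnside_ring G\<^esub> Q) = burnside_weight w P + burnside_weight w Q"
  unfolding burnside_weight_def burnside_ring_def
  by (rule gs.groth_ext_add) (simp_all add: gset_weight_add)

lemma burnside_weight_minus:
  assumes "P \<in> carrier (burnside_ring G)" "Q \<in> carrier (burnside_ring G)"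
  shows "burnside_weight w (P \<ominus>\<^bsub>burnside_ring G\<^esub> Q) = burnside_weight w P - burnside_weight w Q"
proof -
  have "P \<ominus>\<^bsub>burnside_ring G\<^esub> Q \<oplus>\<^bsub>burnside_ring G\<^esub> Q = P"
    using assms by (simp add: br.minus_eq br.a_assoc br.l_neg)
  then show ?thesis
    using burnside_weight_add[OF br.minus_closed[OF assms] assms(2), of w] by simp
qed

lemma burnside_weight_coset:
  assumes "subgroup H G" and "\<And>g. g \<in> carrier G \<Longrightarrow> w (conjg g H) = w H"
  shows "burnside_weight w (coset_elt G H) = of_nat (card (lcosets H)) * w H"
  unfolding coset_elt_diff
    burnside_weight_diff[OF coset_gset_class_closed[OF assms(1)] gset_zero_closed]
  by (simp only: gset_weight_coset[where w = w, OF assms] gset_weight_zero diff_zero)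

lemma burnside_one: "\<one>\<^bsub>burnside_ring G\<^esub> = coset_elt G (carrier G)"
  by (simp add: burnside_ring_def gs.groth_one coset_elt_diff gset_one)

lemma burnside_weight_one: "burnside_weight w \<one>\<^bsub>burnside_ring G\<^esub> = w (carrier G)"
  unfolding burnside_one
  using burnside_weight_coset[OF subgroup_self, of w] by (simp add: conjg_carrier lcosets_carrier_self)

lemma gset_weight_linear:
  fixes w :: "'a set \<Rightarrow> rat"
  assumes "a \<in> carrier (gset_semiring G)"
    and w: "\<And>H. subgroup H G \<Longrightarrow> w H = (\<Sum>i\<in>I. c i * v i H)"
  shows "gset_weight w a = (\<Sum>i\<in>I. c i * gset_weight (v i) a)"
proof -
  obtain E :: "nat set" and \<alpha> where E: "finite E" "acts G E \<alpha>" "a = gset_class G E \<alpha>"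
    using gset_cases[OF assms(1)] .
  have "gset_weight w a = (\<Sum>x\<in>E. \<Sum>i\<in>I. c i * v i (stabilizer G \<alpha> x))"
    unfolding E(3) gset_weight_class[OF E(1,2)]
    by (intro sum.cong refl w subgroup_stabilizer[OF E(2)])
  also have "\<dots> = (\<Sum>i\<in>I. \<Sum>x\<in>E. c i * v i (stabilizer G \<alpha> x))" by (rule sum.swap)
  finally show ?thesis
    unfolding E(3) gset_weight_class[OF E(1,2)] by (simp add: sum_distrib_left)
qed

text \<open>A weight sees \<open>w\<close> only at stabilizers, so a linear relation checked on
  subgroups carries over to all virtual \<open>G\<close>-sets. Expanding one weight in two ways is
  how orbit counts are later compared with marks.\<close>

lemma burnside_weight_linear:
  assumes "P \<in> carrier (burnside_ring G)"
    and w: "\<And>H. subgroup H G \<Longrightarrow> w H = (\<Sum>i\<in>I. c i * v i H)"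
  shows "burnside_weight w P = (\<Sum>i\<in>I. c i * burnside_weight (v i) P)"
proof -
  obtain a b where ab: "a \<in> carrier (gset_semiring G)" "b \<in> carrier (gset_semiring G)"
    "P = groth_diff (gset_semiring G) a b"
    using burnside_cases[OF assms(1)] .
  have "gset_weight w a = (\<Sum>i\<in>I. c i * gset_weight (v i) a)"
    "gset_weight w b = (\<Sum>i\<in>I. c i * gset_weight (v i) b)"
    using gset_weight_linear[OF ab(1), of w] gset_weight_linear[OF ab(2), of w] w by blast+
  then show ?thesis
    by (simp add: ab(3) burnside_weight_diff[OF ab(1,2)] right_diff_distrib sum_subtractf)
qed

lemma burnside_mark_weight:
  assumes "P \<in> carrier (burnside_ring G)" "subgroup K G"
  shows "of_int (burnside_mark K P) = burnside_weight (\<lambda>H. if K \<subseteq> H then 1 else 0) P"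
proof -
  have *: "of_nat (gset_mark K a) = gset_weight (\<lambda>H. if K \<subseteq> H then 1 else (0::rat)) a"
    if a: "a \<in> carrier (gset_semiring G)" for a
  proof -
    obtain E :: "nat set" and \<alpha> where E: "finite E" "acts G E \<alpha>" "a = gset_class G E \<alpha>"
      using gset_cases[OF a] .
    then show ?thesis
      using gset_mark_class[OF E(1,2) subgroup.subset[OF assms(2)]]
      by (simp add: gset_weight_class sum.If_cases Int_def)
  qed
  obtain a b where ab: "a \<in> carrier (gset_semiring G)" "b \<in> carrier (gset_semiring G)"
    "P = groth_diff (gset_semiring G) a b"
    using burnside_cases[OF assms(1)] .
  show ?thesis
    unfolding ab(3) burnside_weight_diff[OF ab(1,2)] burnside_mark_diff[OF ab(1,2) assms(2)]
    by (simp add: * ab(1,2))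
qed

text \<open>Summed over the \<open>|G : H|\<close> points of \<open>G/H\<close>, this weight gives the mark of \<open>G/core(H)\<close> at \<open>K\<close>.\<close>

definition core_weight :: "'a set \<Rightarrow> 'a set \<Rightarrow> rat" where
  "core_weight K H =
     (if K \<subseteq> normal_core G H then of_nat (card H) / of_nat (card (normal_core G H)) else 0)"

lemma card_pos: "subgroup H G \<Longrightarrow> card H > 0"
  using finite_subset[OF subgroup.subset finite_carrier] subgroup.one_closed
  by (fastforce simp: card_gt_0_iff)

lemma subgroup_normal_core: "subgroup H G \<Longrightarrow> subgroup (normal_core G H) G"
  using normal_normal_core by (simp add: normal_def)

lemma core_weight_conjg:
  "\<lbrakk>subgroup H G; g \<in> carrier G\<rbrakk> \<Longrightarrow> core_weight K (conjg g H) = core_weight K H"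
  by (simp add: core_weight_def normal_core_conjg card_conjg subgroup.subset)

text \<open>The core \<open>C\<close> of \<open>H\<close> is normal, so \<open>K\<close> fixes
  either all \<open>|G : C|\<close> points of \<open>G/C\<close> or none. By Lagrange
  \<open>|G : C| = |G : H| * |H| / |C|\<close>, which spreads this mark evenly over the points of
  \<open>G/H\<close>.\<close>

lemma burnside_mark_coset_core:
  assumes "subgroup H G" "subgroup K G"
  shows "of_int (burnside_mark K (coset_elt G (normal_core G H))) =
    burnside_weight (core_weight K) (coset_elt G H)"
proof -
  let ?C = "normal_core G H"
  have C: "subgroup ?C G" "?C \<lhd> G"
    using assms(1) by (simp_all add: subgroup_normal_core normal_normal_core)
  have lagrange: "of_nat (card (lcosets M)) * of_nat (card M) = (of_nat (order G) :: rat)"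
    if "subgroup M G" for M
    using l_lagrange[OF finite_carrier that] by (metis of_nat_mult)
  have "of_int (burnside_mark K (coset_elt G ?C)) =
      of_nat (card (lcosets ?C)) * (if K \<subseteq> ?C then 1 else (0::rat))"
    unfolding burnside_mark_weight[OF coset_elt_closed[OF C(1)] assms(2)]
    by (rule burnside_weight_coset[OF C(1)]) (simp add: normal_conjg[OF C(2)])
  also have "\<dots> = of_nat (card (lcosets H)) * core_weight K H"
    using lagrange[OF assms(1)] lagrange[OF C(1)] card_pos[OF C(1)]
    by (simp add: core_weight_def field_simps)
  also have "\<dots> = burnside_weight (core_weight K) (coset_elt G H)"
    using burnside_weight_coset[OF assms(1), of "core_weight K"] core_weight_conjg[OF assms(1)] by simp
  finally show ?thesis .
qed

section \<open>Existence and uniqueness of the core map\<close>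

definition gset_elt :: "'a gset set \<Rightarrow> 'a burnside" where
  "gset_elt a = groth_diff (gset_semiring G) a \<zero>\<^bsub>gset_semiring G\<^esub>"

lemma gset_elt_closed: "a \<in> carrier (gset_semiring G) \<Longrightarrow> gset_elt a \<in> carrier (burnside_ring G)"
  by (simp add: gset_elt_def groth_diff_closed gset_zero_closed)

lemma gset_elt_coset: "gset_elt (coset_gset_class G H) = coset_elt G H"
  by (simp add: gset_elt_def coset_elt_diff)

lemma gset_elt_zero: "gset_elt \<zero>\<^bsub>gset_semiring G\<^esub> = \<zero>\<^bsub>burnside_ring G\<^esub>"
  by (simp add: gset_elt_def burnside_ring_def gs.groth_zero)

lemma gset_elt_add:
  assumes "a \<in> carrier (gset_semiring G)" "b \<in> carrier (gset_semiring G)"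
  shows "gset_elt (a \<oplus>\<^bsub>gset_semiring G\<^esub> b) = gset_elt a \<oplus>\<^bsub>burnside_ring G\<^esub> gset_elt b"
proof -
  have "\<zero>\<^bsub>gset_semiring G\<^esub> \<oplus>\<^bsub>gset_semiring G\<^esub> \<zero>\<^bsub>gset_semiring G\<^esub> = \<zero>\<^bsub>gset_semiring G\<^esub>"
    by (rule gs.semi_inj) (simp_all add: gset_add_closed gset_zero_closed gs.semi_add gs.semi_zero)
  then show ?thesis
    using gs.groth_add_diff[OF assms(1) gset_zero_closed assms(2) gset_zero_closed]
    by (simp add: gset_elt_def burnside_ring_def)
qed

text \<open>Moving the negative part to the other side reduces additive statements about
  \<open>P\<close> to actual \<open>G\<close>-sets, where \<open>gset_induct\<close>
  applies.\<close>

lemma gset_elt_cases: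
  assumes "P \<in> carrier (burnside_ring G)"
  obtains a b where "a \<in> carrier (gset_semiring G)" "b \<in> carrier (gset_semiring G)"
    "P \<oplus>\<^bsub>burnside_ring G\<^esub> gset_elt b = gset_elt a"
proof -
  obtain a b where ab: "a \<in> carrier (gset_semiring G)" "b \<in> carrier (gset_semiring G)"
    "P = groth_diff (gset_semiring G) a b"
    using burnside_cases[OF assms] .
  have "P \<oplus>\<^bsub>burnside_ring G\<^esub> gset_elt b = gset_elt a"
  proof (rule burnside_eqI)
    fix K assume K: "subgroup K G"
    show "burnside_mark K (P \<oplus>\<^bsub>burnside_ring G\<^esub> gset_elt b) = burnside_mark K (gset_elt a)"
      using burnside_mark_ops(1)[OF K assms gset_elt_closed[OF ab(2)]] ab(1,2)
      by (simp add: ab(3) gset_elt_def burnside_mark_diff[OF _ _ K] gset_zero_closed)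
  qed (use assms ab(1,2) in \<open>simp_all add: gset_elt_closed\<close>)
  then show ?thesis using that ab(1,2) by blast
qed

abbreviation core_map_spec :: "('a burnside \<Rightarrow> 'a burnside) \<Rightarrow> bool" where
  "core_map_spec f \<equiv> f \<in> extensional (carrier (burnside_ring G)) \<and>
     f \<in> hom (add_monoid (burnside_ring G)) (add_monoid (burnside_ring G)) \<and>
     (\<forall>H. subgroup H G \<longrightarrow> f (coset_elt G H) = coset_elt G (normal_core G H))"

text \<open>Both sides are additive in \<open>P\<close> and agree on the transitive
  \<open>G\<close>-sets that generate. This is the uniqueness half, and afterwards the working
  description of the core map.\<close>

lemma core_map_spec_mark:
  assumes f: "core_map_spec f" and P: "P \<in> carrier (burnside_ring G)" and K: "subgroup K G"
  shows "of_int (burnside_mark K (f P)) = burnside_weight (core_weight K) P"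
proof -
  let ?B = "burnside_ring G"
  have closed: "f x \<in> carrier ?B" if "x \<in> carrier ?B" for x
    using f that by (auto simp: hom_def)
  have add: "f (x \<oplus>\<^bsub>?B\<^esub> y) = f x \<oplus>\<^bsub>?B\<^esub> f y" if "x \<in> carrier ?B" "y \<in> carrier ?B" for x y
    using f that by (auto simp: hom_def)
  let ?m = "\<lambda>x. of_int (burnside_mark K (f x)) :: rat"
  let ?w = "burnside_weight (core_weight K)"
  have m_add: "?m (x \<oplus>\<^bsub>?B\<^esub> y) = ?m x + ?m y" if "x \<in> carrier ?B" "y \<in> carrier ?B" for x y
    using burnside_mark_ops(1)[OF K closed[OF that(1)] closed[OF that(2)]] by (simp add: add that)
  have elt: "?m (gset_elt a) = ?w (gset_elt a)" if "a \<in> carrier (gset_semiring G)" for a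
    using that
  proof (induction rule: gset_induct)
    case zero
    show ?case
      \<comment> \<open>Additivity applied to \<open>\<zero> \<oplus> \<zero>\<close> makes both
        values at zero vanish.\<close>
      using m_add[OF br.zero_closed br.zero_closed]
        burnside_weight_add[OF br.zero_closed br.zero_closed, of "core_weight K"]
      by (simp add: gset_elt_zero)
  next
    case (add H a)
    have "?m (coset_elt G H) = ?w (coset_elt G H)"
      using f add.hyps(1) burnside_mark_coset_core[OF add.hyps(1) K] by simp
    then show ?case
      using add m_add[OF coset_elt_closed gset_elt_closed]
        burnside_weight_add[OF coset_elt_closed gset_elt_closed]
      by (simp add: gset_elt_add coset_gset_class_closed gset_elt_coset)
  qed
  obtain a b where ab: "a \<in> carrier (gset_semiring G)" "b \<in> carrier (gset_semiring G)"
    "P \<oplus>\<^bsub>?B\<^esub> gset_elt b = gset_elt a"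
    using gset_elt_cases[OF P] .
  have "?m P + ?m (gset_elt b) = ?m (gset_elt a)"
    using m_add[OF P gset_elt_closed[OF ab(2)]] by (simp add: ab(3))
  moreover have "?w P + ?w (gset_elt b) = ?w (gset_elt a)"
    using burnside_weight_add[OF P gset_elt_closed[OF ab(2)], of "core_weight K"] by (simp add: ab(3))
  ultimately show ?thesis using elt ab(1,2) by simp
qed

text \<open>The image is assembled orbit by orbit, with \<open>G/H\<close> replaced by
  \<open>G/core(H)\<close>. Stating the result through marks makes it independent of the chosen
  decomposition, since marks determine the element.\<close>

lemma core_image_exists:
  assumes P: "P \<in> carrier (burnside_ring G)"
  shows "\<exists>y\<in>carrier (burnside_ring G). \<forall>K. subgroup K G \<longrightarrow>
    of_int (burnside_mark K y) = burnside_weight (core_weight K) P"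
proof -
  let ?B = "burnside_ring G"
  let ?ex = "\<lambda>P. \<exists>y\<in>carrier ?B. \<forall>K. subgroup K G \<longrightarrow>
    of_int (burnside_mark K y) = burnside_weight (core_weight K) P"
  have elt: "?ex (gset_elt a)" if "a \<in> carrier (gset_semiring G)" for a
    using that
  proof (induction rule: gset_induct)
    case zero
    have "burnside_weight w \<zero>\<^bsub>?B\<^esub> = 0" for w
      using burnside_weight_add[OF br.zero_closed br.zero_closed, of w] by simp
    then show ?case
      using burnside_mark_ops(6)[OF _ br.zero_closed br.zero_closed]
      by (intro bexI[of _ "\<zero>\<^bsub>?B\<^esub>"]) (simp_all add: gset_elt_zero)
  next
    case (add H a)
    then obtain y where y: "y \<in> carrier ?B"
      "\<And>K. subgroup K G \<Longrightarrow> of_int (burnside_mark K y) = burnside_weight (core_weight K) (gset_elt a)"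
      by blast
    let ?c = "coset_elt G (normal_core G H)"
    have c: "?c \<in> carrier ?B" by (intro coset_elt_closed subgroup_normal_core add.hyps(1))
    have "of_int (burnside_mark K (?c \<oplus>\<^bsub>?B\<^esub> y)) =
        burnside_weight (core_weight K) (gset_elt (coset_gset_class G H \<oplus>\<^bsub>gset_semiring G\<^esub> a))"
      if K: "subgroup K G" for K
      using burnside_mark_ops(1)[OF K c y(1)] burnside_mark_coset_core[OF add.hyps(1) K] y(2)[OF K]
        burnside_weight_add[OF coset_elt_closed gset_elt_closed] add.hyps
      by (simp add: gset_elt_add coset_gset_class_closed gset_elt_coset)
    then show ?case using c y(1) by (intro bexI[of _ "?c \<oplus>\<^bsub>?B\<^esub> y"]) simp_all
  qed
  obtain a b where ab: "a \<in> carrier (gset_semiring G)" "b \<in> carrier (gset_semiring G)"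
    "P \<oplus>\<^bsub>?B\<^esub> gset_elt b = gset_elt a"
    using gset_elt_cases[OF P] .
  obtain y where y: "y \<in> carrier ?B"
    "\<And>K. subgroup K G \<Longrightarrow> of_int (burnside_mark K y) = burnside_weight (core_weight K) (gset_elt a)"
    using elt[OF ab(1)] by blast
  obtain z where z: "z \<in> carrier ?B"
    "\<And>K. subgroup K G \<Longrightarrow> of_int (burnside_mark K z) = burnside_weight (core_weight K) (gset_elt b)"
    using elt[OF ab(2)] by blast
  have "of_int (burnside_mark K (y \<ominus>\<^bsub>?B\<^esub> z)) = burnside_weight (core_weight K) P" if K: "subgroup K G" for K
    using burnside_mark_ops(2)[OF K y(1) z(1)] y(2)[OF K] z(2)[OF K]
      burnside_weight_add[OF P gset_elt_closed[OF ab(2)], of "core_weight K"] by (simp add: ab(3))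
  then show ?thesis using y(1) z(1) by (intro bexI[of _ "y \<ominus>\<^bsub>?B\<^esub> z"]) simp_all
qed

text \<open>The function \<open>f\<close> is chosen pointwise by prescribed marks. These are
  additive in \<open>P\<close>, so the sum of two images has the marks prescribed for the sum and
  must equal its image; the values on cosets follow in the same way.\<close>

lemma core_map_spec_core_map: "core_map_spec (core_map G)"
proof -
  let ?B = "burnside_ring G"
  let ?Q = "\<lambda>P y. y \<in> carrier ?B \<and> (\<forall>K. subgroup K G \<longrightarrow>
    of_int (burnside_mark K y) = burnside_weight (core_weight K) P)"
  define f where "f = (\<lambda>P\<in>carrier ?B. SOME y. ?Q P y)"
  have f: "?Q P (f P)" if "P \<in> carrier ?B" for P
  proof -
    have "\<exists>y. ?Q P y" using core_image_exists[OF that] by blast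
    then have "?Q P (SOME y. ?Q P y)" by (rule someI_ex)
    then show ?thesis unfolding f_def using that by simp
  qed
  have uniq: "f P = y" if "P \<in> carrier ?B" "?Q P y" for P y
  proof (rule burnside_eqI)
    fix K assume "subgroup K G"
    then have "of_int (burnside_mark K (f P)) = (of_int (burnside_mark K y) :: rat)"
      using f[OF that(1)] that(2) by simp
    then show "burnside_mark K (f P) = burnside_mark K y" by simp
  qed (use f that in auto)
  have "core_map_spec f"
  proof (intro conjI allI impI)
    show "f \<in> extensional (carrier ?B)" by (simp add: f_def)
    have "f (x \<oplus>\<^bsub>?B\<^esub> y) = f x \<oplus>\<^bsub>?B\<^esub> f y" if x: "x \<in> carrier ?B" and y: "y \<in> carrier ?B" for x y
    proof (rule uniq)
      show "?Q (x \<oplus>\<^bsub>?B\<^esub> y) (f x \<oplus>\<^bsub>?B\<^esub> f y)"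
        using f[OF x] f[OF y] burnside_mark_ops(1)[of _ "f x" "f y"] burnside_weight_add[OF x y] by simp
    qed (use x y in simp)
    then show "f \<in> hom (add_monoid ?B) (add_monoid ?B)"
      using f by (simp add: hom_def)
    fix H assume H: "subgroup H G"
    show "f (coset_elt G H) = coset_elt G (normal_core G H)"
      using H by (intro uniq) (simp_all add: coset_elt_closed subgroup_normal_core burnside_mark_coset_core)
  qed
  moreover have "h = f" if h: "core_map_spec h" for h
  proof (rule extensionalityI)
    show "h \<in> extensional (carrier ?B)" "f \<in> extensional (carrier ?B)"
      using h by (simp_all add: f_def)
    fix P assume P: "P \<in> carrier ?B"
    have "h P \<in> carrier ?B" using h P by (auto simp: hom_def)
    then show "h P = f P" using uniq[OF P, of "h P"] core_map_spec_mark[OF h P] by simp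
  qed
  ultimately show ?thesis unfolding core_map_def by (rule theI)
qed

lemma core_map_closed: "P \<in> carrier (burnside_ring G) \<Longrightarrow> core_map G P \<in> carrier (burnside_ring G)"
  using core_map_spec_core_map by (auto simp: hom_def)

lemmas burnside_mark_core_map = core_map_spec_mark[OF core_map_spec_core_map]


section \<open>Units in the kernel of the core map\<close>

lemma finite_normal: "finite {N. N \<lhd> G}"
  by (rule finite_subset[OF _ finite_subgroups]) (auto simp: normal_def)

text \<open>The weight behind \<open>D(M)\<close>: over \<open>G/H\<close> it sums to
  \<open>|G|\<close> if \<open>H\<close> has core \<open>M\<close>, and to 0 otherwise.\<close>

abbreviation core_size :: "'a set \<Rightarrow> 'a set \<Rightarrow> rat" where
  "core_size M H \<equiv> (if normal_core G H = M then of_nat (card H) else 0)"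

text \<open>Stabilizers are grouped by their core: for each \<open>H\<close> only the term
  \<open>M = core(H)\<close> survives. For normal \<open>K\<close> the result is one equation of a
  triangular system.\<close>

lemma core_weight_expand:
  assumes "P \<in> carrier (burnside_ring G)"
  shows "burnside_weight (core_weight K) P =
    (\<Sum>M | M \<lhd> G. (if K \<subseteq> M then 1 / of_nat (card M) else 0) * burnside_weight (core_size M) P)"
proof (rule burnside_weight_linear[OF assms])
  fix H assume H: "subgroup H G"
  have "(\<Sum>M | M \<lhd> G. (if K \<subseteq> M then 1 / of_nat (card M) else 0) * core_size M H) =
      (\<Sum>M | M \<lhd> G. if M = normal_core G H then core_weight K H else 0)"
    by (intro sum.cong) (auto simp: core_weight_def)
  then show "core_weight K H =
      (\<Sum>M | M \<lhd> G. (if K \<subseteq> M then 1 / of_nat (card M) else 0) * core_size M H)"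
    using finite_normal normal_normal_core[OF H] by simp
qed

text \<open>Both sides are \<open>|G|\<close> times the number of orbits of the \<open>N\<close>-fixed points; the right-hand side
  counts these orbits by Burnside's lemma.\<close>

lemma core_size_sum_eq_mark_sum:
  assumes P: "P \<in> carrier (burnside_ring G)" and N: "N \<lhd> G"
  shows "(\<Sum>M | M \<lhd> G. (if N \<subseteq> M then 1 else 0) * burnside_weight (core_size M) P) =
    (\<Sum>g\<in>carrier G. of_int (burnside_mark (generate G (insert g N)) P))"
proof -
  let ?w = "\<lambda>H. if N \<subseteq> H then of_nat (card H) else (0::rat)"
  have "burnside_weight ?w P =
      (\<Sum>M | M \<lhd> G. (if N \<subseteq> M then 1 else 0) * burnside_weight (core_size M) P)"
  proof (rule burnside_weight_linear[OF P])
    fix H assume H: "subgroup H G"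
    \<comment> \<open>Only \<open>M = core(H)\<close> contributes, and \<open>N\<close> lies in this
      core iff it lies in \<open>H\<close>.\<close>
    have "(\<Sum>M | M \<lhd> G. (if N \<subseteq> M then 1 else 0) * core_size M H) =
        (\<Sum>M | M \<lhd> G. if M = normal_core G H then ?w H else 0)"
      using normal_subset_core_iff[OF N subgroup.subset[OF H]] by (intro sum.cong) auto
    then show "?w H = (\<Sum>M | M \<lhd> G. (if N \<subseteq> M then 1 else 0) * core_size M H)"
      using finite_normal normal_normal_core[OF H] by simp
  qed
  moreover have "burnside_weight ?w P = (\<Sum>g\<in>carrier G. 1 *
      burnside_weight (\<lambda>H. if generate G (insert g N) \<subseteq> H then 1 else 0) P)"
  proof (rule burnside_weight_linear[OF P])
    fix H assume H: "subgroup H G"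
    \<comment> \<open>If \<open>N \<subseteq> H\<close>, the generated subgroup lies in
      \<open>H\<close> exactly for \<open>g \<in> H\<close>, so the indicators add up to
      \<open>card H\<close>; otherwise all of them are 0.\<close>
    have "(\<Sum>g\<in>carrier G. 1 * (if generate G (insert g N) \<subseteq> H then 1 else (0::rat))) =
        (\<Sum>g\<in>carrier G. if g \<in> H then if N \<subseteq> H then 1 else 0 else 0)"
      using generate_insert_normal(3)[OF N _ H] by (intro sum.cong) auto
    also have "\<dots> = ?w H"
      using subgroup.subset[OF H] finite_carrier by (simp add: sum.If_cases Int_absorb1)
    finally show "?w H = (\<Sum>g\<in>carrier G. 1 * (if generate G (insert g N) \<subseteq> H then 1 else 0))" ..
  qed
  ultimately show ?thesis
    using burnside_mark_weight[OF P generate_insert_normal(1)[OF N]] by simp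
qed

lemma core_map_eq_one_iff:
  assumes u: "u \<in> carrier (burnside_ring G)"
    and le: "\<And>K. subgroup K G \<Longrightarrow> burnside_mark K u \<le> 1"
  shows "core_map G u = \<one>\<^bsub>burnside_ring G\<^esub> \<longleftrightarrow>
    (\<forall>K. subgroup K G \<longrightarrow> cyclic_group ((G\<lparr>carrier := K\<rparr>) Mod (normal_core G K)) \<longrightarrow>
      burnside_mark K u = 1)" (is "?L \<longleftrightarrow> ?R")
proof -
  let ?B = "burnside_ring G"
  define d where "d = u \<ominus>\<^bsub>?B\<^esub> \<one>\<^bsub>?B\<^esub>"
  have d: "d \<in> carrier ?B" using u by (simp add: d_def)
  define D where "D M = burnside_weight (core_size M) d" for M
  have mark_d: "burnside_mark K d = burnside_mark K u - 1" if "subgroup K G" for K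
    unfolding d_def using burnside_mark_ops(2,5)[OF that u br.one_closed] by simp
  \<comment> \<open>Hence \<open>core_weight K\<close> has the value 1 at \<open>G\<close>, and the
    weight of the ring unit is 1.\<close>
  have core: "normal_core G (carrier G) = carrier G"
    using normal_subset_core_iff[OF normal_self subset_refl] normal_core_subset[OF subset_refl] by blast
  have weight_d: "burnside_weight (core_weight K) d = of_int (burnside_mark K (core_map G u)) - 1"
    if K: "subgroup K G" for K
    unfolding d_def using burnside_weight_minus[OF u br.one_closed] burnside_mark_core_map[OF u K]
      card_pos[OF subgroup_self] subgroup.subset[OF K]
    by (simp add: burnside_weight_one core_weight_def core)
  have "?L \<longleftrightarrow> (\<forall>M. M \<lhd> G \<longrightarrow> D M = 0)"
  proof
    assume ?L
    \<comment> \<open>The marks of the core map at normal subgroups alone already give the full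
      triangular system for \<open>D\<close>.\<close>
    have "(\<Sum>M | M \<lhd> G. (if N \<subseteq> M then 1 / of_nat (card M) else 0) * D M) = 0" if "N \<lhd> G" for N
      using core_weight_expand[OF d, of N] weight_d[of N] that \<open>?L\<close>
        burnside_mark_ops(5)[OF _ u u, of N]
      by (simp add: D_def normal_def)
    then show "\<forall>M. M \<lhd> G \<longrightarrow> D M = 0"
      using upper_sums_zero_imp_zero[OF finite_normal, of "\<lambda>M. 1 / of_nat (card M)" D] card_pos
      by (auto simp: normal_def)
  next
    assume D0: "\<forall>M. M \<lhd> G \<longrightarrow> D M = 0"
    show ?L
    proof (rule burnside_eqI)
      fix K assume K: "subgroup K G"
      have "burnside_weight (core_weight K) d = 0"
        using D0 core_weight_expand[OF d, of K] by (simp add: D_def)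
      then have "burnside_mark K (core_map G u) = 1"
        using weight_d[OF K] by simp
      then show "burnside_mark K (core_map G u) = burnside_mark K \<one>\<^bsub>?B\<^esub>"
        using burnside_mark_ops(5)[OF K u u] by simp
    qed (simp_all add: core_map_closed u)
  qed
  also have "\<dots> \<longleftrightarrow> (\<forall>N. N \<lhd> G \<longrightarrow>
      (\<Sum>g\<in>carrier G. burnside_mark (generate G (insert g N)) d) = 0)"
  proof -
    \<comment> \<open>A second triangular system for the same \<open>D\<close>, now with
      coefficients 1 and with sums of marks of \<open>d\<close> as values.\<close>
    have eq: "(\<Sum>M | M \<lhd> G. (if N \<subseteq> M then 1 else 0) * D M) =
        of_int (\<Sum>g\<in>carrier G. burnside_mark (generate G (insert g N)) d)" if "N \<lhd> G" for N
      using core_size_sum_eq_mark_sum[OF d that] by (simp add: D_def)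
    show ?thesis
    proof
      assume "\<forall>M. M \<lhd> G \<longrightarrow> D M = 0"
      then have "(of_int (\<Sum>g\<in>carrier G. burnside_mark (generate G (insert g N)) d) :: rat) = 0"
        if "N \<lhd> G" for N unfolding eq[OF that, symmetric] by simp
      then show "\<forall>N. N \<lhd> G \<longrightarrow> (\<Sum>g\<in>carrier G. burnside_mark (generate G (insert g N)) d) = 0"
        using of_int_eq_0_iff by blast
    next
      assume "\<forall>N. N \<lhd> G \<longrightarrow> (\<Sum>g\<in>carrier G. burnside_mark (generate G (insert g N)) d) = 0"
      then have "(\<Sum>M | M \<lhd> G. (if N \<subseteq> M then 1 else 0) * D M) = 0" if "N \<lhd> G" for N
        unfolding eq[OF that] using that by simp
      then show "\<forall>M. M \<lhd> G \<longrightarrow> D M = 0"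
        using upper_sums_zero_imp_zero[OF finite_normal, of "\<lambda>M. 1" D] by auto
    qed
  qed
  also have "\<dots> \<longleftrightarrow> (\<forall>N. N \<lhd> G \<longrightarrow> (\<forall>g\<in>carrier G. burnside_mark (generate G (insert g N)) u = 1))"
  proof -
    have "(\<Sum>g\<in>carrier G. burnside_mark (generate G (insert g N)) d) = 0 \<longleftrightarrow>
        (\<forall>g\<in>carrier G. burnside_mark (generate G (insert g N)) u = 1)" if N: "N \<lhd> G" for N
    proof -
      \<comment> \<open>The sign is reversed because the marks of \<open>d\<close> are at most 0 by
        \<open>le\<close>, while \<open>sum_nonneg_eq_0_iff\<close> asks for nonnegative
        terms.\<close>
      have "0 \<le> - burnside_mark (generate G (insert g N)) d" if "g \<in> carrier G" for g
        using mark_d le generate_insert_normal(1)[OF N that] by simp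
      then have "(\<Sum>g\<in>carrier G. - burnside_mark (generate G (insert g N)) d) = 0 \<longleftrightarrow>
          (\<forall>g\<in>carrier G. - burnside_mark (generate G (insert g N)) d = 0)"
        by (intro sum_nonneg_eq_0_iff finite_carrier)
      then have "(\<Sum>g\<in>carrier G. burnside_mark (generate G (insert g N)) d) = 0 \<longleftrightarrow>
          (\<forall>g\<in>carrier G. burnside_mark (generate G (insert g N)) d = 0)"
        by (simp add: sum_negf)
      then show ?thesis using mark_d generate_insert_normal(1)[OF N] by simp
    qed
    then show ?thesis by blast
  qed
  also have "\<dots> \<longleftrightarrow> ?R"
    using cyclic_mod_core_iff generate_insert_normal(1) by metis
  finally show ?thesis .
qed


section \<open>Families of classes and the units they define\<close>

lemma ncc_classesD:
  assumes "S \<subseteq> ncc_classes G"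
  shows "S \<subseteq> conj_class G ` {H. subgroup H G}"
    and "\<lbrakk>subgroup K G; conj_class G K \<in> S\<rbrakk> \<Longrightarrow>
      \<not> cyclic_group ((G\<lparr>carrier := K\<rparr>) Mod (normal_core G K))"
proof -
  show "S \<subseteq> conj_class G ` {H. subgroup H G}"
    using assms by (auto simp: ncc_classes_def ncc_subgroups_def)
  assume K: "subgroup K G" and "conj_class G K \<in> S"
  then obtain H where H: "subgroup H G"
    and nc: "\<not> cyclic_group ((G\<lparr>carrier := H\<rparr>) Mod (normal_core G H))"
    and "conj_class G H = conj_class G K"
    using assms by (auto simp: ncc_classes_def ncc_subgroups_def)
  \<comment> \<open>The class of \<open>K\<close> may be recorded through another representative
    \<open>H\<close>; if \<open>K\<close> were cyclic modulo its core, its conjugate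
    \<open>H\<close> would be as well.\<close>
  then have "H \<in> conj_class G K"
    using conj_class_eq_iff subgroup.subset[OF K] subgroup.subset[OF H] by blast
  then obtain x where "x \<in> carrier G" "H = conjg x K" by (auto simp: conj_class_mem_iff)
  then show "\<not> cyclic_group ((G\<lparr>carrier := K\<rparr>) Mod (normal_core G K))"
    using nc cyclic_mod_core_conjg[OF K] by blast
qed

lemma rat_mark_double_set_idem:
  assumes "S \<subseteq> ncc_classes G" "subgroup K G"
  shows "rat_burnside_mark K ([(2::int)] \<cdot>\<^bsub>rat_burnside_ring G\<^esub> set_idem G S) =
    (if conj_class G K \<in> S then 2 else 0)"
  using rat_mark_ops(3)[OF assms(2) set_idem_spec(1) set_idem_spec(1), of S S 2]
    set_idem_spec(2)[OF _ assms(2), of S] ncc_classesD(1)[OF assms(1)] by simp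

lemma double_set_idem_closed:
  "S \<subseteq> ncc_classes G \<Longrightarrow>
    [(2::int)] \<cdot>\<^bsub>rat_burnside_ring G\<^esub> set_idem G S \<in> carrier (rat_burnside_ring G)"
  by (intro qb.int_pow_closed set_idem_spec(1) ncc_classesD(1))

text \<open>Rational elements are separated by marks, so \<open>2 e_S\<close> is integral iff some
  element of the Burnside ring has its marks. Membership is then decided without
  idempotents.\<close>

lemma S2_iff:
  "S \<in> S2 G \<longleftrightarrow> S \<subseteq> ncc_classes G \<and> (\<exists>y\<in>carrier (burnside_ring G).
     \<forall>K. subgroup K G \<longrightarrow> burnside_mark K y = (if conj_class G K \<in> S then 2 else 0))"
proof (cases "S \<subseteq> ncc_classes G")
  case True
  let ?e = "[(2::int)] \<cdot>\<^bsub>rat_burnside_ring G\<^esub> set_idem G S"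
  have eq: "?e = burnside_to_rat G y \<longleftrightarrow>
      (\<forall>K. subgroup K G \<longrightarrow> burnside_mark K y = (if conj_class G K \<in> S then 2 else 0))"
    (is "_ \<longleftrightarrow> ?R") if y: "y \<in> carrier (burnside_ring G)" for y
  proof
    assume eq: "?e = burnside_to_rat G y"
    show ?R
    proof (intro allI impI)
      fix K assume K: "subgroup K G"
      have "of_int (burnside_mark K y) = (if conj_class G K \<in> S then 2 else (0::rat))"
        using rat_mark_double_set_idem[OF True K] rat_mark_to_rat[OF y K] eq by simp
      then show "burnside_mark K y = (if conj_class G K \<in> S then 2 else 0)"
        by (simp split: if_splits)
    qed
  next
    assume ?R
    then show "?e = burnside_to_rat G y"
      using rat_mark_double_set_idem[OF True] rat_mark_to_rat[OF y]
      by (intro rat_burnside_eqI double_set_idem_closed[OF True] to_rat_closed[OF y]) auto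
  qed
  show ?thesis
    using True unfolding S2_def image_iff mem_Collect_eq by (simp only: eq cong: bex_cong)
qed (simp add: S2_def)

lemma burnside_mark_unit:
  assumes "u \<in> Units (burnside_ring G)" "subgroup K G"
  shows "burnside_mark K u = 1 \<or> burnside_mark K u = - 1"
proof -
  obtain v where uv: "u \<in> carrier (burnside_ring G)" "v \<in> carrier (burnside_ring G)"
    "u \<otimes>\<^bsub>burnside_ring G\<^esub> v = \<one>\<^bsub>burnside_ring G\<^esub>"
    using assms(1) by (auto simp: Units_def)
  have "burnside_mark K u * burnside_mark K v = 1"
    using burnside_mark_ops(3,5)[OF assms(2) uv(1,2)] uv(3) by simp
  then show ?thesis by (auto simp: zmult_eq_1_iff)
qed

lemma core_units_image:
  "burnside_to_rat G ` core_units G =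
     {\<one>\<^bsub>rat_burnside_ring G\<^esub> \<ominus>\<^bsub>rat_burnside_ring G\<^esub>
        [(2::int)] \<cdot>\<^bsub>rat_burnside_ring G\<^esub> (set_idem G S) | S. S \<in> S2 G}"
  (is "_ = {?e S | S. S \<in> S2 G}")
proof -
  let ?B = "burnside_ring G"
  have closed: "?e S \<in> carrier (rat_burnside_ring G)" if "S \<subseteq> ncc_classes G" for S
    using double_set_idem_closed[OF that] by simp
  have mark_e: "rat_burnside_mark K (?e S) = (if conj_class G K \<in> S then - 1 else 1)"
    if "S \<subseteq> ncc_classes G" "subgroup K G" for S K
    using rat_mark_ops(2,4)[OF that(2) qb.one_closed double_set_idem_closed[OF that(1)]]
      rat_mark_double_set_idem[OF that] by simp
  have "\<exists>S\<in>S2 G. burnside_to_rat G u = ?e S" if u: "u \<in> core_units G" for u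
  proof -
    have unit: "u \<in> Units ?B" "core_map G u = \<one>\<^bsub>?B\<^esub>" using u by (auto simp: core_units_def)
    have uB: "u \<in> carrier ?B" using unit(1) by (simp add: Units_def)
    note pm = burnside_mark_unit[OF unit(1)]
    have le: "burnside_mark K u \<le> 1" if "subgroup K G" for K using pm[OF that] by auto
    \<comment> \<open>Marks of \<open>u\<close> are 1 or -1 and \<open>1 - 2 e_S\<close> has mark -1
      exactly on \<open>S\<close>, so no other family is possible.\<close>
    define S where "S = {conj_class G K | K. subgroup K G \<and> burnside_mark K u = - 1}"
    have mem: "conj_class G K \<in> S \<longleftrightarrow> burnside_mark K u = - 1" if K: "subgroup K G" for K
    proof
      assume "conj_class G K \<in> S"
      then obtain L where L: "subgroup L G" "burnside_mark L u = - 1" "conj_class G K = conj_class G L"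
        by (auto simp: S_def)
      then have "K \<in> conj_class G L"
        using conj_class_eq_iff subgroup.subset[OF K] subgroup.subset[OF L(1)] by blast
      then show "burnside_mark K u = - 1" using burnside_mark_conj_class[OF uB L(1)] L(2) by simp
    qed (use K in \<open>auto simp: S_def\<close>)
    have "\<not> cyclic_group ((G\<lparr>carrier := K\<rparr>) Mod (normal_core G K))"
      if "subgroup K G" "burnside_mark K u = - 1" for K
      using core_map_eq_one_iff[OF uB le] unit(2) that by force
    then have ncc: "S \<subseteq> ncc_classes G"
      by (auto simp: S_def ncc_classes_def ncc_subgroups_def)
    \<comment> \<open>The integral element \<open>1 - u\<close> has the marks of
      \<open>2 e_S\<close> and witnesses that \<open>S\<close> is admissible.\<close>
    have "burnside_mark K (\<one>\<^bsub>?B\<^esub> \<ominus>\<^bsub>?B\<^esub> u) = (if conj_class G K \<in> S then 2 else 0)"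
      if K: "subgroup K G" for K
      using burnside_mark_ops(2,5)[OF K br.one_closed uB] mem[OF K] pm[OF K] by auto
    then have "S \<in> S2 G"
      unfolding S2_iff using ncc uB by (intro conjI bexI[of _ "\<one>\<^bsub>?B\<^esub> \<ominus>\<^bsub>?B\<^esub> u"]) simp_all
    moreover have "burnside_to_rat G u = ?e S"
    proof (rule rat_burnside_eqI[OF to_rat_closed[OF uB] closed[OF ncc]])
      fix K assume K: "subgroup K G"
      show "rat_burnside_mark K (burnside_to_rat G u) = rat_burnside_mark K (?e S)"
        using mark_e[OF ncc K] rat_mark_to_rat[OF uB K] mem[OF K] pm[OF K] by auto
    qed
    ultimately show ?thesis by blast
  qed
  moreover have "?e S \<in> burnside_to_rat G ` core_units G" if S: "S \<in> S2 G" for S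
  proof -
    obtain y where ncc: "S \<subseteq> ncc_classes G" and y: "y \<in> carrier ?B"
      and mark_y: "\<And>K. subgroup K G \<Longrightarrow> burnside_mark K y = (if conj_class G K \<in> S then 2 else 0)"
      using S unfolding S2_iff by blast
    define u where "u = \<one>\<^bsub>?B\<^esub> \<ominus>\<^bsub>?B\<^esub> y"
    have uB: "u \<in> carrier ?B" using y by (simp add: u_def)
    have mark_u: "burnside_mark K u = (if conj_class G K \<in> S then - 1 else 1)"
      if K: "subgroup K G" for K
      unfolding u_def using burnside_mark_ops(2,5)[OF K br.one_closed y] mark_y[OF K] by auto
    \<comment> \<open>All marks of \<open>u\<close> are 1 or -1, so \<open>u\<close> is its own
      inverse.\<close>
    have "u \<otimes>\<^bsub>?B\<^esub> u = \<one>\<^bsub>?B\<^esub>"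
    proof (rule burnside_eqI)
      fix K assume K: "subgroup K G"
      show "burnside_mark K (u \<otimes>\<^bsub>?B\<^esub> u) = burnside_mark K \<one>\<^bsub>?B\<^esub>"
        using burnside_mark_ops(3,5)[OF K uB uB] mark_u[OF K] by auto
    qed (use uB in simp_all)
    then have "u \<in> Units ?B" using uB by (auto simp: Units_def)
    moreover have "core_map G u = \<one>\<^bsub>?B\<^esub>"
      using core_map_eq_one_iff[OF uB] mark_u ncc_classesD(2)[OF ncc] by auto
    moreover have "?e S = burnside_to_rat G u"
    proof (rule rat_burnside_eqI[OF closed[OF ncc] to_rat_closed[OF uB]])
      fix K assume K: "subgroup K G"
      show "rat_burnside_mark K (?e S) = rat_burnside_mark K (burnside_to_rat G u)"
        using mark_e[OF ncc K] rat_mark_to_rat[OF uB K] mark_u[OF K] by auto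
    qed
    ultimately show ?thesis by (auto simp: core_units_def)
  qed
  ultimately show ?thesis by blast
qed

section \<open>The vector space of admissible families\<close>

lemma empty_in_S2: "{} \<in> S2 G"
  unfolding S2_iff using burnside_mark_ops(6)[OF _ br.zero_closed br.zero_closed]
  by (intro conjI bexI[of _ "\<zero>\<^bsub>burnside_ring G\<^esub>"]) auto

text \<open>Symmetric difference corresponds to the product of units:
  \<open>(1 - x) (1 - y) = 1 - (x + y - x y)\<close>. On the classes common to \<open>S\<close> and
  \<open>T\<close> the product \<open>x y\<close> has mark 4, which cancels 2 + 2.\<close>

lemma sym_diff_in_S2:
  assumes "S \<in> S2 G" "T \<in> S2 G"
  shows "sym_diff S T \<in> S2 G"
proof -
  let ?B = "burnside_ring G"
  obtain x where x: "x \<in> carrier ?B"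
    "\<And>K. subgroup K G \<Longrightarrow> burnside_mark K x = (if conj_class G K \<in> S then 2 else 0)"
    using assms(1) unfolding S2_iff by blast
  obtain y where y: "y \<in> carrier ?B"
    "\<And>K. subgroup K G \<Longrightarrow> burnside_mark K y = (if conj_class G K \<in> T then 2 else 0)"
    using assms(2) unfolding S2_iff by blast
  let ?z = "(x \<oplus>\<^bsub>?B\<^esub> y) \<ominus>\<^bsub>?B\<^esub> x \<otimes>\<^bsub>?B\<^esub> y"
  have "burnside_mark K ?z = (if conj_class G K \<in> sym_diff S T then 2 else 0)" if K: "subgroup K G" for K
    using burnside_mark_ops(2)[OF K br.a_closed[OF x(1) y(1)] br.m_closed[OF x(1) y(1)]]
      burnside_mark_ops(1,3)[OF K x(1) y(1)] x(2)[OF K] y(2)[OF K] by auto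
  moreover have "sym_diff S T \<subseteq> ncc_classes G" using assms by (auto simp: S2_def)
  ultimately show ?thesis
    unfolding S2_iff using x(1) y(1) by (intro conjI bexI[of _ ?z]) simp_all
qed

lemma module_S2_space: "module (residue_ring 2) (S2_space G)"
proof -
  interpret residues 2 "residue_ring 2" by unfold_locales simp_all
  have scalar: "c = 0 \<or> c = 1" if "c \<in> carrier (residue_ring 2)" for c
    using that by (auto simp: residue_ring_def)
  show ?thesis
  proof (rule moduleI)
    show "cring (residue_ring 2)" by (rule cring)
    show "abelian_group (S2_space G)"
      by (rule abelian_groupI) (auto simp: S2_space_def empty_in_S2 intro!: sym_diff_in_S2)
  next
    fix a b x
    assume "a \<in> carrier (residue_ring 2)" "b \<in> carrier (residue_ring 2)"
    \<comment> \<open>In the case \<open>a = b = 1\<close> the scalar sum is 0 modulo 2, matching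
      the empty symmetric difference of \<open>x\<close> with itself.\<close>
    then have "a = 0 \<or> a = 1" "b = 0 \<or> b = 1" using scalar by blast+
    then show "(a \<oplus>\<^bsub>residue_ring 2\<^esub> b) \<odot>\<^bsub>S2_space G\<^esub> x =
        a \<odot>\<^bsub>S2_space G\<^esub> x \<oplus>\<^bsub>S2_space G\<^esub> b \<odot>\<^bsub>S2_space G\<^esub> x"
      and "(a \<otimes>\<^bsub>residue_ring 2\<^esub> b) \<odot>\<^bsub>S2_space G\<^esub> x =
        a \<odot>\<^bsub>S2_space G\<^esub> (b \<odot>\<^bsub>S2_space G\<^esub> x)"
      by (auto simp: S2_space_def residue_ring_def)
  qed (simp_all add: S2_space_def residue_ring_def empty_in_S2)
qed

end

lemma field_residue_ring_2: "field (residue_ring 2)"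
proof -
  interpret residues_prime 2 "residue_ring 2" by unfold_locales simp_all
  show ?thesis by (rule is_field)
qed

text \<open>The equation is stated in the rational ring, where the idempotents live, with
  \<open>burnside_to_rat\<close> as the inclusion. The field statement makes the module over
  \<open>residue_ring 2\<close> a vector space.\<close>

theorem theorem6p2:
  fixes G (structure)
  assumes "group G" and "finite (carrier G)"
  shows "burnside_to_rat G ` core_units G =
           {\<one>\<^bsub>rat_burnside_ring G\<^esub> \<ominus>\<^bsub>rat_burnside_ring G\<^esub>
              [(2::int)] \<cdot>\<^bsub>rat_burnside_ring G\<^esub> (set_idem G S) | S. S \<in> S2 G}
         \<and> field (residue_ring 2) \<and> module (residue_ring 2) (S2_space G)"
proof -
  interpret finite_group G
    using assms by (simp add: finite_group_def finite_group_axioms_def)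
  show ?thesis
    using core_units_image field_residue_ring_2 module_S2_space by blast
qed

end
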